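(* Let $\mathcal M$, $\mathcal N$ be smooth Riemannian manifolds of dimensions $n\ge 2$ and $d\ge 2$, respectively. Let $u\colon\mathcal M\to\mathcal N$ be a $p$-harmonic map, $p>1$. Then, at any point $q\in\mathcal M$ where $\nabla u(q)\ne 0$, we have $$\kappa(p,n)\,\bigl|\nabla|\nabla u|\bigr|^2\le|\nabla^2u|^2,$$ where $$\kappa(p,n)=\begin{cases}1+\dfrac{(p-1)^2}{n-1} & \text{for } 1\le p\le 1+\dfrac{n-1}{\sqrt{2n}-1},\\[2mm] 2-\dfrac{(p-\sqrt{2n})^2}{(\sqrt n-\sqrt2)^2} & \text{for } 1+\dfrac{n-1}{\sqrt{2n}-1}\le p\le\sqrt{2n},\\[2mm] 2 & \text{for } p\ge\sqrt{2n}\end{cases}$$ is the sharp constant in this inequality, in the sense that there is a map that solves the $p$-harmonic equation at $q$ and achieves equality at that point.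
   Context: $\mathcal N$ is assumed to be isometrically embedded into some Euclidean space $\mathbb R^L$. A $p$-harmonic map is a critical point of $E_p(u)=\int_{\mathcal M}|\nabla u|^p$ among $u\in W^{1,p}(\mathcal M,\mathcal N)$; its Euler--Lagrange equation (the $p$-harmonic equation) is $-\operatorname{div}_{\mathcal M}(|\nabla u|^{p-2}\nabla u)=|\nabla u|^{p-2}A(\nabla u,\nabla u)$, where $A$ is the second fundamental form of the isometric embedding $\mathcal N\subset\mathbb R^L$. Here $\nabla^2u$ is the covariant Hessian of $u$, i.e. the covariant derivative of $du$ as a section of $T^*\mathcal M\otimes u^*T\mathcal N$, and $|\nabla u|$, $|\nabla^2 u|$ are the Hilbert--Schmidt norms. In normal coordinates around $q\in\mathcal M$ and $u(q)\in\mathcal N$, with $u_i^a$, $u_{ij}^a$ the first and second derivatives of the components of $u$, the $p$-harmonic equation at a point $q$ with $\nabla u(q)\neq0$ takes the form $$\sum_{i=1}^n u_{ii}^a+\frac{p-2}{|\nabla u|^2}\sum_{i,j=1}^n\sum_{b=1}^d u_i^au_j^bu_{ij}^b=0,\qquad a\in\{1,\dots,d\}.$$ "Solves the $p$-harmonic equation at $q$" means that the equation holds at the single point $q$. For $n=2$ one has $1+\frac{n-1}{\sqrt{2n}-1}=2=\sqrt{2n}$, so the middle range degenerates and the formula is read as $\kappa(p,2)=\min\{1+(p-1)^2,2\}$. *)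

theory Defs
  imports "HOL-Analysis.Analysis"
begin

fun Ck_on :: "nat \<Rightarrow> 'a::real_normed_vector set \<Rightarrow> ('a \<Rightarrow> 'b::real_normed_vector) \<Rightarrow> bool" where
  "Ck_on 0 S f \<longleftrightarrow> continuous_on S f"
| "Ck_on (Suc k) S f \<longleftrightarrow>
     (\<forall>x\<in>S. f differentiable (at x)) \<and>
     (\<forall>v. Ck_on k S (\<lambda>x. frechet_derivative f (at x) v))"

definition smooth_on :: "'a::real_normed_vector set \<Rightarrow> ('a \<Rightarrow> 'b::real_normed_vector) \<Rightarrow> bool" where
  "smooth_on S f \<longleftrightarrow> (\<forall>k. Ck_on k S f)"

definition pd :: "'n::finite \<Rightarrow> (real^'n \<Rightarrow> 'b::real_normed_vector) \<Rightarrow> real^'n \<Rightarrow> 'b" where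
  "pd i f x = frechet_derivative f (at x) (axis i 1)"

type_synonym ('m, 'n) chart = "'m set \<times> ('m \<Rightarrow> real^'n)"

definition cdom :: "('m, 'n) chart \<Rightarrow> 'm set" where
  "cdom c = fst c"

definition cmap :: "('m, 'n) chart \<Rightarrow> 'm \<Rightarrow> real^'n" where
  "cmap c = snd c"

definition cimg :: "('m, 'n) chart \<Rightarrow> (real^'n) set" where
  "cimg c = cmap c ` cdom c"

definition cinv :: "('m, 'n) chart \<Rightarrow> real^'n \<Rightarrow> 'm" where
  "cinv c = inv_into (cdom c) (cmap c)"

text \<open>The metric is given by its coordinate matrices: \<open>metric M c x\<close> is \<open>(g\<^sub>i\<^sub>j)\<close> in the chart
  \<open>c\<close> at the coordinate point \<open>x \<in> cimg c\<close>.\<close>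

record ('m, 'n) manifold =
  mtop :: "'m topology"
  atlas :: "('m, 'n) chart set"
  metric :: "('m, 'n) chart \<Rightarrow> real^'n \<Rightarrow> real^'n^'n"

definition riemannian_manifold :: "('m, 'n::finite) manifold \<Rightarrow> bool" where
  "riemannian_manifold M \<longleftrightarrow>
     topspace (mtop M) \<noteq> {} \<and> Hausdorff_space (mtop M) \<and> second_countable (mtop M) \<and>
     topspace (mtop M) = (\<Union>c\<in>atlas M. cdom c) \<and>
     (\<forall>c\<in>atlas M. openin (mtop M) (cdom c) \<and> open (cimg c) \<and>
        homeomorphic_map (subtopology (mtop M) (cdom c)) (top_of_set (cimg c)) (cmap c)) \<and>
     (\<forall>c\<in>atlas M. \<forall>c'\<in>atlas M.
        smooth_on (cmap c ` (cdom c \<inter> cdom c')) (cmap c' \<circ> cinv c)) \<and>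
     (\<forall>c\<in>atlas M.
        (\<forall>i j. smooth_on (cimg c) (\<lambda>x. metric M c x $ i $ j)) \<and>
        (\<forall>x\<in>cimg c. transpose (metric M c x) = metric M c x \<and>
           (\<forall>v. v \<noteq> 0 \<longrightarrow> 0 < v \<bullet> (metric M c x *v v)))) \<and>
     (\<forall>c\<in>atlas M. \<forall>c'\<in>atlas M. \<forall>x\<in>cmap c ` (cdom c \<inter> cdom c').
        (let J = matrix (frechet_derivative (cmap c' \<circ> cinv c) (at x)) in
         metric M c x = transpose J ** metric M c' ((cmap c' \<circ> cinv c) x) ** J))"

definition ginv :: "('m, 'n::finite) manifold \<Rightarrow> ('m, 'n) chart \<Rightarrow> real^'n \<Rightarrow> 'n \<Rightarrow> 'n \<Rightarrow> real" where
  "ginv M c x i j = matrix_inv (metric M c x) $ i $ j"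

definition vol_density :: "('m, 'n::finite) manifold \<Rightarrow> ('m, 'n) chart \<Rightarrow> real^'n \<Rightarrow> real" where
  "vol_density M c x = sqrt (det (metric M c x))"

definition christoffel ::
  "('m, 'n::finite) manifold \<Rightarrow> ('m, 'n) chart \<Rightarrow> real^'n \<Rightarrow> 'n \<Rightarrow> 'n \<Rightarrow> 'n \<Rightarrow> real" where
  "christoffel M c x k i j = (1/2) * (\<Sum>l\<in>UNIV. ginv M c x k l *
      (pd i (\<lambda>y. metric M c y $ j $ l) x + pd j (\<lambda>y. metric M c y $ i $ l) x
       - pd l (\<lambda>y. metric M c y $ i $ j) x))"

text \<open>The Riemannian volume measure: the unique Borel measure on \<open>M\<close> with density
  \<open>sqrt (det g)\<close> in every chart.\<close>

definition is_riemannian_volume :: "('m, 'n::finite) manifold \<Rightarrow> 'm measure \<Rightarrow> bool" where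
  "is_riemannian_volume M \<mu> \<longleftrightarrow>
     space \<mu> = topspace (mtop M) \<and>
     sets \<mu> = sigma_sets (topspace (mtop M)) {U. openin (mtop M) U} \<and>
     (\<forall>c\<in>atlas M. \<forall>A\<in>sets \<mu>. A \<subseteq> cdom c \<longrightarrow>
        emeasure \<mu> A = (\<integral>\<^sup>+x\<in>cmap c ` A. ennreal (vol_density M c x) \<partial>lborel))"

text \<open>\<open>N\<close> carries the Riemannian metric induced from the ambient inner product. It is not
  assumed to be closed in the ambient space.\<close>

definition embedded_submanifold :: "nat \<Rightarrow> 'l::euclidean_space set \<Rightarrow> bool" where
  "embedded_submanifold d N \<longleftrightarrow> N \<noteq> {} \<and>
     (\<forall>y\<in>N. \<exists>(V :: 'l set) (W :: 'l set) (\<Phi> :: 'l \<Rightarrow> 'l) (\<Psi> :: 'l \<Rightarrow> 'l) (S :: 'l set).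
        open V \<and> y \<in> V \<and> open W \<and> \<Phi> ` V = W \<and> \<Psi> ` W = V \<and>
        (\<forall>z\<in>V. \<Psi> (\<Phi> z) = z) \<and> (\<forall>w\<in>W. \<Phi> (\<Psi> w) = w) \<and>
        smooth_on V \<Phi> \<and> smooth_on W \<Psi> \<and>
        subspace S \<and> dim S = d \<and> \<Phi> ` (V \<inter> N) = W \<inter> S)"

text \<open>Tangent vectors are velocities of curves in \<open>N\<close>; only the behaviour of the curve near
  \<open>0\<close> matters.\<close>

definition tangent_space :: "'l::euclidean_space set \<Rightarrow> 'l \<Rightarrow> 'l set" where
  "tangent_space N y =
     {v. \<exists>\<gamma> :: real \<Rightarrow> 'l. (\<forall>t. \<gamma> t \<in> N) \<and> \<gamma> 0 = y \<and> (\<gamma> has_vector_derivative v) (at 0)}"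

definition tangential :: "'l::euclidean_space set \<Rightarrow> 'l \<Rightarrow> 'l \<Rightarrow> 'l" where
  "tangential N y v =
     (THE w. w \<in> tangent_space N y \<and> (\<forall>s\<in>tangent_space N y. (v - w) \<bullet> s = 0))"

text \<open>The second fundamental form \<open>A(X, Y) = - (D\<^sub>X Z)\<^sup>\<bottom>\<close>, for any local tangential
  extension \<open>Z\<close> of \<open>Y\<close>. The sign is the one for which harmonic maps satisfy
  \<open>- \<Delta>u = A(\<nabla>u, \<nabla>u)\<close>; for the unit sphere \<open>A\<^sub>y(X, Y) = (X \<bullet> Y) y\<close>.\<close>

definition second_fundamental_form :: "'l::euclidean_space set \<Rightarrow> 'l \<Rightarrow> 'l \<Rightarrow> 'l \<Rightarrow> 'l" where
  "second_fundamental_form N y X Y =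
     (THE a. \<forall>V Z. open V \<and> y \<in> V \<and> smooth_on V Z \<and>
        (\<forall>z\<in>V \<inter> N. Z z \<in> tangent_space N z) \<and> Z y = Y \<longrightarrow>
        a = - (frechet_derivative Z (at y) X - tangential N y (frechet_derivative Z (at y) X)))"

text \<open>Maps \<open>u : M \<rightarrow> N\<close> are functions into the ambient space of \<open>N\<close>. All quantities
  below are computed in a chart \<open>c\<close> at a coordinate point \<open>x \<in> cimg c\<close>; the norms do not depend on
  the choice of the chart.\<close>

definition loc :: "('m, 'n) chart \<Rightarrow> ('m \<Rightarrow> 'l) \<Rightarrow> real^'n \<Rightarrow> 'l" where
  "loc c u = u \<circ> cinv c"

definition smooth_map :: "('m, 'n::finite) manifold \<Rightarrow> 'l::euclidean_space set \<Rightarrow> ('m \<Rightarrow> 'l) \<Rightarrow> bool" where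
  "smooth_map M N u \<longleftrightarrow> (\<forall>x\<in>topspace (mtop M). u x \<in> N) \<and>
     (\<forall>c\<in>atlas M. smooth_on (cimg c) (loc c u))"

definition C2_near :: "('m, 'n::finite) chart \<Rightarrow> ('m \<Rightarrow> 'l::euclidean_space) \<Rightarrow> 'm \<Rightarrow> bool" where
  "C2_near c u q \<longleftrightarrow> (\<exists>V. open V \<and> cmap c q \<in> V \<and> V \<subseteq> cimg c \<and> Ck_on 2 V (loc c u))"

definition grad_norm ::
  "('m, 'n::finite) manifold \<Rightarrow> ('m, 'n) chart \<Rightarrow> ('m \<Rightarrow> 'l::euclidean_space) \<Rightarrow> real^'n \<Rightarrow> real" where
  "grad_norm M c u x =
     sqrt (\<Sum>i\<in>UNIV. \<Sum>j\<in>UNIV. ginv M c x i j * (pd i (loc c u) x \<bullet> pd j (loc c u) x))"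

definition grad_grad_norm ::
  "('m, 'n::finite) manifold \<Rightarrow> ('m, 'n) chart \<Rightarrow> ('m \<Rightarrow> 'l::euclidean_space) \<Rightarrow> real^'n \<Rightarrow> real" where
  "grad_grad_norm M c u x =
     sqrt (\<Sum>i\<in>UNIV. \<Sum>j\<in>UNIV. ginv M c x i j * (pd i (grad_norm M c u) x * pd j (grad_norm M c u) x))"

text \<open>The covariant derivative of \<open>du\<close> as a section of \<open>T\<^sup>*M \<otimes> u\<^sup>*TN\<close>. The Levi-Civita
  connection of \<open>N\<close> is the tangential part of the flat ambient connection, hence so is the
  induced connection on \<open>u\<^sup>*TN\<close>.\<close>

definition hess ::
  "('m, 'n::finite) manifold \<Rightarrow> ('m, 'n) chart \<Rightarrow> 'l::euclidean_space set \<Rightarrow> ('m \<Rightarrow> 'l) \<Rightarrow> real^'n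
     \<Rightarrow> 'n \<Rightarrow> 'n \<Rightarrow> 'l" where
  "hess M c N u x i j = tangential N (loc c u x) (pd i (pd j (loc c u)) x)
     - (\<Sum>k\<in>UNIV. christoffel M c x k i j *\<^sub>R pd k (loc c u) x)"

definition hess_norm ::
  "('m, 'n::finite) manifold \<Rightarrow> ('m, 'n) chart \<Rightarrow> 'l::euclidean_space set \<Rightarrow> ('m \<Rightarrow> 'l) \<Rightarrow> real^'n
     \<Rightarrow> real" where
  "hess_norm M c N u x =
     sqrt (\<Sum>i\<in>UNIV. \<Sum>j\<in>UNIV. \<Sum>k\<in>UNIV. \<Sum>l\<in>UNIV.
        ginv M c x i k * ginv M c x j l * (hess M c N u x i j \<bullet> hess M c N u x k l))"

text \<open>Divergence of an \<open>\<real>\<^sup>L\<close>-valued vector field with contravariant components \<open>\<xi> i\<close>.\<close>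

definition divergence ::
  "('m, 'n::finite) manifold \<Rightarrow> ('m, 'n) chart \<Rightarrow> ('n \<Rightarrow> real^'n \<Rightarrow> 'l::euclidean_space) \<Rightarrow> real^'n \<Rightarrow> 'l" where
  "divergence M c \<xi> x =
     (1 / vol_density M c x) *\<^sub>R (\<Sum>i\<in>UNIV. pd i (\<lambda>y. vol_density M c y *\<^sub>R \<xi> i y) x)"

definition solves_p_harmonic_eq_at ::
  "('m, 'n::finite) manifold \<Rightarrow> ('m, 'n) chart \<Rightarrow> 'l::euclidean_space set \<Rightarrow> real \<Rightarrow> ('m \<Rightarrow> 'l)
     \<Rightarrow> real^'n \<Rightarrow> bool" where
  "solves_p_harmonic_eq_at M c N p u x \<longleftrightarrow>
     - divergence M c (\<lambda>i y. (grad_norm M c u y powr (p - 2)) *\<^sub>R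
          (\<Sum>j\<in>UNIV. ginv M c y i j *\<^sub>R pd j (loc c u) y)) x
     = (grad_norm M c u x powr (p - 2)) *\<^sub>R
         (\<Sum>i\<in>UNIV. \<Sum>j\<in>UNIV. ginv M c x i j *\<^sub>R
            second_fundamental_form N (loc c u x) (pd i (loc c u) x) (pd j (loc c u) x))"

definition locally_integrable :: "(real^'n::finite) set \<Rightarrow> (real^'n \<Rightarrow> 'l::euclidean_space) \<Rightarrow> bool" where
  "locally_integrable \<Omega> f \<longleftrightarrow> (\<forall>K. compact K \<and> K \<subseteq> \<Omega> \<longrightarrow> set_integrable lborel K f)"

definition weak_pd ::
  "(real^'n::finite) set \<Rightarrow> 'n \<Rightarrow> (real^'n \<Rightarrow> 'l::euclidean_space) \<Rightarrow> (real^'n \<Rightarrow> 'l) \<Rightarrow> bool" where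
  "weak_pd \<Omega> i f D \<longleftrightarrow> locally_integrable \<Omega> f \<and> locally_integrable \<Omega> D \<and>
     (\<forall>\<eta> :: real^'n \<Rightarrow> real.
        smooth_on UNIV \<eta> \<and> (\<exists>K. compact K \<and> K \<subseteq> \<Omega> \<and> (\<forall>x. x \<notin> K \<longrightarrow> \<eta> x = 0)) \<longrightarrow>
        (LINT x:\<Omega>|lborel. pd i \<eta> x *\<^sub>R f x) = - (LINT x:\<Omega>|lborel. \<eta> x *\<^sub>R D x))"

text \<open>\<open>e\<close> is (a representative of) the function \<open>|\<nabla>u|\<close> on \<open>M\<close> for a weakly
  differentiable \<open>u\<close>.\<close>

definition weak_grad_norm ::
  "('m, 'n::finite) manifold \<Rightarrow> 'm measure \<Rightarrow> ('m \<Rightarrow> 'l::euclidean_space) \<Rightarrow> ('m \<Rightarrow> real) \<Rightarrow> bool" where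
  "weak_grad_norm M \<mu> u e \<longleftrightarrow> e \<in> borel_measurable \<mu> \<and>
     (\<forall>c\<in>atlas M. \<exists>D. (\<forall>i. weak_pd (cimg c) i (loc c u) (D i)) \<and>
        (AE x in lborel. x \<in> cimg c \<longrightarrow>
           e (cinv c x) = sqrt (\<Sum>i\<in>UNIV. \<Sum>j\<in>UNIV. ginv M c x i j * (D i x \<bullet> D j x))))"

definition W1p ::
  "('m, 'n::finite) manifold \<Rightarrow> 'm measure \<Rightarrow> 'l::euclidean_space set \<Rightarrow> real \<Rightarrow> ('m \<Rightarrow> 'l) set" where
  "W1p M \<mu> N p = {u. (\<forall>x\<in>topspace (mtop M). u x \<in> N) \<and>
     u \<in> borel_measurable \<mu> \<and> integrable \<mu> (\<lambda>x. norm (u x) powr p) \<and>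
     (\<exists>e. weak_grad_norm M \<mu> u e \<and> integrable \<mu> (\<lambda>x. \<bar>e x\<bar> powr p))}"

definition energy ::
  "('m, 'n::finite) manifold \<Rightarrow> 'm measure \<Rightarrow> real \<Rightarrow> ('m \<Rightarrow> 'l::euclidean_space) \<Rightarrow> real" where
  "energy M \<mu> p u = (LINT x|\<mu>. \<bar>(SOME e. weak_grad_norm M \<mu> u e) x\<bar> powr p)"

text \<open>Smooth compactly supported deformations \<open>y \<mapsto> F t x y\<close> of the target, depending on the
  point \<open>x\<close> of the domain. They map \<open>W1p\<close> to itself, and the competitors of \<open>u\<close> are
  \<open>x \<mapsto> F t x (u x)\<close>. Their velocities at \<open>t = 0\<close> include the fields \<open>(x, y) \<mapsto> tangential N y (\<phi> x)\<close>
  (multiplied by a cutoff in \<open>y\<close>), i.e. those of the variations \<open>\<pi>\<^sub>N(u + t\<phi>)\<close>.\<close>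

definition variation ::
  "('m, 'n::finite) manifold \<Rightarrow> 'l::euclidean_space set \<Rightarrow> (real \<Rightarrow> 'm \<Rightarrow> 'l \<Rightarrow> 'l) \<Rightarrow> bool" where
  "variation M N F \<longleftrightarrow> (\<exists>\<epsilon>>0.
     (\<forall>c\<in>atlas M. smooth_on ({-\<epsilon><..<\<epsilon>} \<times> cimg c \<times> UNIV) (\<lambda>(t, x, y). F t (cinv c x) y)) \<and>
     (\<forall>x\<in>topspace (mtop M). \<forall>y\<in>N. F 0 x y = y \<and> (\<forall>t\<in>{-\<epsilon><..<\<epsilon>}. F t x y \<in> N)) \<and>
     (\<exists>K C. compactin (mtop M) K \<and> compact C \<and> C \<subseteq> N \<and>
        (\<forall>t\<in>{-\<epsilon><..<\<epsilon>}. \<forall>x\<in>topspace (mtop M). \<forall>y\<in>N. (x, y) \<notin> K \<times> C \<longrightarrow> F t x y = y)))"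

text \<open>Critical points of the energy in \<open>W1p\<close>. The quantifier over \<open>\<mu>\<close> merely names the
  volume measure, which exists and is unique.\<close>

definition p_harmonic_map ::
  "('m, 'n::finite) manifold \<Rightarrow> 'l::euclidean_space set \<Rightarrow> real \<Rightarrow> ('m \<Rightarrow> 'l) \<Rightarrow> bool" where
  "p_harmonic_map M N p u \<longleftrightarrow> (\<exists>\<mu>. is_riemannian_volume M \<mu> \<and> u \<in> W1p M \<mu> N p \<and>
     (\<forall>F. variation M N F \<longrightarrow>
        ((\<lambda>t. energy M \<mu> p (\<lambda>x. F t x (u x))) has_real_derivative 0) (at 0)))"

text \<open>For \<open>n = 2\<close> both thresholds equal \<open>2\<close>, so the second case, where the denominator
  vanishes, is never reached.\<close>

definition kappa :: "real \<Rightarrow> nat \<Rightarrow> real" where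
  "kappa p n =
     (if p \<le> 1 + (real n - 1) / (sqrt (2 * real n) - 1) then 1 + (p - 1)\<^sup>2 / (real n - 1)
      else if p \<le> sqrt (2 * real n)
      then 2 - (p - sqrt (2 * real n))\<^sup>2 / (sqrt (real n) - sqrt 2)\<^sup>2
      else 2)"

end

theory Submission
  imports Defs
begin

text \<open>
  Fix a point \<open>q\<close> with \<open>\<nabla>u(q) \<noteq> 0\<close> and a \<open>g\<close>-orthonormal frame there whose distinguished vector \<open>k\<^sub>0\<close> points
  in the direction of \<open>\<nabla>|\<nabla>u|\<close>. Write \<open>E k\<close> for the derivatives of \<open>u\<close>, \<open>H k l\<close> for the covariant second
  derivatives and \<open>w k\<close> for the derivatives of \<open>|\<nabla>u|\<close>, so that \<open>w k = 0\<close> for \<open>k \<noteq> k\<^sub>0\<close>. Metric compatibility of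
  the connection gives \<open>|\<nabla>u| w k = \<Sum>l. H k l \<bullet> E l\<close>, and the tangential part of the p-harmonic equation reads
  \<open>(\<Sum>k. H k k) + ((p - 2) / |\<nabla>u|) (\<Sum>k. w k E k) = 0\<close>. From here on the estimate is algebra
  (\<open>refined_Kato_pointwise\<close>): the row and the column of \<open>k\<^sub>0\<close> in \<open>H\<close> control \<open>w k\<^sub>0\<close> by the Cauchy-Schwarz
  inequality, and the other diagonal entries are controlled through their sum, which the equation prescribes. If
  \<open>\<sigma>\<close> denotes the share of the \<open>k\<^sub>0\<close>-derivative in \<open>|\<nabla>u|\<^sup>2\<close>, minimizing a quadratic polynomial yields the constant
  \<open>F(\<sigma>) = ((p - 2)\<^sup>2 \<sigma>\<^sup>2 + ((p - 2)\<^sup>2 + 4 (p - 2)) \<sigma> + 2 n) / (n + (n - 2) \<sigma>)\<close>. The minimum of \<open>F\<close> over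
  \<open>[0, 1]\<close> is \<open>kappa p n\<close>: it is attained at \<open>\<sigma> = 1\<close>, at an interior point or at \<open>\<sigma> = 0\<close>, according to the
  three cases of the definition (\<open>kappa_le_quotient\<close>, \<open>kappa_extremal\<close>).

  A p-harmonic map is a critical point of the energy in a Sobolev class, so its equation has to be derived at
  \<open>q\<close>. Near \<open>q\<close> the map is twice continuously differentiable. A straightening chart of \<open>N\<close> moves the values of \<open>u\<close>
  in a direction \<open>v\<close>, with cut-offs in the domain and in the target (\<open>slice_variation\<close>). Outside a small box the
  map does not change, and inside its weak derivatives are classical; uniqueness of weak derivatives then shows
  that the energy of the deformed map is a constant plus the integral of a classical density over the box
  (\<open>energy_modified\<close>). Differentiating under the integral and integrating by parts gives the vanishing of the
  tangential part of the p-Laplacian (\<open>p_harmonic_imp_tension_zero\<close>).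

  For sharpness, equality in the algebraic estimate is realized by explicit \<open>E\<close> and \<open>H\<close> with values in the span of
  two orthonormal tangent vectors of \<open>N\<close>, and every pair of first and symmetric second covariant derivatives is
  the jet at \<open>q\<close> of a smooth map into \<open>N\<close>: a quadratic polynomial in charts, multiplied by a bump function
  (\<open>map_with_prescribed_jet\<close>). The equation at \<open>q\<close> for this map includes its normal part, which holds for every
  map into \<open>N\<close> because the normal part of a second derivative is the second fundamental form
  (\<open>second_fundamental_form_dderiv\<close>).
\<close>

section \<open>Calculus of k times continuously differentiable functions\<close>

abbreviation dderiv :: "('a::real_normed_vector \<Rightarrow> 'b::real_normed_vector) \<Rightarrow> 'a \<Rightarrow> 'a \<Rightarrow> 'b" where
  "dderiv f v x \<equiv> frechet_derivative f (at x) v"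

lemma dderiv_eqI: "(f has_derivative f') (at x) \<Longrightarrow> dderiv f v x = f' v"
  by (metis frechet_derivative_at)

lemma differentiable_has_dderiv:
  "f differentiable (at x) \<Longrightarrow> (f has_derivative (\<lambda>v. dderiv f v x)) (at x)"
  using frechet_derivative_works by blast

lemma Ck_on_subset: "Ck_on k S f \<Longrightarrow> T \<subseteq> S \<Longrightarrow> Ck_on k T f"
  by (induction k arbitrary: f) (auto intro: continuous_on_subset)

lemma Ck_on_cong:
  assumes "open S" "\<And>x. x \<in> S \<Longrightarrow> f x = g x" "Ck_on k S f"
  shows "Ck_on k S g"
  using assms(2,3)
proof (induction k arbitrary: f g)
  case 0
  then show ?case by (auto cong: continuous_on_cong)
next
  case (Suc k)
  have d: "f differentiable at x" if "x \<in> S" for x using Suc that by auto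
  have "g differentiable at x" if "x \<in> S" for x
    using has_derivative_transform_within_open[OF differentiable_has_dderiv[OF d[OF that]] assms(1) that Suc.prems(1)]
    by (auto simp: differentiable_def)
  moreover have "Ck_on k S (dderiv g v)" for v
    by (rule Suc.IH[of "dderiv f v"])
      (use Suc.prems(2) frechet_derivative_transform_within_open[OF d assms(1) _ Suc.prems(1)] in auto)
  ultimately show ?case by auto
qed

text \<open>Differentiability and the values of the derivatives are local; hence regularity may be checked on neighbourhoods.\<close>

lemma Ck_on_local:
  assumes "\<And>x. x \<in> S \<Longrightarrow> \<exists>T. open T \<and> x \<in> T \<and> Ck_on k T f"
  shows "Ck_on k S f"
  using assms
proof (induction k arbitrary: f)
  case 0
  show ?case unfolding Ck_on.simps
  proof (rule continuous_at_imp_continuous_on, rule)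
    fix x assume "x \<in> S"
    then obtain T where T: "open T" "x \<in> T" "Ck_on 0 T f" using 0 by metis
    then show "isCont f x" by (simp add: continuous_on_eq_continuous_at)
  qed
next
  case (Suc k)
  have 1: "f differentiable at x" if "x \<in> S" for x
    using Suc.prems[OF that] by auto
  have "Ck_on k S (dderiv f v)" for v
    by (rule Suc.IH) (use Suc.prems in fastforce)
  then show ?case using 1 by auto
qed

lemma Ck_on_SucD: "Ck_on (Suc k) S f \<Longrightarrow> Ck_on k S f"
proof (induction k arbitrary: f)
  case 0
  then show ?case
    by (auto intro!: continuous_at_imp_continuous_on differentiable_imp_continuous_within)
next
  case (Suc k)
  have 1: "\<forall>x\<in>S. f differentiable at x" and 2: "Ck_on (Suc k) S (dderiv f v)" for v
    using Suc.prems unfolding Ck_on.simps(2)[of "Suc k"] by blast+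
  have "Ck_on k S (dderiv f v)" for v using Suc.IH[OF 2] .
  then show ?case using 1 by simp
qed

lemma Ck_on_mono: "Ck_on k S f \<Longrightarrow> j \<le> k \<Longrightarrow> Ck_on j S f"
proof (induction k)
  case (Suc k)
  then show ?case by (metis Ck_on_SucD le_Suc_eq)
qed simp

lemma Ck_on_imp_continuous_on: "Ck_on k S f \<Longrightarrow> continuous_on S f"
  using Ck_on_mono[of k S f 0] by simp

lemma Ck_on_imp_differentiable: "Ck_on k S f \<Longrightarrow> 0 < k \<Longrightarrow> x \<in> S \<Longrightarrow> f differentiable (at x)"
  by (cases k) auto

lemma Ck_on_dderiv: "Ck_on (Suc k) S f \<Longrightarrow> Ck_on k S (dderiv f v)"
  by simp

lemma Ck_on_const [simp, intro]: "Ck_on k S (\<lambda>x. a)"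
  by (induction k arbitrary: a) auto

lemma Ck_on_linear:
  assumes "bounded_linear f" shows "Ck_on k S f"
proof (cases k)
  case 0
  then show ?thesis using assms by (simp add: linear_continuous_on)
next
  case (Suc j)
  have "(f has_derivative f) (at x)" for x using assms by (simp add: bounded_linear_imp_has_derivative)
  then have "dderiv f v = (\<lambda>x. f v)" "f differentiable (at x)" for v x
    by (auto simp: dderiv_eqI differentiable_def)
  then show ?thesis using Suc by auto
qed

lemma Ck_on_id: "Ck_on k S (\<lambda>x. x)"
  by (rule Ck_on_linear) (rule bounded_linear_ident)

lemma Ck_on_add:
  assumes "open S" "Ck_on k S f" "Ck_on k S g"
  shows "Ck_on k S (\<lambda>x. f x + g x)"
  using assms(2,3)
proof (induction k arbitrary: f g)
  case 0
  then show ?case by (auto intro: continuous_intros)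
next
  case (Suc k)
  have h: "((\<lambda>x. f x + g x) has_derivative (\<lambda>v. dderiv f v x + dderiv g v x)) (at x)" if "x \<in> S" for x
    using Suc.prems that by (auto intro!: has_derivative_add differentiable_has_dderiv)
  have "Ck_on k S (\<lambda>x. dderiv f v x + dderiv g v x)" for v using Suc by simp
  then have "Ck_on k S (dderiv (\<lambda>x. f x + g x) v)" for v
    by (rule Ck_on_cong[OF assms(1), rotated]) (simp add: dderiv_eqI[OF h])
  then show ?case using h by (auto simp: differentiable_def)
qed

lemma Ck_on_bilinear:
  assumes B: "bounded_bilinear B" and "open S" "Ck_on k S f" "Ck_on k S g"
  shows "Ck_on k S (\<lambda>x. B (f x) (g x))"
  using assms(3,4)
proof (induction k arbitrary: f g)
  case 0
  then show ?case using bounded_bilinear.continuous_on[OF B] by auto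
next
  case (Suc k)
  have h: "((\<lambda>x. B (f x) (g x)) has_derivative (\<lambda>v. B (f x) (dderiv g v x) + B (dderiv f v x) (g x))) (at x)"
    if "x \<in> S" for x
    using Suc.prems that by (auto intro!: bounded_bilinear.FDERIV[OF B] differentiable_has_dderiv)
  have "Ck_on k S (\<lambda>x. B (f x) (dderiv g v x) + B (dderiv f v x) (g x))" for v
    by (intro Ck_on_add assms(2) Suc.IH)
       (use Suc.prems Ck_on_SucD in \<open>auto simp del: Ck_on.simps intro: Ck_on_dderiv\<close>)
  then have "Ck_on k S (dderiv (\<lambda>x. B (f x) (g x)) v)" for v
    by (rule Ck_on_cong[OF assms(2), rotated]) (simp add: dderiv_eqI[OF h])
  then show ?case using h by (auto simp: differentiable_def)
qed

lemmas Ck_on_scaleR = Ck_on_bilinear[OF bounded_bilinear_scaleR]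
lemmas Ck_on_inner = Ck_on_bilinear[OF bounded_bilinear_inner]
lemma Ck_on_mult: "open S \<Longrightarrow> Ck_on k S f \<Longrightarrow> Ck_on k S g \<Longrightarrow> Ck_on k S (\<lambda>x. f x * g x :: real)"
  by (rule Ck_on_bilinear[OF bounded_bilinear_mult])

lemma Ck_on_sum: "open S \<Longrightarrow> (\<And>i. i \<in> I \<Longrightarrow> Ck_on k S (f i)) \<Longrightarrow> Ck_on k S (\<lambda>x. \<Sum>i\<in>I. f i x)"
  by (induction I rule: infinite_finite_induct) (auto intro: Ck_on_add)

lemma Ck_on_prod:
  fixes f :: "'i \<Rightarrow> 'a::real_normed_vector \<Rightarrow> real"
  shows "open S \<Longrightarrow> (\<And>i. i \<in> I \<Longrightarrow> Ck_on k S (f i)) \<Longrightarrow> Ck_on k S (\<lambda>x. \<Prod>i\<in>I. f i x)"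
  by (induction I rule: infinite_finite_induct) (auto intro: Ck_on_mult)

lemma Ck_on_minus: "open S \<Longrightarrow> Ck_on k S f \<Longrightarrow> Ck_on k S (\<lambda>x. - f x)"
  using Ck_on_scaleR[of S k "\<lambda>_. -1" f] by simp

lemma Ck_on_diff: "open S \<Longrightarrow> Ck_on k S f \<Longrightarrow> Ck_on k S g \<Longrightarrow> Ck_on k S (\<lambda>x. f x - g x)"
  using Ck_on_add[of S k f "\<lambda>x. - g x"] Ck_on_minus[of S k g] by simp

lemma dderiv_in_basis:
  fixes f :: "'a::euclidean_space \<Rightarrow> 'b::real_normed_vector"
  assumes "f differentiable (at x)"
  shows "dderiv f v x = (\<Sum>b\<in>Basis. (v \<bullet> b) *\<^sub>R dderiv f b x)"
proof -
  interpret linear "\<lambda>v. dderiv f v x" using assms by (rule linear_frechet_derivative)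
  have "dderiv f v x = dderiv f (\<Sum>b\<in>Basis. (v \<bullet> b) *\<^sub>R b) x" by (simp add: euclidean_representation)
  then show ?thesis by (simp add: sum scale)
qed

text \<open>The derivative of a composition involves the derivative of \<open>g\<close> in a direction that depends on the point.
  Expanding that direction in a basis leaves only derivatives of \<open>g\<close> in fixed directions, to which the
  induction hypothesis applies.\<close>

lemma Ck_on_compose:
  fixes f :: "'a::real_normed_vector \<Rightarrow> 'b::euclidean_space" and g :: "'b \<Rightarrow> 'c::real_normed_vector"
  assumes "open S" "Ck_on k S f" "Ck_on k T g" "\<And>x. x \<in> S \<Longrightarrow> f x \<in> T"
  shows "Ck_on k S (\<lambda>x. g (f x))"
  using assms(2,3)
proof (induction k arbitrary: g)
  case 0
  then show ?case using assms(4) by (auto intro: continuous_on_compose2)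
next
  case (Suc k)
  have dg: "g differentiable at (f x)" if "x \<in> S" for x using Suc.prems assms(4) that by auto
  have h: "((\<lambda>x. g (f x)) has_derivative (\<lambda>v. dderiv g (dderiv f v x) (f x))) (at x)" if "x \<in> S" for x
    using diff_chain_at[of f "\<lambda>v. dderiv f v x" x g "\<lambda>v. dderiv g v (f x)"]
      Suc.prems that dg by (auto simp: o_def intro!: differentiable_has_dderiv)
  have "Ck_on k S (\<lambda>x. \<Sum>b\<in>Basis. (dderiv f v x \<bullet> b) *\<^sub>R dderiv g b (f x))" for v
    by (intro Ck_on_sum Ck_on_scaleR Ck_on_inner Ck_on_const assms(1) Suc.IH Ck_on_dderiv Suc.prems Ck_on_SucD[OF Suc.prems(1)])
  then have "Ck_on k S (dderiv (\<lambda>x. g (f x)) v)" for v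
    by (rule Ck_on_cong[OF assms(1), rotated])
      (auto simp add: dderiv_eqI[OF h] dderiv_in_basis[OF dg, symmetric])
  then show ?case using h by (auto simp: differentiable_def)
qed

lemma Ck_on_linear_compose:
  fixes f :: "'a::real_normed_vector \<Rightarrow> 'b::euclidean_space"
  assumes "bounded_linear L" "open S" "Ck_on k S f"
  shows "Ck_on k S (\<lambda>x. L (f x))"
  by (rule Ck_on_compose[OF assms(2,3) Ck_on_linear[OF assms(1), of _ UNIV]]) simp

lemma Ck_on_compose_linear:
  fixes f :: "'a::real_normed_vector \<Rightarrow> 'b::euclidean_space"
  assumes "bounded_linear f" "open S" "Ck_on k T g" "\<And>x. x \<in> S \<Longrightarrow> f x \<in> T"
  shows "Ck_on k S (\<lambda>x. g (f x))"
  by (rule Ck_on_compose[OF assms(2) Ck_on_linear[OF assms(1)] assms(3,4)])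

lemma Ck_on_Pair:
  fixes f :: "'a::real_normed_vector \<Rightarrow> 'b::euclidean_space" and g :: "'a \<Rightarrow> 'c::euclidean_space"
  assumes "open S" "Ck_on k S f" "Ck_on k S g"
  shows "Ck_on k S (\<lambda>x. (f x, g x))"
proof -
  have "Ck_on k S (\<lambda>x. (f x, 0) + (0, g x) :: 'b \<times> 'c)"
    by (intro Ck_on_add assms(1) Ck_on_linear_compose[OF _ assms(1,2)] Ck_on_linear_compose[OF _ assms(1,3)]
         bounded_linear_intros)
  then show ?thesis by simp
qed

lemma Ck_on_powr: "Ck_on k {0<..} (\<lambda>s::real. s powr a)"
proof (induction k arbitrary: a)
  case 0
  then show ?case by (auto intro!: continuous_intros)
next
  case (Suc k)
  have h: "((\<lambda>s::real. s powr a) has_derivative (\<lambda>v. v * (a * x powr (a - 1)))) (at x)" if "x > 0" for x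
    using has_real_derivative_powr[OF that, of a] by (simp add: has_field_derivative_def mult.commute[of _ "a * _"])
  have "Ck_on k {0<..} (\<lambda>x. v * (a * x powr (a - 1)))" for v
    by (intro Ck_on_mult Suc Ck_on_const) auto
  then have "Ck_on k {0<..} (dderiv (\<lambda>s::real. s powr a) v)" for v
    by (rule Ck_on_cong[rotated 2]) (auto simp: dderiv_eqI[OF h])
  then show ?case using h by (auto simp: differentiable_def)
qed

lemma Ck_on_powr_compose:
  fixes f :: "'a::real_normed_vector \<Rightarrow> real"
  assumes "open S" "Ck_on k S f" "\<And>x. x \<in> S \<Longrightarrow> 0 < f x"
  shows "Ck_on k S (\<lambda>x. f x powr a)"
  by (rule Ck_on_compose[OF assms(1,2) Ck_on_powr]) (simp add: assms(3))

lemma Ck_on_sqrt: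
  fixes f :: "'a::real_normed_vector \<Rightarrow> real"
  assumes "open S" "Ck_on k S f" "\<And>x. x \<in> S \<Longrightarrow> 0 < f x"
  shows "Ck_on k S (\<lambda>x. sqrt (f x))"
  by (rule Ck_on_cong[OF assms(1) _ Ck_on_powr_compose[OF assms, of "1/2"]])
    (auto simp: powr_half_sqrt less_imp_le assms(3))

lemma Ck_on_divide:
  fixes f :: "'a::real_normed_vector \<Rightarrow> real"
  assumes "open S" "Ck_on k S f" "Ck_on k S g" "\<And>x. x \<in> S \<Longrightarrow> 0 < g x"
  shows "Ck_on k S (\<lambda>x. f x / g x)"
  by (rule Ck_on_cong[OF assms(1) _ Ck_on_mult[OF assms(1,2) Ck_on_powr_compose[OF assms(1,3,4), of "-1"]]])
    (use assms(4) in \<open>auto simp: powr_minus_divide less_imp_le\<close>)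

lemma has_vector_derivative_along_line:
  assumes "f differentiable (at (x + t *\<^sub>R v))"
  shows "((\<lambda>s. f (x + s *\<^sub>R v)) has_vector_derivative dderiv f v (x + t *\<^sub>R v)) (at t)"
proof -
  have 1: "((\<lambda>s. x + s *\<^sub>R v) has_derivative (\<lambda>h. h *\<^sub>R v)) (at t)"
    by (auto intro!: derivative_eq_intros)
  have "((\<lambda>s. f (x + s *\<^sub>R v)) has_derivative (\<lambda>h. dderiv f (h *\<^sub>R v) (x + t *\<^sub>R v))) (at t)"
    using diff_chain_at[OF 1 differentiable_has_dderiv[OF assms]] by (simp add: o_def)
  then show ?thesis
    using linear_frechet_derivative[OF assms] by (simp add: has_vector_derivative_def linear_cmul)
qed

text \<open>Two applications of the mean value theorem, in the direction \<open>u\<close> and then in the direction \<open>v\<close>. The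
  second difference on the left is symmetric in \<open>u\<close> and \<open>v\<close>; this is why the second derivatives commute.\<close>

lemma Schwarz_second_difference:
  fixes f :: "'a::real_normed_vector \<Rightarrow> real"
  assumes C: "Ck_on 2 (ball x (2 * r)) f" and h: "0 < h" "h * norm u < r" "h * norm v < r"
  shows "\<exists>y. norm (y - x) \<le> h * (norm u + norm v) \<and>
     f (x + h *\<^sub>R u + h *\<^sub>R v) - f (x + h *\<^sub>R u) - f (x + h *\<^sub>R v) + f x
       = h^2 * dderiv (dderiv f u) v y"
proof -
  have C1: "f differentiable (at y)" "dderiv f w differentiable (at y)" if "y \<in> ball x (2 * r)" for y w
    using C that by (auto simp: numeral_2_eq_2)
  have inb: "x + s *\<^sub>R u + t *\<^sub>R v \<in> ball x (2 * r)" if "0 \<le> s" "s \<le> h" "0 \<le> t" "t \<le> h" for s t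
  proof -
    have "norm (s *\<^sub>R u + t *\<^sub>R v) \<le> s * norm u + t * norm v"
      using norm_triangle_ineq[of "s *\<^sub>R u" "t *\<^sub>R v"] that by simp
    also have "\<dots> \<le> h * norm u + h * norm v" using that by (intro add_mono mult_right_mono) auto
    also have "\<dots> < 2 * r" using h by simp
    finally show ?thesis by (simp add: dist_norm norm_minus_commute algebra_simps)
  qed
  define g where "g s = f (x + h *\<^sub>R v + s *\<^sub>R u) - f (x + s *\<^sub>R u)" for s
  have "(g has_real_derivative dderiv f u (x + h *\<^sub>R v + s *\<^sub>R u) - dderiv f u (x + s *\<^sub>R u)) (at s)"
    if "0 \<le> s" "s \<le> h" for s
    unfolding g_def using inb[of s h] inb[of s 0] that h
    by (intro DERIV_diff has_vector_derivative_along_line[THEN has_real_derivative_iff_has_vector_derivative[THEN iffD2]] C1)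
      (auto simp: algebra_simps)
  from MVT2[OF h(1) this] obtain s where s: "0 < s" "s < h"
    "g h - g 0 = h * (dderiv f u (x + h *\<^sub>R v + s *\<^sub>R u) - dderiv f u (x + s *\<^sub>R u))" by auto
  have "((\<lambda>t. dderiv f u (x + s *\<^sub>R u + t *\<^sub>R v)) has_real_derivative
      dderiv (dderiv f u) v (x + s *\<^sub>R u + t *\<^sub>R v)) (at t)" if "0 \<le> t" "t \<le> h" for t
    using inb[of s t] that s
    by (intro has_vector_derivative_along_line[THEN has_real_derivative_iff_has_vector_derivative[THEN iffD2]] C1) auto
  from MVT2[OF h(1) this] obtain t where t: "0 < t" "t < h"
    "dderiv f u (x + s *\<^sub>R u + h *\<^sub>R v) - dderiv f u (x + s *\<^sub>R u)
      = h * dderiv (dderiv f u) v (x + s *\<^sub>R u + t *\<^sub>R v)" by auto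
  have "f (x + h *\<^sub>R u + h *\<^sub>R v) - f (x + h *\<^sub>R u) - f (x + h *\<^sub>R v) + f x = g h - g 0"
    by (simp add: g_def algebra_simps)
  also have "\<dots> = h^2 * dderiv (dderiv f u) v (x + s *\<^sub>R u + t *\<^sub>R v)"
    using s(3) t(3) by (simp add: algebra_simps power2_eq_square)
  finally have e: "f (x + h *\<^sub>R u + h *\<^sub>R v) - f (x + h *\<^sub>R u) - f (x + h *\<^sub>R v) + f x =
    h^2 * dderiv (dderiv f u) v (x + s *\<^sub>R u + t *\<^sub>R v)" .
  have "norm (s *\<^sub>R u + t *\<^sub>R v) \<le> s * norm u + t * norm v"
    using norm_triangle_ineq[of "s *\<^sub>R u" "t *\<^sub>R v"] s t by simp
  also have "\<dots> \<le> h * (norm u + norm v)" using s t unfolding distrib_left by (intro add_mono mult_right_mono) auto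
  finally show ?thesis using e by (intro exI[of _ "x + s *\<^sub>R u + t *\<^sub>R v"]) (simp add: algebra_simps)
qed

text \<open>The points where the second difference quotients evaluate the two mixed derivatives converge to \<open>x\<close>, and both
  mixed derivatives are continuous there.\<close>

lemma dderiv_commute_real:
  fixes f :: "'a::real_normed_vector \<Rightarrow> real"
  assumes S: "open S" "x \<in> S" and C: "Ck_on 2 S f"
  shows "dderiv (dderiv f u) v x = dderiv (dderiv f v) u x"
proof -
  obtain r0 where r0: "0 < r0" "ball x r0 \<subseteq> S" using S open_contains_ball by blast
  \<comment> \<open>The second difference evaluates \<open>f\<close> at distances up to twice the length of its steps.\<close>
  define r where "r = r0/2"
  have r: "r > 0" "Ck_on 2 (ball x (2 * r)) f" using r0 Ck_on_subset[OF C] by (auto simp: r_def)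
  define h where "h n = r / (norm u + norm v + 1) / (real n + 1)" for n
  have q: "r / (norm u + norm v + 1) > 0"
    using r by (intro divide_pos_pos add_nonneg_pos add_nonneg_nonneg) auto
  have h0: "h n > 0" for n unfolding h_def by (intro divide_pos_pos[OF q]) auto
  have h1: "h n \<le> r / (norm u + norm v + 1)" for n
    unfolding h_def using divide_left_mono[of 1 "real n + 1" "r / (norm u + norm v + 1)"] q by simp
  have hu: "h n * norm w < r" if "norm w \<le> norm u + norm v" for n w
  proof -
    have "h n * norm w \<le> r / (norm u + norm v + 1) * (norm u + norm v)"
      using h1 that h0 q by (intro mult_mono) auto
    also have "\<dots> < r / (norm u + norm v + 1) * (norm u + norm v + 1)"
      using q by (intro mult_strict_left_mono) auto
    also have "\<dots> = r" using add_nonneg_pos[of "norm u + norm v" 1] by simp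
    finally show ?thesis .
  qed
  have hlim: "h \<longlonglongrightarrow> 0" unfolding h_def
    by (rule tendsto_divide_0[OF tendsto_const]) (auto intro!: filterlim_at_top_imp_at_infinity filterlim_tendsto_add_at_top filterlim_real_sequentially simp: add.commute)
  have cont: "isCont (dderiv (dderiv f a) b) x" for a b
    using C S by (auto simp: numeral_2_eq_2 continuous_on_eq_continuous_at)
  define \<Delta> where "\<Delta> n = f (x + h n *\<^sub>R u + h n *\<^sub>R v) - f (x + h n *\<^sub>R u) - f (x + h n *\<^sub>R v) + f x" for n
  have lim: "(\<lambda>n. \<Delta> n / (h n)^2) \<longlonglongrightarrow> dderiv (dderiv f a) b x"
    if ab: "a = u \<and> b = v \<or> a = v \<and> b = u" for a b
  proof -
    have "\<exists>y. norm (y - x) \<le> h n * (norm a + norm b) \<and> \<Delta> n = (h n)^2 * dderiv (dderiv f a) b y" for n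
      using Schwarz_second_difference[OF r(2) h0[of n], of a b] hu[of a n] hu[of b n] ab
      by (auto simp: \<Delta>_def algebra_simps)
    then obtain y where y: "\<And>n. norm (y n - x) \<le> h n * (norm a + norm b)"
      "\<And>n. \<Delta> n = (h n)^2 * dderiv (dderiv f a) b (y n)" by metis
    have "(\<lambda>n. y n - x) \<longlonglongrightarrow> 0"
      by (rule Lim_null_comparison[OF _ tendsto_mult_left_zero[OF hlim, of "norm a + norm b"]]) (use y(1) in auto)
    then have "y \<longlonglongrightarrow> x" by (simp add: LIM_zero_iff)
    then have "(\<lambda>n. dderiv (dderiv f a) b (y n)) \<longlonglongrightarrow> dderiv (dderiv f a) b x"
      using cont isCont_tendsto_compose by blast
    moreover have "\<Delta> n / (h n)^2 = dderiv (dderiv f a) b (y n)" for n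
      using y(2)[of n] h0[of n] by simp
    ultimately show ?thesis by simp
  qed
  show ?thesis using LIMSEQ_unique[OF lim lim] by blast
qed

lemma dderiv_cong:
  assumes "open S" "x \<in> S" "\<And>y. y \<in> S \<Longrightarrow> f y = g y" "f differentiable (at x)"
  shows "dderiv f v x = dderiv g v x"
  using frechet_derivative_transform_within_open[OF assms(4,1,2,3)] by simp

lemma dderiv_inner:
  assumes "f differentiable (at x)"
  shows "dderiv (\<lambda>x. f x \<bullet> b) v x = dderiv f v x \<bullet> b"
  by (rule dderiv_eqI) (auto intro!: has_derivative_inner_left differentiable_has_dderiv assms)

lemma dderiv_commute:
  fixes f :: "'a::real_normed_vector \<Rightarrow> 'b::euclidean_space"
  assumes S: "open S" "x \<in> S" and C: "Ck_on 2 S f"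
  shows "dderiv (dderiv f u) v x = dderiv (dderiv f v) u x"
proof (rule euclidean_eqI)
  fix b :: 'b assume "b \<in> Basis"
  have C2: "Ck_on 2 S (\<lambda>x. f x \<bullet> b)" by (intro Ck_on_inner C S Ck_on_const)
  have d: "f differentiable (at y)" "dderiv f w differentiable (at y)" if "y \<in> S" for y w
    using C that by (auto simp: numeral_2_eq_2)
  have "dderiv (dderiv (\<lambda>x. f x \<bullet> b) a) c x = dderiv (dderiv f a) c x \<bullet> b" for a c
  proof -
    have "dderiv (dderiv (\<lambda>x. f x \<bullet> b) a) c x = dderiv (\<lambda>y. dderiv f a y \<bullet> b) c x"
      by (rule dderiv_cong[OF S]) (use C2 S d in \<open>auto simp: numeral_2_eq_2 dderiv_inner\<close>)
    then show ?thesis by (simp add: dderiv_inner d S)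
  qed
  then show "dderiv (dderiv f u) v x \<bullet> b = dderiv (dderiv f v) u x \<bullet> b"
    using dderiv_commute_real[OF S C2, of u v] by simp
qed

lemma dderiv_compose:
  assumes "f differentiable (at x)" "g differentiable (at (f x))"
  shows "dderiv (\<lambda>x. g (f x)) v x = dderiv g (dderiv f v x) (f x)"
  using frechet_derivative_compose[OF assms] by (simp add: o_def)

text \<open>The same expansion in a basis as for \<open>Ck_on_compose\<close> allows differentiating the chain rule once more.\<close>

lemma dderiv2_compose:
  fixes f :: "'a::real_normed_vector \<Rightarrow> 'b::euclidean_space" and g :: "'b \<Rightarrow> 'c::real_normed_vector"
  assumes S: "open S" "x \<in> S" and f: "Ck_on 2 S f" and T: "open T" and g: "Ck_on 2 T g" and ST: "\<And>x. x \<in> S \<Longrightarrow> f x \<in> T"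
  shows "dderiv (dderiv (\<lambda>x. g (f x)) v) w x =
     dderiv (dderiv g (dderiv f v x)) (dderiv f w x) (f x) + dderiv g (dderiv (dderiv f v) w x) (f x)"
proof -
  have df: "f differentiable (at y)" "dderiv f z differentiable (at y)" if "y \<in> S" for y z
    using f that by (auto simp: numeral_2_eq_2)
  have dg: "g differentiable (at y)" "dderiv g z differentiable (at y)" if "y \<in> T" for y z
    using g that by (auto simp: numeral_2_eq_2)
  have x: "f x \<in> T" using S ST by auto
  have gf: "Ck_on 2 S (\<lambda>x. g (f x))" by (rule Ck_on_compose[OF S(1) f g ST])
  have "dderiv (dderiv (\<lambda>x. g (f x)) v) w x = dderiv (\<lambda>y. \<Sum>b\<in>Basis. (dderiv f v y \<bullet> b) *\<^sub>R dderiv g b (f y)) w x"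
    using gf S by (intro dderiv_cong[of S])
      (auto simp: dderiv_compose df dg ST numeral_2_eq_2 dderiv_in_basis[OF dg(1), symmetric])
  also have "\<dots> = (\<Sum>b\<in>Basis. (dderiv f v x \<bullet> b) *\<^sub>R dderiv (dderiv g b) (dderiv f w x) (f x)
      + (dderiv (dderiv f v) w x \<bullet> b) *\<^sub>R dderiv g b (f x))"
    by (rule dderiv_eqI)
      (rule has_derivative_sum has_derivative_scaleR has_derivative_inner_left
         differentiable_has_dderiv df S dg x
         diff_chain_at[OF differentiable_has_dderiv[OF df(1)] differentiable_has_dderiv, unfolded o_def])+
  also have "\<dots> = (\<Sum>b\<in>Basis. (dderiv f v x \<bullet> b) *\<^sub>R dderiv (dderiv g b) (dderiv f w x) (f x))
      + dderiv g (dderiv (dderiv f v) w x) (f x)"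
    by (simp add: sum.distrib dderiv_in_basis[OF dg(1)[OF x], symmetric])
  also have "(\<Sum>b\<in>Basis. (dderiv f v x \<bullet> b) *\<^sub>R dderiv (dderiv g b) (dderiv f w x) (f x)) =
     dderiv (\<lambda>y. \<Sum>b\<in>Basis. (dderiv f v x \<bullet> b) *\<^sub>R dderiv g b y) (dderiv f w x) (f x)"
    by (rule dderiv_eqI[symmetric])
      (rule has_derivative_sum has_derivative_scaleR_right differentiable_has_dderiv dg x)+
  also have "\<dots> = dderiv (dderiv g (dderiv f v x)) (dderiv f w x) (f x)"
    using dg x T by (intro dderiv_cong[of T, symmetric]) (auto simp: dderiv_in_basis[OF dg(1), symmetric])
  finally show ?thesis .
qed

section \<open>Smooth cut-off functions\<close>

text \<open>The powers of \<open>s\<close> are carried along because derivatives of \<open>exp (- 1 / s)\<close> produce them: the family is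
  closed under differentiation, so its members are smooth by induction.\<close>

definition flat_exp :: "nat \<Rightarrow> real \<Rightarrow> real" where
  "flat_exp n s = (if s > 0 then exp (- (1 / s)) / s ^ n else 0)"

lemma flat_exp_nonneg: "0 \<le> flat_exp n s"
  by (simp add: flat_exp_def)

text \<open>For every \<open>k\<close>, \<open>exp (1 / s)\<close> is at least \<open>(1 / (s k)) ^ k\<close>. With \<open>k = n + 2\<close> a factor \<open>s\<^sup>2\<close> survives the
  division by \<open>s ^ n\<close>, and a quadratic bound gives the derivative zero at the origin.\<close>

lemma flat_exp_bound: "flat_exp n s \<le> (real n + 2) ^ (n + 2) * s^2"
proof (cases "s > 0")
  case True
  define k where "k = n + 2"
  have k: "k > 0" "real k = real n + 2" by (auto simp: k_def)
  have "exp (1 / s) = exp (1 / (s * k)) ^ k"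
    using k by (simp add: exp_of_nat_mult[symmetric])
  moreover have "(1 / (s * k)) ^ k \<le> exp (1 / (s * k)) ^ k"
    using True exp_ge_add_one_self[of "1 / (s * k)"] by (intro power_mono; linarith?) (auto intro: order_trans[OF _ exp_ge_add_one_self])
  ultimately have "1 / (s ^ k * k ^ k) \<le> exp (1 / s)"
    by (simp add: power_divide power_mult_distrib)
  then have "exp (- (1 / s)) \<le> s ^ k * k ^ k"
    using True k by (simp add: exp_minus field_simps)
  then have "exp (- (1 / s)) / s ^ n \<le> s ^ k * k ^ k / s ^ n"
    using True by (intro divide_right_mono) auto
  also have "\<dots> = s\<^sup>2 * k ^ k" using True by (simp add: k_def power_add power2_eq_square)
  finally show ?thesis using True k(2) unfolding k_def[symmetric] flat_exp_def by (simp add: mult.commute)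
next
  case False
  then show ?thesis by (simp add: flat_exp_def)
qed

lemma flat_exp_deriv:
  "(flat_exp n has_real_derivative flat_exp (n + 2) s - n * flat_exp (n + 1) s) (at s)"
proof -
  consider "s > 0" | "s < 0" | "s = 0" by linarith
  then show ?thesis
  proof cases
    case 1
    have "((\<lambda>s. exp (- (1 / s)) / s ^ n) has_real_derivative
       (exp (- (1 / s)) * (1 / s^2) * s ^ n - exp (- (1 / s)) * (n * s ^ (n - 1))) / (s ^ n * s ^ n)) (at s)"
      using 1 by (auto intro!: derivative_eq_intros simp: power2_eq_square)
    moreover have "(exp (- (1 / s)) * (1 / s^2) * s ^ n - exp (- (1 / s)) * (n * s ^ (n - 1))) / (s ^ n * s ^ n)
       = flat_exp (n + 2) s - n * flat_exp (n + 1) s"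
      using 1 by (cases n) (auto simp: flat_exp_def field_simps power2_eq_square)
    ultimately have h: "((\<lambda>s. exp (- (1 / s)) / s ^ n) has_real_derivative
        flat_exp (n + 2) s - n * flat_exp (n + 1) s) (at s)" by simp
    then show ?thesis
      by (rule has_field_derivative_transform_within_open[where S = "{0<..}"])
         (use 1 in \<open>auto simp: flat_exp_def\<close>)
  next
    case 2
    have "((\<lambda>_. 0) has_real_derivative flat_exp (n + 2) s - n * flat_exp (n + 1) s) (at s)"
      using 2 by (auto simp: flat_exp_def)
    then show ?thesis
      by (rule has_field_derivative_transform_within_open[where S = "{..<0}"])
         (use 2 in \<open>auto simp: flat_exp_def\<close>)
  next
    case 3
    have "((\<lambda>h. (flat_exp n (0 + h) - flat_exp n 0) / h) \<longlongrightarrow> 0) (at 0)"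
    proof (rule Lim_null_comparison)
      show "\<forall>\<^sub>F h in at 0. norm ((flat_exp n (0 + h) - flat_exp n 0) / h) \<le> (real n + 2) ^ (n + 2) * \<bar>h\<bar>"
      proof (rule always_eventually, rule)
        fix h :: real
        have "\<bar>flat_exp n h\<bar> \<le> ((real n + 2) ^ (n + 2) * \<bar>h\<bar>) * \<bar>h\<bar>"
          using flat_exp_bound[of n h] flat_exp_nonneg[of n h] by (simp add: power2_eq_square abs_mult_self_eq mult.assoc)
        then show "norm ((flat_exp n (0 + h) - flat_exp n 0) / h) \<le> (real n + 2) ^ (n + 2) * \<bar>h\<bar>"
          by (cases "h = 0") (auto simp: flat_exp_def[of _ 0] divide_le_eq)
      qed
      show "((\<lambda>h. (real n + 2) ^ (n + 2) * \<bar>h\<bar>) \<longlongrightarrow> 0) (at 0)"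
        by (intro tendsto_mult_right_zero tendsto_rabs_zero tendsto_ident_at)
    qed
    then show ?thesis using 3 by (simp add: DERIV_def flat_exp_def[of _ 0])
  qed
qed

lemma Ck_on_flat_exp: "Ck_on k S (flat_exp n)"
proof -
  have "Ck_on k UNIV (flat_exp n)"
  proof (induction k arbitrary: n)
    case 0
    show ?case
      by (auto intro!: continuous_at_imp_continuous_on DERIV_isCont flat_exp_deriv)
  next
    case (Suc k)
    have h: "(flat_exp n has_derivative (\<lambda>v. (flat_exp (n + 2) s - n * flat_exp (n + 1) s) * v)) (at s)" for s
      using flat_exp_deriv[of n s] by (simp add: has_field_derivative_def)
    have "Ck_on k UNIV (\<lambda>s. (flat_exp (n + 2) s - n * flat_exp (n + 1) s) * v)" for v
      by (intro Ck_on_mult Ck_on_diff Ck_on_const open_UNIV Suc)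
    then show ?case using h by (auto simp: differentiable_def dderiv_eqI[OF h])
  qed
  then show ?thesis by (rule Ck_on_subset) auto
qed

abbreviation flat0 :: "real \<Rightarrow> real" where "flat0 \<equiv> flat_exp 0"

lemma flat0_le_1: "flat0 s \<le> 1"
  by (simp add: flat_exp_def)

lemma flat0_pos_iff: "0 < flat0 s \<longleftrightarrow> 0 < s"
  by (simp add: flat_exp_def)

definition bump :: "'a::euclidean_space \<Rightarrow> real \<Rightarrow> 'a \<Rightarrow> real" where
  "bump a r x = flat0 (r\<^sup>2 - (x - a) \<bullet> (x - a))"

lemma Ck_on_bump: "open S \<Longrightarrow> Ck_on k S (bump a r)"
  unfolding bump_def
  by (rule Ck_on_compose[OF _ _ Ck_on_flat_exp[of _ UNIV]])
     (intro Ck_on_diff Ck_on_inner Ck_on_const Ck_on_id | simp)+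

lemma bump_nonneg: "0 \<le> bump a r x"
  by (simp add: bump_def flat_exp_nonneg)

lemma bump_le_1: "bump a r x \<le> 1"
  by (simp add: bump_def flat0_le_1)

lemma bump_pos_iff: "0 < r \<Longrightarrow> 0 < bump a r x \<longleftrightarrow> x \<in> ball a r"
proof -
  assume r: "0 < r"
  have "(x - a) \<bullet> (x - a) < r\<^sup>2 \<longleftrightarrow> norm (x - a) < r"
    using r by (auto simp: power2_norm_eq_inner[symmetric] intro: power2_less_imp_less power_strict_mono)
  then show ?thesis by (simp add: bump_def flat0_pos_iff dist_norm norm_minus_commute)
qed

lemma bump_eq_0: "0 < r \<Longrightarrow> x \<notin> ball a r \<Longrightarrow> bump a r x = 0"
  using bump_pos_iff[of r a x] bump_nonneg[of a r x] by auto

section \<open>Weak derivatives\<close>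

lemma tendsto_compose_at_nonzero:
  assumes "(g \<longlongrightarrow> l) (at (0::real))" "h \<longlonglongrightarrow> 0" "\<And>n. h n \<noteq> 0"
  shows "(\<lambda>n. g (h n)) \<longlonglongrightarrow> l"
  by (rule filterlim_compose[OF assms(1)]) (use assms(2,3) in \<open>auto simp: filterlim_at\<close>)

lemma compact_support_bounded:
  fixes f :: "'a::euclidean_space \<Rightarrow> 'b::real_normed_vector"
  assumes "continuous_on UNIV f" "compact K" "\<And>x. x \<notin> K \<Longrightarrow> f x = 0"
  obtains B where "0 \<le> B" "\<And>x. norm (f x) \<le> B"
proof -
  have "bounded (f ` K)"
    using assms by (intro compact_imp_bounded compact_continuous_image) (auto intro: continuous_on_subset)
  then obtain B where B: "\<And>x. x \<in> K \<Longrightarrow> norm (f x) \<le> B" unfolding bounded_iff by auto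
  show ?thesis
  proof (rule that[of "max B 0"])
    show "norm (f x) \<le> max B 0" for x
      using B[of x] assms(3)[of x] by (cases "x \<in> K") auto
  qed simp
qed

lemma integrable_compact_support:
  fixes f :: "'a::euclidean_space \<Rightarrow> 'b::euclidean_space"
  assumes "continuous_on K f" "compact K" "\<And>x. x \<notin> K \<Longrightarrow> f x = 0"
  shows "integrable lborel f"
proof -
  have "(\<lambda>x. indicator K x *\<^sub>R f x) = f" using assms(3) by (auto simp: indicator_def fun_eq_iff)
  then show ?thesis using borel_integrable_compact[OF assms(2,1)] by simp
qed

lemma dderiv_zero_outside:
  assumes "closed K" "\<And>x. x \<notin> K \<Longrightarrow> f x = 0" "x \<notin> K"
  shows "dderiv f v x = 0"
proof -
  have "dderiv (\<lambda>_. 0) v x = dderiv f v x"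
    by (rule dderiv_cong[of "-K"]) (use assms in auto)
  then show ?thesis by simp
qed

text \<open>The difference quotients have integral zero by translation invariance of the measure, and they are dominated
  by a multiple of the indicator of one ball.\<close>

lemma integral_dderiv_compact_support:
  fixes f :: "'a::euclidean_space \<Rightarrow> 'b::euclidean_space"
  assumes C: "Ck_on 1 UNIV f" and K: "compact K" "\<And>x. x \<notin> K \<Longrightarrow> f x = 0"
  shows "(\<integral>x. dderiv f v x \<partial>lborel) = 0"
proof -
  have d: "f differentiable (at x)" for x using C by auto
  have cf: "continuous_on UNIV f" using C by (rule Ck_on_imp_continuous_on)
  have cdf: "continuous_on UNIV (dderiv f v)" using C by auto
  have [measurable]: "f \<in> borel_measurable borel" "dderiv f v \<in> borel_measurable borel"
    using cf cdf by (auto intro: borel_measurable_continuous_onI)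
  obtain B where B: "0 \<le> B" "\<And>x. norm (dderiv f v x) \<le> B"
    using compact_support_bounded[OF cdf K(1) dderiv_zero_outside[OF compact_imp_closed[OF K(1)] K(2)]] by blast
  define h where "h n = 1 / (real n + 1)" for n
  have h: "h n > 0" "h n \<le> 1" for n by (auto simp: h_def)
  have hlim: "h \<longlonglongrightarrow> 0" unfolding h_def using LIMSEQ_inverse_real_of_nat by (simp add: inverse_eq_divide add.commute)
  define q where "q n x = (1 / h n) *\<^sub>R (f (h n *\<^sub>R v + x) - f x)" for n x
  obtain R where R: "\<And>x. x \<in> K \<Longrightarrow> norm x \<le> R" using compact_imp_bounded[OF K(1)] unfolding bounded_iff by auto
  have qb: "norm (q n x) \<le> indicator (cball 0 (R + norm v)) x *\<^sub>R B" for n x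
  proof -
    have "((\<lambda>s. f (x + s *\<^sub>R v)) has_derivative (\<lambda>s. s *\<^sub>R dderiv f v (x + t *\<^sub>R v))) (at t)" for t
      using has_vector_derivative_along_line[OF d] by (simp add: has_vector_derivative_def)
    moreover have "continuous_on {0..h n} (\<lambda>s. f (x + s *\<^sub>R v))"
      by (rule continuous_on_compose2[OF cf]) (auto intro!: continuous_intros)
    ultimately obtain t where
      "norm (f (x + h n *\<^sub>R v) - f x) \<le> norm (h n *\<^sub>R dderiv f v (x + t *\<^sub>R v))"
      using mvt_general[OF h(1)[of n], of "\<lambda>s. f (x + s *\<^sub>R v)" "\<lambda>t s. s *\<^sub>R dderiv f v (x + t *\<^sub>R v)"] by auto
    also have "\<dots> \<le> h n * B" using B(2) h(1)[of n] by simp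
    finally have "norm (f (x + h n *\<^sub>R v) - f x) \<le> h n * B" .
    moreover have "norm (q n x) = norm (f (x + h n *\<^sub>R v) - f x) / h n"
      using h(1)[of n] by (simp add: q_def add.commute)
    ultimately have 1: "norm (q n x) \<le> B" using h(1)[of n] by (simp add: divide_le_eq mult.commute)
    have "q n x = 0" if "x \<notin> cball 0 (R + norm v)"
    proof -
      have "norm (h n *\<^sub>R v) \<le> norm v" using h[of n] by (simp add: mult_left_le_one_le)
      moreover have "norm x \<le> norm (h n *\<^sub>R v + x) + norm (h n *\<^sub>R v)"
        using norm_triangle_ineq4[of "h n *\<^sub>R v + x" "h n *\<^sub>R v"] by simp
      moreover have "R + norm v < norm x" using that by simp
      ultimately have "R < norm x" "R < norm (h n *\<^sub>R v + x)" using norm_ge_zero[of v] by linarith+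
      then have "x \<notin> K" "h n *\<^sub>R v + x \<notin> K" using R by force+
      then show ?thesis by (simp add: q_def K(2))
    qed
    then show ?thesis using 1 by (auto simp: indicator_def)
  qed
  have "(\<lambda>n. \<integral>x. q n x \<partial>lborel) \<longlonglongrightarrow> (\<integral>x. dderiv f v x \<partial>lborel)"
  proof (rule integral_dominated_convergence[where w = "\<lambda>x. indicator (cball 0 (R + norm v)) x *\<^sub>R B"])
    show "integrable lborel (\<lambda>x::'a. indicator (cball 0 (R + norm v)) x *\<^sub>R B)"
      by (rule borel_integrable_compact) auto
    show "AE x in lborel. (\<lambda>n. q n x) \<longlonglongrightarrow> dderiv f v x"
    proof (rule AE_I2)
      fix x
      have "((\<lambda>s. f (x + s *\<^sub>R v)) has_derivative (\<lambda>s. s *\<^sub>R dderiv f v x)) (at 0)"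
        using has_vector_derivative_along_line[where f = f and x = x and t = 0 and v = v] d by (simp add: has_vector_derivative_def)
      then have "((\<lambda>s. norm (f (x + s *\<^sub>R v) - f x - s *\<^sub>R dderiv f v x) / norm s) \<longlongrightarrow> 0) (at 0)"
        by (simp add: has_derivative_at)
      then have "(\<lambda>n. norm (f (x + h n *\<^sub>R v) - f x - h n *\<^sub>R dderiv f v x) / norm (h n)) \<longlonglongrightarrow> 0"
        by (rule tendsto_compose_at_nonzero) (use h hlim in \<open>auto simp: less_imp_neq[symmetric]\<close>)
      moreover have "norm (f (x + h n *\<^sub>R v) - f x - h n *\<^sub>R dderiv f v x) / norm (h n) = norm (q n x - dderiv f v x)" for n
      proof -
        have "q n x - dderiv f v x = (1 / h n) *\<^sub>R (f (x + h n *\<^sub>R v) - f x - h n *\<^sub>R dderiv f v x)"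
          using h(1)[of n] by (simp add: q_def algebra_simps)
        then show ?thesis by simp
      qed
      ultimately show "(\<lambda>n. q n x) \<longlonglongrightarrow> dderiv f v x"
        by (simp add: tendsto_norm_zero_iff LIM_zero_iff)
    qed
  qed (use qb in \<open>auto simp: q_def\<close>)
  moreover have "(\<integral>x. q n x \<partial>lborel) = 0" for n
  proof -
    have i: "integrable lborel f" by (rule integrable_compact_support[OF _ K]) (use cf continuous_on_subset in auto)
    have i': "integrable lborel (\<lambda>x. f (h n *\<^sub>R v + x))"
      and e: "(\<integral>x. f (h n *\<^sub>R v + x) \<partial>lborel) = (\<integral>x. f x \<partial>lborel)"
      using i integral_distr[of "(+) (h n *\<^sub>R v)" lborel borel f] integrable_distr_eq[of "(+) (h n *\<^sub>R v)" lborel borel f]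
      by (simp_all add: lborel_distr_plus)
    show ?thesis unfolding q_def using i i' e by simp
  qed
  ultimately show ?thesis using LIMSEQ_unique[OF tendsto_const] by force
qed


text \<open>Near a point outside \<open>\<Omega>\<close> the extension vanishes, since the closed set \<open>K\<close> keeps away from it.\<close>

lemma Ck_on_zero_extend:
  assumes "open \<Omega>" "closed K" "K \<subseteq> \<Omega>" "Ck_on k \<Omega> f" "\<And>x. x \<in> \<Omega> - K \<Longrightarrow> f x = 0"
  shows "Ck_on k UNIV (\<lambda>x. if x \<in> \<Omega> then f x else 0)"
proof (rule Ck_on_local)
  fix x
  show "\<exists>T. open T \<and> x \<in> T \<and> Ck_on k T (\<lambda>x. if x \<in> \<Omega> then f x else 0)"
  proof (cases "x \<in> \<Omega>")
    case True
    have "Ck_on k \<Omega> (\<lambda>x. if x \<in> \<Omega> then f x else 0)"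
      by (rule Ck_on_cong[OF assms(1) _ assms(4)]) auto
    then show ?thesis using True assms(1) by blast
  next
    case False
    have "Ck_on k (-K) (\<lambda>x. if x \<in> \<Omega> then f x else 0)"
      by (rule Ck_on_cong[OF _ _ Ck_on_const[of _ _ 0]]) (use assms in auto)
    then show ?thesis using False assms(2,3) by (intro exI[of _ "-K"]) auto
  qed
qed

lemma integrable_test_times:
  fixes f :: "real^'n::finite \<Rightarrow> 'l::euclidean_space"
  assumes f: "locally_integrable \<Omega> f" and \<eta>: "continuous_on UNIV \<eta>" and K: "compact K" "K \<subseteq> \<Omega>" "\<And>x. x \<notin> K \<Longrightarrow> \<eta> x = 0"
  shows "set_integrable lborel \<Omega> (\<lambda>x. \<eta> x *\<^sub>R f x)"
proof -
  obtain B where B: "\<And>x. norm (\<eta> x) \<le> B"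
    using compact_support_bounded[OF \<eta> K(1,3)] by blast
  have i: "integrable lborel (\<lambda>x. indicator K x *\<^sub>R f x)"
    using f K unfolding locally_integrable_def set_integrable_def by auto
  have [measurable]: "\<eta> \<in> borel_measurable borel" using \<eta> by (rule borel_measurable_continuous_onI)
  have "integrable lborel (\<lambda>x. \<eta> x *\<^sub>R (indicator K x *\<^sub>R f x))"
  proof (rule Bochner_Integration.integrable_bound)
    show "integrable lborel (\<lambda>x. B *\<^sub>R (indicator K x *\<^sub>R f x))"
      using i by (rule integrable_scaleR_right)
    show "(\<lambda>x. \<eta> x *\<^sub>R (indicator K x *\<^sub>R f x)) \<in> borel_measurable lborel"
      using borel_measurable_integrable[OF i] by measurable
    show "AE x in lborel. norm (\<eta> x *\<^sub>R indicator K x *\<^sub>R f x) \<le> norm (B *\<^sub>R indicator K x *\<^sub>R f x)"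
      using B by (intro AE_I2, unfold norm_scaleR, intro mult_right_mono) (auto intro: order_trans[OF _ abs_ge_self])
  qed
  moreover have "\<eta> x *\<^sub>R (indicator K x *\<^sub>R f x) = indicator \<Omega> x *\<^sub>R (\<eta> x *\<^sub>R f x)" for x
    using K(2) K(3)[of x] by (auto simp: indicator_def)
  ultimately show ?thesis unfolding set_integrable_def by (simp only:)
qed

lemma continuous_locally_integrable:
  "continuous_on \<Omega> f \<Longrightarrow> locally_integrable \<Omega> f"
  unfolding locally_integrable_def set_integrable_def
  by (auto intro!: borel_integrable_compact intro: continuous_on_subset)

text \<open>The product of a test function with \<open>f\<close>, extended by zero, is compactly supported on the whole space, so its
  derivatives have integral zero.\<close>

lemma weak_pd_classical:
  fixes f :: "real^'n::finite \<Rightarrow> 'l::euclidean_space"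
  assumes O: "open \<Omega>" and f: "Ck_on 1 \<Omega> f"
  shows "weak_pd \<Omega> i f (pd i f)"
  unfolding weak_pd_def
proof (intro conjI allI impI)
  have df: "continuous_on \<Omega> (pd i f)" using f by (simp add: pd_def)
  then show li: "locally_integrable \<Omega> f" "locally_integrable \<Omega> (pd i f)"
    using continuous_locally_integrable Ck_on_imp_continuous_on[OF f] by auto
  fix \<eta> :: "real^'n \<Rightarrow> real"
  assume "smooth_on UNIV \<eta> \<and> (\<exists>K. compact K \<and> K \<subseteq> \<Omega> \<and> (\<forall>x. x \<notin> K \<longrightarrow> \<eta> x = 0))"
  then obtain K where \<eta>: "Ck_on 1 UNIV \<eta>" and K: "compact K" "K \<subseteq> \<Omega>" "\<And>x. x \<notin> K \<Longrightarrow> \<eta> x = 0"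
    unfolding smooth_on_def by blast
  have cl: "closed K" using K(1) by (rule compact_imp_closed)
  define h where "h x = (if x \<in> \<Omega> then \<eta> x *\<^sub>R f x else 0)" for x
  have \<eta>': "Ck_on 1 \<Omega> \<eta>" using Ck_on_subset[OF \<eta>] by blast
  have h: "Ck_on 1 UNIV h" unfolding h_def
    by (rule Ck_on_zero_extend[OF O cl K(2) Ck_on_scaleR[OF O \<eta>' f]]) (use K(3) in auto)
  have 0: "(\<integral>x. pd i h x \<partial>lborel) = 0" unfolding pd_def
    by (rule integral_dderiv_compact_support[OF h K(1)]) (simp add: h_def K(3))
  have pd0: "pd i \<eta> x = 0" if "x \<notin> K" for x
    unfolding pd_def by (rule dderiv_zero_outside[OF cl K(3) that])
  have d: "\<eta> differentiable (at x)" for x using \<eta> by auto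
  have pdh: "pd i h x = indicator \<Omega> x *\<^sub>R (pd i \<eta> x *\<^sub>R f x) + indicator \<Omega> x *\<^sub>R (\<eta> x *\<^sub>R pd i f x)" for x
  proof (cases "x \<in> \<Omega>")
    case True
    have fx: "f differentiable (at x)" using f True by auto
    have "dderiv (\<lambda>x. \<eta> x *\<^sub>R f x) (axis i 1) x = dderiv h (axis i 1) x"
      by (rule dderiv_cong[OF O True]) (use fx d in \<open>auto simp: h_def intro: differentiable_scaleR\<close>)
    moreover have "dderiv (\<lambda>x. \<eta> x *\<^sub>R f x) (axis i 1) x = \<eta> x *\<^sub>R pd i f x + pd i \<eta> x *\<^sub>R f x"
      unfolding pd_def
      by (rule dderiv_eqI) (auto intro!: has_derivative_scaleR differentiable_has_dderiv fx d)
    ultimately show ?thesis using True by (simp add: pd_def add.commute)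
  next
    case False
    then have "x \<notin> K" using K by auto
    then have "pd i h x = 0" unfolding pd_def by (intro dderiv_zero_outside[OF cl]) (auto simp: h_def K(3))
    then show ?thesis using False by simp
  qed
  have I1: "set_integrable lborel \<Omega> (\<lambda>x. pd i \<eta> x *\<^sub>R f x)"
    by (rule integrable_test_times[OF li(1) _ K(1,2)]) (use \<eta> pd0 in \<open>auto simp: pd_def\<close>)
  have I2: "set_integrable lborel \<Omega> (\<lambda>x. \<eta> x *\<^sub>R pd i f x)"
    by (rule integrable_test_times[OF li(2) _ K]) (rule Ck_on_imp_continuous_on[OF \<eta>])
  have "(\<integral>x. pd i h x \<partial>lborel) = (LINT x:\<Omega>|lborel. pd i \<eta> x *\<^sub>R f x) + (LINT x:\<Omega>|lborel. \<eta> x *\<^sub>R pd i f x)"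
    using I1 I2 unfolding pdh set_lebesgue_integral_def set_integrable_def
    by (rule Bochner_Integration.integral_add)
  then show "(LINT x:\<Omega>|lborel. pd i \<eta> x *\<^sub>R f x) = - (LINT x:\<Omega>|lborel. \<eta> x *\<^sub>R pd i f x)"
    using 0 by (simp add: eq_neg_iff_add_eq_0)
qed

text \<open>As \<open>n\<close> grows, these smooth functions increase to the indicator of the open box, because \<open>flat0 (n s)\<close> tends to
  \<open>1\<close> for \<open>s > 0\<close> and is \<open>0\<close> otherwise.\<close>

definition box_cutoff :: "'a::euclidean_space \<Rightarrow> 'a \<Rightarrow> nat \<Rightarrow> 'a \<Rightarrow> real" where
  "box_cutoff a b n x = (\<Prod>i\<in>Basis. flat0 (real n * (x \<bullet> i - a \<bullet> i)) * flat0 (real n * (b \<bullet> i - x \<bullet> i)))"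

lemma smooth_on_box_cutoff: "smooth_on UNIV (box_cutoff a b n)"
proof -
  have *: "Ck_on k UNIV (\<lambda>x. flat0 (f x))" if "Ck_on k UNIV f" for k and f :: "'a \<Rightarrow> real"
    by (rule Ck_on_compose[OF open_UNIV that Ck_on_flat_exp[of _ UNIV]]) simp
  show ?thesis unfolding smooth_on_def box_cutoff_def
    by (intro * allI Ck_on_prod Ck_on_mult Ck_on_diff Ck_on_inner Ck_on_id Ck_on_const open_UNIV)
qed

lemma box_cutoff_le_1: "0 \<le> box_cutoff a b n x" "box_cutoff a b n x \<le> 1"
  unfolding box_cutoff_def
  by (auto intro!: prod_nonneg prod_le_1 mult_nonneg_nonneg mult_le_one flat_exp_nonneg flat0_le_1)

lemma box_cutoff_eq_0: "x \<notin> box a b \<Longrightarrow> box_cutoff a b n x = 0"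
proof -
  assume "x \<notin> box a b"
  then obtain i where "i \<in> Basis" "x \<bullet> i \<le> a \<bullet> i \<or> b \<bullet> i \<le> x \<bullet> i" by (auto simp: mem_box not_less)
  then show ?thesis unfolding box_cutoff_def
    by (intro prod_zero) (auto intro!: bexI[of _ i] simp: flat_exp_def zero_less_mult_iff)
qed

lemma box_cutoff_tendsto: "(\<lambda>n. box_cutoff a b n x) \<longlonglongrightarrow> indicator (box a b) x"
proof (cases "x \<in> box a b")
  case True
  have *: "(\<lambda>n. flat0 (real n * s)) \<longlonglongrightarrow> 1" if "s > 0" for s
  proof -
    have "(\<lambda>n. exp (- ((1 / s) * (1 / real n)))) \<longlonglongrightarrow> exp (- ((1 / s) * 0))"
      by (intro tendsto_intros lim_1_over_n)
    moreover have "\<forall>\<^sub>F n in sequentially. exp (- ((1 / s) * (1 / real n))) = flat0 (real n * s)"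
      using eventually_gt_at_top[of 0] by eventually_elim (use that in \<open>simp add: flat_exp_def mult.commute\<close>)
    ultimately show ?thesis using Lim_transform_eventually by fastforce
  qed
  have "(\<lambda>n. box_cutoff a b n x) \<longlonglongrightarrow> (\<Prod>i\<in>(Basis::'a set). 1 * 1)"
    unfolding box_cutoff_def using True by (intro tendsto_prod tendsto_mult *) (auto simp: mem_box)
  then show ?thesis using True by simp
next
  case False
  then show ?thesis by (simp add: box_cutoff_eq_0)
qed

text \<open>The fundamental lemma of the calculus of variations: smooth cut-offs approximate the indicators of boxes, so \<open>f\<close>
  has integral zero over all small boxes, hence over all Borel sets, which the boxes generate.\<close>

lemma fundamental_lemma_box:
  fixes f :: "real^'n::finite \<Rightarrow> real"
  assumes int: "set_integrable lborel (cbox a b) f"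
    and test: "\<And>\<eta>. smooth_on UNIV \<eta> \<Longrightarrow> (\<And>x. x \<notin> cbox a b \<Longrightarrow> \<eta> x = 0) \<Longrightarrow> (\<integral>x. \<eta> x * f x \<partial>lborel) = 0"
  shows "AE x in lborel. x \<in> box a b \<longrightarrow> f x = 0"
proof -
  have i: "integrable lborel (\<lambda>x. indicator (cbox a b) x * f x)"
    using int by (simp add: set_integrable_def)
  note [measurable] = borel_measurable_integrable[OF i]
  have box0: "(\<integral>x. indicator (box c d) x * f x \<partial>lborel) = 0" if sub: "box c d \<subseteq> box a b" for c d
  proof -
    have sub': "box c d \<subseteq> cbox a b" using sub box_subset_cbox by blast
    have e: "indicator (box c d) x * f x = indicator (box c d) x * (indicator (cbox a b) x * f x)"
      "box_cutoff c d n x * f x = box_cutoff c d n x * (indicator (cbox a b) x * f x)" for x n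
      using sub' box_cutoff_eq_0[of x c d n] by (auto simp: indicator_def)
    have [measurable]: "box_cutoff c d n \<in> borel_measurable borel" for n
      using smooth_on_box_cutoff[of c d n]
      by (auto intro!: borel_measurable_continuous_onI simp: smooth_on_def dest: spec[of _ 0])
    have "(\<lambda>n. \<integral>x. box_cutoff c d n x * f x \<partial>lborel) \<longlonglongrightarrow> (\<integral>x. indicator (box c d) x * f x \<partial>lborel)"
      unfolding e
    proof (rule integral_dominated_convergence[where w = "\<lambda>x. norm (indicator (cbox a b) x * f x)"])
      show "AE x in lborel. (\<lambda>n. box_cutoff c d n x * (indicator (cbox a b) x * f x))
        \<longlonglongrightarrow> indicator (box c d) x * (indicator (cbox a b) x * f x)"
        by (intro AE_I2 tendsto_mult box_cutoff_tendsto tendsto_const)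
      show "AE x in lborel. norm (box_cutoff c d n x * (indicator (cbox a b) x * f x))
         \<le> norm (indicator (cbox a b) x * f x)" for n
        unfolding norm_mult[of "box_cutoff c d n _"]
        by (intro AE_I2 mult_left_le_one_le) (auto simp: box_cutoff_le_1)
    qed (use i in \<open>measurable; simp\<close>)+
    moreover have "(\<integral>x. box_cutoff c d n x * f x \<partial>lborel) = 0" for n
      by (rule test[OF smooth_on_box_cutoff]) (use sub' box_cutoff_eq_0 in blast)
    ultimately show ?thesis using LIMSEQ_unique[OF tendsto_const] by force
  qed
  define g where "g x = indicator (box a b) x * f x" for x
  have gi: "integrable lborel g"
  proof -
    have "integrable lborel (\<lambda>x. indicator (box a b) x *\<^sub>R (indicator (cbox a b) x * f x))"
      by (rule integrable_mult_indicator[OF _ i]) auto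
    moreover have "indicator (box a b) x *\<^sub>R (indicator (cbox a b) x * f x) = g x" for x
      using box_subset_cbox[of a b] by (auto simp: g_def indicator_def)
    ultimately show ?thesis by simp
  qed
  have g0: "(\<integral>x\<in>A. g x \<partial>lborel) = 0" if "A \<in> sets borel" for A
  proof -
    let ?G = "range (\<lambda>(a, b). box a b :: (real^'n) set)"
    have G: "Int_stable ?G" "?G \<subseteq> Pow UNIV" "A \<in> sigma_sets UNIV ?G"
      using that unfolding borel_eq_box by (auto simp: Int_stable_def box_Int_box)
    then show ?thesis
    proof (induction rule: sigma_sets_induct_disjoint)
      case (basic A)
      then obtain c d where "A = box c d" by auto
      then have e: "indicator A x * g x = indicator (box c d \<inter> box a b) x * f x" for x
        by (auto simp: g_def indicator_def)
      obtain c' d' where cd: "box c d \<inter> box a b = box c' d'" using box_Int_box by blast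
      have "box c' d' \<subseteq> box a b" using cd by auto
      then show ?case unfolding set_lebesgue_integral_def using box0[of c' d'] by (simp add: e cd)
    next
      case empty
      then show ?case by (simp add: set_lebesgue_integral_def)
    next
      case (compl A)
      then have A: "A \<in> sets borel" unfolding borel_eq_box by simp
      have gA: "set_integrable lborel B g" if "B \<in> sets borel" for B
        using integrable_mult_indicator[of B lborel g] gi that by (simp add: set_integrable_def)
      have "(\<integral>x\<in>UNIV. g x \<partial>lborel) = (\<integral>x\<in>(UNIV - A). g x \<partial>lborel) + (\<integral>x\<in>A. g x \<partial>lborel)"
        using set_integral_Un[of "UNIV - A" A lborel g] gA A by (simp add: Un_commute Diff_disjoint Int_commute)
      moreover have "(\<integral>x\<in>UNIV. g x \<partial>lborel) = 0"
        using box0[of a b] by (simp add: set_lebesgue_integral_def g_def)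
      ultimately show ?case using compl by simp
    next
      case (union A)
      have A: "A n \<in> sets borel" for n using union unfolding borel_eq_box by auto
      have "set_integrable lborel (\<Union>n. A n) g"
        using integrable_mult_indicator[of "\<Union>n. A n" lborel g] gi A by (simp add: set_integrable_def)
      then have "(\<integral>x\<in>(\<Union>n. A n). g x \<partial>lborel) = (\<Sum>n. \<integral>x\<in>A n. g x \<partial>lborel)"
        using union(1) A by (intro lebesgue_integral_countable_add) (auto simp: disjoint_family_on_def)
      then show ?case using union by simp
    qed
  qed
  have "AE x in lborel. g x = 0"
    by (rule density_unique_real[OF gi]) (use g0 in \<open>auto simp: set_lebesgue_integral_def\<close>)
  then show ?thesis by eventually_elim (auto simp: g_def)
qed

text \<open>A test function on the smaller set is one on the larger set, and both integrals only see its support.\<close>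

lemma weak_pd_subset:
  fixes f :: "real^'n::finite \<Rightarrow> 'l::euclidean_space"
  assumes "weak_pd \<Omega> i f D" "\<Omega>' \<subseteq> \<Omega>"
  shows "weak_pd \<Omega>' i f D"
  unfolding weak_pd_def
proof (intro conjI allI impI)
  show "locally_integrable \<Omega>' f" "locally_integrable \<Omega>' D"
    using assms by (auto simp: weak_pd_def locally_integrable_def)
  fix \<eta> :: "real^'n \<Rightarrow> real"
  assume "smooth_on UNIV \<eta> \<and> (\<exists>K. compact K \<and> K \<subseteq> \<Omega>' \<and> (\<forall>x. x \<notin> K \<longrightarrow> \<eta> x = 0))"
  then obtain K where \<eta>: "smooth_on UNIV \<eta>" and K: "compact K" "K \<subseteq> \<Omega>'" "\<And>x. x \<notin> K \<Longrightarrow> \<eta> x = 0"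
    by auto
  have pd0: "pd i \<eta> x = 0" if "x \<notin> K" for x
    unfolding pd_def by (rule dderiv_zero_outside[OF compact_imp_closed[OF K(1)] K(3) that])
  have "indicator \<Omega>' x *\<^sub>R (g x *\<^sub>R h x) = indicator \<Omega> x *\<^sub>R (g x *\<^sub>R h x)"
    if "\<And>x. x \<notin> K \<Longrightarrow> g x = 0" for g :: "real^'n \<Rightarrow> real" and h :: "real^'n \<Rightarrow> 'l" and x
    using K(2) assms(2) that[of x] by (auto simp: indicator_def)
  note e = this
  have "(LINT x:\<Omega>'|lborel. pd i \<eta> x *\<^sub>R f x) = (LINT x:\<Omega>|lborel. pd i \<eta> x *\<^sub>R f x)"
    "(LINT x:\<Omega>'|lborel. \<eta> x *\<^sub>R D x) = (LINT x:\<Omega>|lborel. \<eta> x *\<^sub>R D x)"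
    unfolding set_lebesgue_integral_def
    by (rule Bochner_Integration.integral_cong[OF refl e], erule pd0)
       (rule Bochner_Integration.integral_cong[OF refl e], erule K(3))
  moreover have "\<exists>K. compact K \<and> K \<subseteq> \<Omega> \<and> (\<forall>x. x \<notin> K \<longrightarrow> \<eta> x = 0)" using K assms(2) by blast
  ultimately show "(LINT x:\<Omega>'|lborel. pd i \<eta> x *\<^sub>R f x) = - (LINT x:\<Omega>'|lborel. \<eta> x *\<^sub>R D x)"
    using assms(1) \<eta> by (simp only: weak_pd_def)
qed

lemma locally_integrable_combine:
  assumes "locally_integrable \<Omega> f" "locally_integrable \<Omega> g"
  shows "locally_integrable \<Omega> (\<lambda>x. f x + g x)" "locally_integrable \<Omega> (\<lambda>x. f x - g x)"
  using assms unfolding locally_integrable_def by (auto intro: set_integral_add set_integral_diff)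

lemma weak_pd_add:
  fixes f g :: "real^'n::finite \<Rightarrow> 'l::euclidean_space"
  assumes "weak_pd \<Omega> i f D" "weak_pd \<Omega> i g E"
  shows "weak_pd \<Omega> i (\<lambda>x. f x + g x) (\<lambda>x. D x + E x)"
  unfolding weak_pd_def
proof (intro conjI allI impI)
  have li: "locally_integrable \<Omega> f" "locally_integrable \<Omega> D" "locally_integrable \<Omega> g" "locally_integrable \<Omega> E"
    using assms by (auto simp: weak_pd_def)
  then show "locally_integrable \<Omega> (\<lambda>x. f x + g x)" "locally_integrable \<Omega> (\<lambda>x. D x + E x)"
    by (auto intro: locally_integrable_combine)
  fix \<eta> :: "real^'n \<Rightarrow> real"
  assume t: "smooth_on UNIV \<eta> \<and> (\<exists>K. compact K \<and> K \<subseteq> \<Omega> \<and> (\<forall>x. x \<notin> K \<longrightarrow> \<eta> x = 0))"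
  then obtain K where \<eta>: "Ck_on 1 UNIV \<eta>" and K: "compact K" "K \<subseteq> \<Omega>" "\<And>x. x \<notin> K \<Longrightarrow> \<eta> x = 0"
    unfolding smooth_on_def by blast
  have pd0: "pd i \<eta> x = 0" if "x \<notin> K" for x
    unfolding pd_def by (rule dderiv_zero_outside[OF compact_imp_closed[OF K(1)] K(3) that])
  have c: "continuous_on UNIV (pd i \<eta>)" "continuous_on UNIV \<eta>"
    using \<eta> Ck_on_imp_continuous_on[OF \<eta>] by (auto simp: pd_def)
  show "(LINT x:\<Omega>|lborel. pd i \<eta> x *\<^sub>R (f x + g x)) = - (LINT x:\<Omega>|lborel. \<eta> x *\<^sub>R (D x + E x))"
    using assms t
    by (simp add: scaleR_add_right set_integral_add integrable_test_times[OF li(1) c(1) K(1,2) pd0]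
        integrable_test_times[OF li(3) c(1) K(1,2) pd0] integrable_test_times[OF li(2) c(2) K]
        integrable_test_times[OF li(4) c(2) K] weak_pd_def)
qed

text \<open>The open set is a countable union of closed boxes. The fundamental lemma applies in the interior of each, to
  each component of the difference, and the faces of the boxes are null sets.\<close>

lemma weak_pd_unique:
  fixes f :: "real^'n::finite \<Rightarrow> 'l::euclidean_space"
  assumes O: "open \<Omega>" and D: "weak_pd \<Omega> i f D" "weak_pd \<Omega> i f E"
  shows "AE x in lborel. x \<in> \<Omega> \<longrightarrow> D x = E x"
proof -
  have li: "locally_integrable \<Omega> D" "locally_integrable \<Omega> E" using D by (auto simp: weak_pd_def)
  have box: "AE x in lborel. x \<in> box a b \<longrightarrow> D x \<bullet> e = E x \<bullet> e" if ab: "cbox a b \<subseteq> \<Omega>" for a b e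
  proof -
    have "AE x in lborel. x \<in> box a b \<longrightarrow> (D x - E x) \<bullet> e = 0"
    proof (rule fundamental_lemma_box)
      have "set_integrable lborel (cbox a b) (\<lambda>x. D x - E x)"
        using locally_integrable_combine(2)[OF li] ab by (auto simp: locally_integrable_def)
      then have "integrable lborel (\<lambda>x. (indicator (cbox a b) x *\<^sub>R (D x - E x)) \<bullet> e)"
        unfolding set_integrable_def by (rule integrable_inner_left)
      then show "set_integrable lborel (cbox a b) (\<lambda>x. (D x - E x) \<bullet> e)"
        by (simp add: set_integrable_def)
      fix \<eta> :: "real^'n \<Rightarrow> real" assume \<eta>: "smooth_on UNIV \<eta>" "\<And>x. x \<notin> cbox a b \<Longrightarrow> \<eta> x = 0"
      have c: "continuous_on UNIV \<eta>" using \<eta>(1) by (auto simp: smooth_on_def dest: spec[of _ 0])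
      have t: "smooth_on UNIV \<eta> \<and> (\<exists>K. compact K \<and> K \<subseteq> \<Omega> \<and> (\<forall>x. x \<notin> K \<longrightarrow> \<eta> x = 0))"
        using ab \<eta> by (intro conjI exI[of _ "cbox a b"]) auto
      have "(LINT x:\<Omega>|lborel. pd i \<eta> x *\<^sub>R f x) = - (LINT x:\<Omega>|lborel. \<eta> x *\<^sub>R D x)"
        "(LINT x:\<Omega>|lborel. pd i \<eta> x *\<^sub>R f x) = - (LINT x:\<Omega>|lborel. \<eta> x *\<^sub>R E x)"
        using D[unfolded weak_pd_def, THEN conjunct2, THEN conjunct2, rule_format, OF t] by simp_all
      then have "(LINT x:\<Omega>|lborel. \<eta> x *\<^sub>R D x) = (LINT x:\<Omega>|lborel. \<eta> x *\<^sub>R E x)" by simp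
      moreover have I: "set_integrable lborel \<Omega> (\<lambda>x. \<eta> x *\<^sub>R D x)" "set_integrable lborel \<Omega> (\<lambda>x. \<eta> x *\<^sub>R E x)"
        by (rule integrable_test_times[OF li(1) c compact_cbox ab \<eta>(2)], assumption,
            rule integrable_test_times[OF li(2) c compact_cbox ab \<eta>(2)], assumption)
      ultimately have "(LINT x:\<Omega>|lborel. \<eta> x *\<^sub>R D x - \<eta> x *\<^sub>R E x) = 0" by simp
      then have "(\<integral>x. indicator \<Omega> x *\<^sub>R (\<eta> x *\<^sub>R D x - \<eta> x *\<^sub>R E x) \<partial>lborel) \<bullet> e = 0"
        by (simp add: set_lebesgue_integral_def)
      moreover have "(\<integral>x. indicator \<Omega> x *\<^sub>R (\<eta> x *\<^sub>R D x - \<eta> x *\<^sub>R E x) \<partial>lborel) \<bullet> e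
         = (\<integral>x. (indicator \<Omega> x *\<^sub>R (\<eta> x *\<^sub>R D x - \<eta> x *\<^sub>R E x)) \<bullet> e \<partial>lborel)"
        using set_integral_diff(1)[OF I] unfolding set_integrable_def by (rule integral_inner_left[symmetric])
      moreover have "(indicator \<Omega> x *\<^sub>R (\<eta> x *\<^sub>R D x - \<eta> x *\<^sub>R E x)) \<bullet> e = \<eta> x * ((D x - E x) \<bullet> e)" for x
        using ab \<eta>(2)[of x] by (auto simp: indicator_def inner_diff_left right_diff_distrib)
      ultimately show "(\<integral>x. \<eta> x * ((D x - E x) \<bullet> e) \<partial>lborel) = 0" by simp
    qed
    then show ?thesis by eventually_elim (auto simp: inner_diff_left)
  qed
  have comp: "AE x in lborel. x \<in> \<Omega> \<longrightarrow> D x \<bullet> e = E x \<bullet> e" for e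
  proof -
    obtain \<D> where \<D>: "countable \<D>" "\<D> \<subseteq> Pow \<Omega>" "\<And>X. X \<in> \<D> \<Longrightarrow> \<exists>a b. X = cbox a b" "\<Union>\<D> = \<Omega>"
      using open_countable_Union_open_cbox[OF O] by metis
    have "AE x in lborel. x \<in> X \<longrightarrow> D x \<bullet> e = E x \<bullet> e" if X: "X \<in> \<D>" for X
    proof -
      obtain a b where ab: "X = cbox a b" using \<D>(3)[OF X] by auto
      have "negligible (cbox a b - box a b)" by (rule negligible_frontier_interval)
      then have "cbox a b - box a b \<in> null_sets lborel"
        by (auto simp: negligible_iff_null_sets null_sets_completion_iff)
      from AE_not_in[OF this] have 1: "AE x in lborel. x \<notin> cbox a b - box a b" .
      have "cbox a b \<subseteq> \<Omega>" using \<D>(2) X ab by auto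
      from 1 box[OF this, of e] show ?thesis unfolding ab by eventually_elim auto
    qed
    then have "AE x in lborel. \<forall>X\<in>\<D>. x \<in> X \<longrightarrow> D x \<bullet> e = E x \<bullet> e"
      using \<D>(1) by (subst AE_ball_countable) auto
    then show ?thesis by eventually_elim (use \<D>(4) in auto)
  qed
  then have "AE x in lborel. \<forall>e\<in>Basis. x \<in> \<Omega> \<longrightarrow> D x \<bullet> e = E x \<bullet> e"
    by (intro AE_finite_allI finite_Basis)
  then show ?thesis by eventually_elim (auto intro: euclidean_eqI)
qed

section \<open>Submanifolds of Euclidean space\<close>

text \<open>The diffeomorphism \<open>\<Phi>\<close> straightens \<open>N\<close> to the subspace \<open>S\<close>; the data of this predicate exist around every
  point of an embedded submanifold.\<close>

definition slice_chart ::
  "nat \<Rightarrow> 'l::euclidean_space set \<Rightarrow> 'l set \<Rightarrow> 'l set \<Rightarrow> ('l \<Rightarrow> 'l) \<Rightarrow> ('l \<Rightarrow> 'l) \<Rightarrow> 'l set \<Rightarrow> bool" where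
  "slice_chart d N V W \<Phi> \<Psi> S \<longleftrightarrow>
     open V \<and> open W \<and> \<Phi> ` V = W \<and> \<Psi> ` W = V \<and>
     (\<forall>z\<in>V. \<Psi> (\<Phi> z) = z) \<and> (\<forall>w\<in>W. \<Phi> (\<Psi> w) = w) \<and>
     smooth_on V \<Phi> \<and> smooth_on W \<Psi> \<and> subspace S \<and> dim S = d \<and> \<Phi> ` (V \<inter> N) = W \<inter> S"

lemma slice_chart_exists:
  fixes N :: "'l::euclidean_space set"
  assumes "embedded_submanifold d N" "y \<in> N"
  obtains V W \<Phi> \<Psi> S where "slice_chart d N V W \<Phi> \<Psi> S" "y \<in> V"
proof -
  from bspec[OF conjunct2[OF assms(1)[unfolded embedded_submanifold_def]] assms(2)]
  obtain V W :: "'l set" and \<Phi> \<Psi> :: "'l \<Rightarrow> 'l" and S :: "'l set" where "open V \<and> y \<in> V \<and> open W \<and> \<Phi> ` V = W \<and> \<Psi> ` W = V \<and>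
        (\<forall>z\<in>V. \<Psi> (\<Phi> z) = z) \<and> (\<forall>w\<in>W. \<Phi> (\<Psi> w) = w) \<and>
        smooth_on V \<Phi> \<and> smooth_on W \<Psi> \<and>
        subspace S \<and> dim S = d \<and> \<Phi> ` (V \<inter> N) = W \<inter> S"
    by (elim exE) (rule that)
  then show ?thesis by (intro that[of V W \<Phi> \<Psi> S]) (simp_all add: slice_chart_def)
qed

lemma isCont_eventually_in_open:
  assumes "isCont f a" "open S" "f a \<in> S"
  shows "\<forall>\<^sub>F x in nhds a. f x \<in> S"
  using topological_tendstoD[OF assms(1)[unfolded isCont_def] assms(2,3)] assms(3)
  by (auto simp: eventually_at_filter elim: eventually_mono)

lemma vector_derivative_in_subspace:
  fixes S :: "'l::euclidean_space set"
  assumes S: "subspace S" and g: "(g has_vector_derivative D) (at t)" "eventually (\<lambda>s. g s \<in> S) (nhds t)"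
  shows "D \<in> S"
proof -
  have "((\<lambda>h. (1 / h) *\<^sub>R (g (t + h) - g t)) \<longlongrightarrow> D) (at 0)"
  proof -
    have 1: "((\<lambda>h. norm (g (t + h) - g t - h *\<^sub>R D) / norm h) \<longlongrightarrow> 0) (at 0)"
      using g(1) by (simp add: has_vector_derivative_def has_derivative_at)
    have "((\<lambda>h. norm ((1 / h) *\<^sub>R (g (t + h) - g t) - D)) \<longlongrightarrow> 0) (at 0)"
    proof (rule Lim_transform_eventually[OF 1])
      have "norm (g (t + h) - g t - h *\<^sub>R D) / norm h = norm ((1 / h) *\<^sub>R (g (t + h) - g t) - D)" if "h \<noteq> 0" for h
      proof -
        have "(1 / h) *\<^sub>R (g (t + h) - g t) - D = (1 / h) *\<^sub>R (g (t + h) - g t - h *\<^sub>R D)"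
          using that by (simp add: scaleR_diff_right)
        then show ?thesis by simp
      qed
      then show "\<forall>\<^sub>F h in at 0. norm (g (t + h) - g t - h *\<^sub>R D) / norm h = norm ((1 / h) *\<^sub>R (g (t + h) - g t) - D)"
        by (simp add: eventually_at_filter)
    qed
    then show ?thesis by (simp add: tendsto_norm_zero_iff LIM_zero_iff)
  qed
  moreover have "\<forall>\<^sub>F h in at 0. (1 / h) *\<^sub>R (g (t + h) - g t) \<in> S"
  proof -
    have "((\<lambda>h. t + h) \<longlongrightarrow> t + 0) (at 0)" by (intro tendsto_intros)
    then have "\<forall>\<^sub>F h in at 0. g (t + h) \<in> S"
      using g(2) by (subst (asm) filterlim_iff) (drule spec[of _ "\<lambda>s. g s \<in> S"], simp)
    then show ?thesis
      by eventually_elim (intro subspace_scale[OF S] subspace_diff[OF S] eventually_nhds_x_imp_x[OF g(2)])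
  qed
  ultimately show ?thesis
    using Lim_in_closed_set[OF closed_subspace[OF S], of "\<lambda>h. (1 / h) *\<^sub>R (g (t + h) - g t)" "at 0" D] by simp
qed

context
  fixes d :: nat and N V W :: "'l::euclidean_space set" and \<Phi> \<Psi> :: "'l \<Rightarrow> 'l" and S :: "'l set"
  assumes sc: "slice_chart d N V W \<Phi> \<Psi> S"
begin

lemma slice_chart_facts:
  shows slice_open: "open V" "open W"
    and slice_Phi_in: "z \<in> V \<Longrightarrow> \<Phi> z \<in> W" and slice_Psi_in: "w \<in> W \<Longrightarrow> \<Psi> w \<in> V"
    and slice_Psi_Phi: "z \<in> V \<Longrightarrow> \<Psi> (\<Phi> z) = z" and slice_Phi_Psi: "w \<in> W \<Longrightarrow> \<Phi> (\<Psi> w) = w"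
    and slice_smooth: "Ck_on k V \<Phi>" "Ck_on k W \<Psi>"
    and slice_subspace: "subspace S" and slice_dim: "dim S = d"
    and slice_Phi_S: "z \<in> V \<Longrightarrow> z \<in> N \<Longrightarrow> \<Phi> z \<in> S"
    and slice_Psi_N: "w \<in> W \<Longrightarrow> w \<in> S \<Longrightarrow> \<Psi> w \<in> N"
proof -
  show "w \<in> W \<Longrightarrow> w \<in> S \<Longrightarrow> \<Psi> w \<in> N"
  proof -
    assume "w \<in> W" "w \<in> S"
    then have "w \<in> \<Phi> ` (V \<inter> N)" using sc by (simp add: slice_chart_def)
    then obtain z where "z \<in> V" "z \<in> N" "w = \<Phi> z" by blast
    then show "\<Psi> w \<in> N" using sc by (simp add: slice_chart_def)
  qed
qed (use sc in \<open>auto simp: slice_chart_def smooth_on_def\<close>)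

lemma slice_Phi_diff: "z \<in> V \<Longrightarrow> \<Phi> differentiable (at z)"
  and slice_Psi_diff: "w \<in> W \<Longrightarrow> \<Psi> differentiable (at w)"
  using Ck_on_imp_differentiable[OF slice_smooth(1)[of 1]] Ck_on_imp_differentiable[OF slice_smooth(2)[of 1]]
  by auto

lemma slice_inverse1: "z \<in> V \<Longrightarrow> dderiv \<Psi> (dderiv \<Phi> v z) (\<Phi> z) = v"
proof -
  assume z: "z \<in> V"
  have "dderiv (\<lambda>z. \<Psi> (\<Phi> z)) v z = dderiv (\<lambda>z. z) v z"
    by (rule dderiv_cong[OF slice_open(1) z, symmetric]) (auto simp: slice_Psi_Phi)
  then show ?thesis
    using dderiv_compose[OF slice_Phi_diff[OF z] slice_Psi_diff[OF slice_Phi_in[OF z]]] by simp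
qed

lemma slice_inverse2: "w \<in> W \<Longrightarrow> dderiv \<Phi> (dderiv \<Psi> v w) (\<Psi> w) = v"
proof -
  assume w: "w \<in> W"
  have "dderiv (\<lambda>z. \<Phi> (\<Psi> z)) v w = dderiv (\<lambda>z. z) v w"
    by (rule dderiv_cong[OF slice_open(2) w, symmetric]) (auto simp: slice_Phi_Psi)
  then show ?thesis
    using dderiv_compose[OF slice_Psi_diff[OF w] slice_Phi_diff[OF slice_Psi_in[OF w]]] by simp
qed

lemma linear_dPsi: "w \<in> W \<Longrightarrow> linear (\<lambda>v. dderiv \<Psi> v w)"
  using linear_frechet_derivative[OF slice_Psi_diff] .

lemma linear_dPhi: "w \<in> V \<Longrightarrow> linear (\<lambda>v. dderiv \<Phi> v w)"
  using linear_frechet_derivative[OF slice_Phi_diff] .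

lemma dPhi_curve_in_slice:
  assumes y: "y \<in> V" "\<gamma> t = y" and g: "(\<gamma> has_vector_derivative v) (at t)" "eventually (\<lambda>s. \<gamma> s \<in> N) (nhds t)"
  shows "dderiv \<Phi> v y \<in> S"
proof (rule vector_derivative_in_subspace[OF slice_subspace])
  have "((\<lambda>s. \<Phi> (\<gamma> s)) has_derivative (\<lambda>h. dderiv \<Phi> (h *\<^sub>R v) y)) (at t)"
    using diff_chain_at[of \<gamma> "\<lambda>h. h *\<^sub>R v" t \<Phi>, OF _ differentiable_has_dderiv] g(1) y slice_Phi_diff
    by (simp add: has_vector_derivative_def o_def)
  then show "((\<lambda>s. \<Phi> (\<gamma> s)) has_vector_derivative dderiv \<Phi> v y) (at t)"
    using linear_cmul[OF linear_dPhi[OF y(1)]] by (simp add: has_vector_derivative_def)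
  have "isCont \<gamma> t" using g(1) by (rule has_vector_derivative_continuous)
  then have "\<forall>\<^sub>F s in nhds t. \<gamma> s \<in> V"
    using slice_open(1) y by (auto intro: isCont_eventually_in_open)
  then show "\<forall>\<^sub>F s in nhds t. \<Phi> (\<gamma> s) \<in> S" using g(2) by eventually_elim (rule slice_Phi_S)
qed

text \<open>Straightening turns curves in \<open>N\<close> into curves in \<open>S\<close>, whose velocities are the vectors of \<open>S\<close>. Conversely
  the image of a straight line in \<open>S\<close> is a curve in \<open>N\<close>; the velocity only concerns small times, so the curve
  may stay constant once the line leaves \<open>W\<close>.\<close>

lemma tangent_space_slice:
  assumes y: "y \<in> V" "y \<in> N"
  shows "tangent_space N y = (\<lambda>s. dderiv \<Psi> s (\<Phi> y)) ` S"
proof safe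
  fix v assume "v \<in> tangent_space N y"
  then obtain \<gamma> where "\<And>t. \<gamma> t \<in> N" "\<gamma> 0 = y" "(\<gamma> has_vector_derivative v) (at 0)"
    by (auto simp: tangent_space_def)
  then have "dderiv \<Phi> v y \<in> S" using dPhi_curve_in_slice[OF y(1), of \<gamma> 0 v] by auto
  then show "v \<in> (\<lambda>s. dderiv \<Psi> s (\<Phi> y)) ` S" using slice_inverse1[OF y(1), of v] by (metis imageI)
next
  fix s assume s: "s \<in> S"
  have w: "\<Phi> y \<in> W" "\<Phi> y \<in> S" using slice_Phi_in slice_Phi_S y by auto
  define \<gamma> where "\<gamma> t = (if \<Phi> y + t *\<^sub>R s \<in> W then \<Psi> (\<Phi> y + t *\<^sub>R s) else y)" for t
  have "\<gamma> t \<in> N" for t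
    using slice_Psi_N[of "\<Phi> y + t *\<^sub>R s"] slice_subspace s w y(2)
    by (auto simp: \<gamma>_def subspace_add subspace_scale)
  moreover have "\<gamma> 0 = y" using slice_Psi_Phi[OF y(1)] by (simp add: \<gamma>_def)
  moreover have "(\<gamma> has_vector_derivative dderiv \<Psi> s (\<Phi> y)) (at 0)"
  proof -
    have "open ((\<lambda>t. \<Phi> y + t *\<^sub>R s) -` W)"
      by (intro open_vimage slice_open) (auto intro!: continuous_intros)
    then show ?thesis
      using has_vector_derivative_along_line[of \<Psi> "\<Phi> y" 0 s] slice_Psi_diff[OF w(1)] w(1)
      by (auto simp: \<gamma>_def intro!: has_vector_derivative_transform_within_open[where f = "\<lambda>t. \<Psi> (\<Phi> y + t *\<^sub>R s)" and S = "(\<lambda>t. \<Phi> y + t *\<^sub>R s) -` W"])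
  qed
  ultimately show "dderiv \<Psi> s (\<Phi> y) \<in> tangent_space N y" by (auto simp: tangent_space_def)
qed

lemma tangent_space_iff:
  assumes "y \<in> V" "y \<in> N"
  shows "v \<in> tangent_space N y \<longleftrightarrow> dderiv \<Phi> v y \<in> S"
  using tangent_space_slice[OF assms] slice_inverse1[OF assms(1)] slice_inverse2[OF slice_Phi_in[OF assms(1)]]
    slice_Psi_Phi[OF assms(1)]
  by (metis (no_types, lifting) image_iff)

lemma subspace_tangent_space_slice:
  assumes "y \<in> V" "y \<in> N"
  shows "subspace (tangent_space N y)"
  unfolding tangent_space_slice[OF assms]
  by (rule linear_subspace_image[OF linear_dPsi[OF slice_Phi_in[OF assms(1)]] slice_subspace])

lemma dim_tangent_space_slice:
  assumes "y \<in> V" "y \<in> N"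
  shows "dim (tangent_space N y) = d"
proof -
  have "inj (\<lambda>s. dderiv \<Psi> s (\<Phi> y))"
    using slice_inverse2[OF slice_Phi_in[OF assms(1)]] by (metis injI)
  then show ?thesis unfolding tangent_space_slice[OF assms]
    using dim_image_eq[OF linear_dPsi[OF slice_Phi_in[OF assms(1)]]] slice_dim by (metis inj_on_subset subset_UNIV)
qed

text \<open>Applying \<open>D\<Phi>\<close> turns a tangent field along \<open>\<gamma>\<close> into a curve in the subspace \<open>S\<close>, whose derivative lies in
  \<open>S\<close>. Since the field vanishes at time zero, the derivative of \<open>D\<Phi>\<close> itself does not contribute. Applied to the
  difference of two tangent fields that agree at one point, this says that their derivatives there have the same
  normal part.\<close>

lemma tangent_derivative_of_vanishing_field:
  assumes y: "y \<in> V" "y \<in> N" "\<gamma> 0 = y"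
    and \<gamma>: "\<gamma> differentiable (at 0)" "eventually (\<lambda>t. \<gamma> t \<in> N) (nhds 0)"
    and X: "(X has_vector_derivative D) (at 0)" "eventually (\<lambda>t. X t \<in> tangent_space N (\<gamma> t)) (nhds 0)" "X 0 = 0"
  shows "D \<in> tangent_space N y"
proof -
  have dg: "dderiv \<Phi> b differentiable (at y)" for b
    using slice_smooth(1)[of 2] y by (auto simp: numeral_2_eq_2)
  have V: "\<forall>\<^sub>F t in nhds 0. \<gamma> t \<in> V"
    using slice_open(1) y differentiable_imp_continuous_within[OF \<gamma>(1)] by (auto intro: isCont_eventually_in_open)
  have "((\<lambda>t. \<Sum>b\<in>Basis. (X t \<bullet> b) *\<^sub>R dderiv \<Phi> b (\<gamma> t)) has_vector_derivative
      (\<Sum>b\<in>Basis. (D \<bullet> b) *\<^sub>R dderiv \<Phi> b y)) (at 0)"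
  proof (rule has_vector_derivative_sum)
    fix b :: 'l
    have 1: "(\<lambda>t. dderiv \<Phi> b (\<gamma> t)) differentiable (at 0)"
      using differentiable_chain_at[OF \<gamma>(1), of "dderiv \<Phi> b"] dg y by (simp add: o_def)
    then obtain E where E: "((\<lambda>t. dderiv \<Phi> b (\<gamma> t)) has_vector_derivative E) (at 0)"
      using vector_derivative_works by blast
    have "((\<lambda>t. X t \<bullet> b) has_vector_derivative D \<bullet> b) (at 0)"
      using X(1) by (rule bounded_linear.has_vector_derivative[OF bounded_linear_inner_left])
    then show "((\<lambda>t. (X t \<bullet> b) *\<^sub>R dderiv \<Phi> b (\<gamma> t)) has_vector_derivative (D \<bullet> b) *\<^sub>R dderiv \<Phi> b y) (at 0)"
      using has_vector_derivative_scaleR[of "\<lambda>t. X t \<bullet> b" "D \<bullet> b" 0 UNIV, OF _ E] X(3) y(3)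
      by (simp add: has_real_derivative_iff_has_vector_derivative)
  qed
  moreover have "\<forall>\<^sub>F t in nhds 0. (\<Sum>b\<in>Basis. (X t \<bullet> b) *\<^sub>R dderiv \<Phi> b (\<gamma> t)) \<in> S"
    using V \<gamma>(2) X(2)
    by eventually_elim (simp add: tangent_space_iff dderiv_in_basis[OF slice_Phi_diff, symmetric])
  ultimately have "(\<Sum>b\<in>Basis. (D \<bullet> b) *\<^sub>R dderiv \<Phi> b y) \<in> S"
    by (rule vector_derivative_in_subspace[OF slice_subspace])
  then show ?thesis using y by (simp add: tangent_space_iff dderiv_in_basis[OF slice_Phi_diff, symmetric])
qed

end

lemma subspace_tangent_space:
  "embedded_submanifold d N \<Longrightarrow> y \<in> N \<Longrightarrow> subspace (tangent_space N y)"
  by (metis slice_chart_exists subspace_tangent_space_slice)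

lemma dim_tangent_space:
  "embedded_submanifold d N \<Longrightarrow> y \<in> N \<Longrightarrow> dim (tangent_space N y) = d"
  by (metis slice_chart_exists dim_tangent_space_slice)

text \<open>Two candidates for the orthogonal projection differ by a tangent vector that is orthogonal to itself.\<close>

lemma tangential_eqI:
  assumes S: "subspace (tangent_space N y)" and w: "w \<in> tangent_space N y" "\<And>s. s \<in> tangent_space N y \<Longrightarrow> (v - w) \<bullet> s = 0"
  shows "tangential N y v = w"
  unfolding tangential_def
proof (rule the_equality)
  fix z assume z: "z \<in> tangent_space N y \<and> (\<forall>s\<in>tangent_space N y. (v - z) \<bullet> s = 0)"
  have "w - z \<in> tangent_space N y" using z w subspace_diff[OF S] by auto
  then have "(v - w) \<bullet> (w - z) = 0" "(v - z) \<bullet> (w - z) = 0" using w(2) z by auto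
  then have "(w - z) \<bullet> (w - z) = 0" by (simp add: inner_diff_left)
  then show "z = w" by simp
qed (use w in auto)

context
  fixes N :: "'l::euclidean_space set" and y :: 'l
  assumes S: "subspace (tangent_space N y)"
begin

lemma tangential_props:
  shows tangential_in: "tangential N y v \<in> tangent_space N y"
    and tangential_orth: "s \<in> tangent_space N y \<Longrightarrow> (v - tangential N y v) \<bullet> s = 0"
proof -
  obtain a b where ab: "a \<in> span (tangent_space N y)" "\<And>w. w \<in> span (tangent_space N y) \<Longrightarrow> orthogonal b w" "v = a + b"
    using orthogonal_subspace_decomp_exists[of "tangent_space N y" v] by metis
  have sp: "span (tangent_space N y) = tangent_space N y" using S by (simp add: span_eq_iff)
  have "tangential N y v = a" by (rule tangential_eqI[OF S]) (use ab sp in \<open>auto simp: orthogonal_def\<close>)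
  then show "tangential N y v \<in> tangent_space N y"
    "s \<in> tangent_space N y \<Longrightarrow> (v - tangential N y v) \<bullet> s = 0"
    using ab sp by (auto simp: orthogonal_def)
qed

lemma tangential_id: "v \<in> tangent_space N y \<Longrightarrow> tangential N y v = v"
  by (rule tangential_eqI[OF S]) auto

lemma tangential_add: "tangential N y (v + w) = tangential N y v + tangential N y w"
  by (rule tangential_eqI[OF S])
    (use tangential_orth[of _ v] tangential_orth[of _ w] in \<open>auto intro!: subspace_add[OF S] tangential_in simp: algebra_simps inner_add_left inner_diff_left\<close>)

lemma tangential_scaleR: "tangential N y (c *\<^sub>R v) = c *\<^sub>R tangential N y v"
  by (rule tangential_eqI[OF S])
    (use tangential_orth[of _ v] in \<open>auto intro!: subspace_scale[OF S] tangential_in simp: inner_diff_left\<close>)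

lemma tangential_diff: "tangential N y (v - w) = tangential N y v - tangential N y w"
  using tangential_add[of v "(-1) *\<^sub>R w"] tangential_scaleR[of "-1" w] by simp

lemma tangential_inner: "s \<in> tangent_space N y \<Longrightarrow> tangential N y v \<bullet> s = v \<bullet> s"
  using tangential_orth[of s v] by (simp add: inner_diff_left)

end

text \<open>The derivative in direction \<open>v\<close> is the velocity of the image of a straight segment, prolonged by a constant.\<close>

lemma dderiv_in_tangent_space:
  fixes U :: "'a::real_normed_vector \<Rightarrow> 'l::euclidean_space"
  assumes S: "open S" "x \<in> S" and U: "\<And>x. x \<in> S \<Longrightarrow> U x \<in> N" "U differentiable (at x)"
  shows "dderiv U v x \<in> tangent_space N (U x)"
proof -
  define \<gamma> where "\<gamma> t = (if x + t *\<^sub>R v \<in> S then U (x + t *\<^sub>R v) else U x)" for t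
  have "\<gamma> t \<in> N" for t using U S by (auto simp: \<gamma>_def)
  moreover have "\<gamma> 0 = U x" by (simp add: \<gamma>_def)
  moreover have "(\<gamma> has_vector_derivative dderiv U v x) (at 0)"
  proof -
    have "open ((\<lambda>t. x + t *\<^sub>R v) -` S)"
      by (intro open_vimage S) (auto intro!: continuous_intros)
    then show ?thesis
      using has_vector_derivative_along_line[of U x 0 v] U S
      by (auto simp: \<gamma>_def intro!: has_vector_derivative_transform_within_open[where f = "\<lambda>t. U (x + t *\<^sub>R v)" and S = "(\<lambda>t. x + t *\<^sub>R v) -` S"])
  qed
  ultimately show ?thesis by (auto simp: tangent_space_def)
qed

text \<open>Along \<open>t \<mapsto> U (x + t v)\<close> both the derivative of \<open>U\<close> in direction \<open>w\<close> and any tangential extension of its value at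
  \<open>x\<close> are tangent fields, and they agree at \<open>t = 0\<close>. Hence they have the same normal derivative, and the value of
  the second fundamental form does not depend on the extension. An extension exists: transport a constant vector of
  the straightened submanifold by \<open>D\<Psi>\<close>.\<close>

lemma second_fundamental_form_dderiv:
  fixes U :: "'a::euclidean_space \<Rightarrow> 'l::euclidean_space"
  assumes N: "embedded_submanifold d N"
    and S: "open S" "x \<in> S" and U: "\<And>x. x \<in> S \<Longrightarrow> U x \<in> N" "Ck_on 2 S U"
  shows "second_fundamental_form N (U x) (dderiv U v x) (dderiv U w x)
    = tangential N (U x) (dderiv (dderiv U w) v x) - dderiv (dderiv U w) v x"
proof -
  define y where "y = U x"
  have yN: "y \<in> N" using U S by (simp add: y_def)
  obtain V W \<Phi> \<Psi> T where sc: "slice_chart d N V W \<Phi> \<Psi> T" and yV: "y \<in> V"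
    using slice_chart_exists[OF N yN] by metis
  note sub = subspace_tangent_space[OF N yN]
  have dU: "U differentiable (at z)" "dderiv U u differentiable (at z)" if "z \<in> S" for z u
    using U(2) that by (auto simp: numeral_2_eq_2)
  have tU: "dderiv U u z \<in> tangent_space N (U z)" if "z \<in> S" for u z
    by (rule dderiv_in_tangent_space[OF S(1) that U(1) dU(1)[OF that]])
  define B where "B = dderiv (dderiv U w) v x"
  have key: "- (frechet_derivative Z (at y) (dderiv U v x) - tangential N y (frechet_derivative Z (at y) (dderiv U v x)))
      = tangential N y B - B"
    if Z: "open V'" "y \<in> V'" "smooth_on V' Z" "\<And>z. z \<in> V' \<inter> N \<Longrightarrow> Z z \<in> tangent_space N z" "Z y = dderiv U w x" for V' Z
  proof -
    have dZ: "Z differentiable (at y)"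
      using Z by (intro Ck_on_imp_differentiable[of 1 V']) (auto simp: smooth_on_def)
    define \<gamma> where "\<gamma> t = U (x + t *\<^sub>R v)" for t :: real
    have \<gamma>: "(\<gamma> has_vector_derivative dderiv U v x) (at 0)"
      using has_vector_derivative_along_line[of U x 0 v] dU S by (simp add: \<gamma>_def[abs_def])
    have evS: "\<forall>\<^sub>F t in nhds 0. x + t *\<^sub>R v \<in> S"
      using S by (intro isCont_eventually_in_open) (auto intro!: continuous_intros)
    have evV: "\<forall>\<^sub>F t in nhds 0. \<gamma> t \<in> V'"
      using has_vector_derivative_continuous[OF \<gamma>] Z(1,2)
      by (intro isCont_eventually_in_open) (simp_all add: \<gamma>_def[of 0] y_def)
    have "(Z \<circ> \<gamma> has_derivative (\<lambda>h. dderiv Z (h *\<^sub>R dderiv U v x) y)) (at 0)"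
      using diff_chain_at[of \<gamma> "\<lambda>h. h *\<^sub>R dderiv U v x" 0 Z, OF _ differentiable_has_dderiv] \<gamma> dZ
      by (simp add: has_vector_derivative_def o_def \<gamma>_def y_def)
    then have Z': "((\<lambda>t. Z (\<gamma> t)) has_vector_derivative dderiv Z (dderiv U v x) y) (at 0)"
      using linear_cmul[OF linear_frechet_derivative[OF dZ]] by (simp add: has_vector_derivative_def o_def)
    have "((\<lambda>t. Z (\<gamma> t) - dderiv U w (x + t *\<^sub>R v)) has_vector_derivative dderiv Z (dderiv U v x) y - B) (at 0)"
      using has_vector_derivative_along_line[of "dderiv U w" x 0 v] dU S
      by (intro has_vector_derivative_diff Z') (simp add: B_def)
    then have "dderiv Z (dderiv U v x) y - B \<in> tangent_space N y"
    proof (rule tangent_derivative_of_vanishing_field[OF sc yV yN, rotated 3])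
      show "\<gamma> 0 = y" by (simp add: \<gamma>_def y_def)
      show "\<gamma> differentiable (at 0)" using \<gamma> differentiableI_vector by blast
      show "\<forall>\<^sub>F t in nhds 0. \<gamma> t \<in> N" using evS by eventually_elim (simp add: \<gamma>_def U)
      show "\<forall>\<^sub>F t in nhds 0. Z (\<gamma> t) - dderiv U w (x + t *\<^sub>R v) \<in> tangent_space N (\<gamma> t)"
        using evS evV
      proof eventually_elim
        case (elim t)
        have "\<gamma> t \<in> N" using U elim by (simp add: \<gamma>_def)
        then show ?case using elim Z(4)[of "\<gamma> t"] tU[of "x + t *\<^sub>R v" w]
          by (intro subspace_diff subspace_tangent_space[OF N]) (auto simp: \<gamma>_def)
      qed
      show "Z (\<gamma> 0) - dderiv U w (x + 0 *\<^sub>R v) = 0" using Z(5) by (simp add: \<gamma>_def y_def)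
    qed
    from tangential_id[OF sub this] show ?thesis by (simp add: tangential_diff[OF sub] algebra_simps)
  qed
  have ex: "\<exists>V' Z. open V' \<and> y \<in> V' \<and> smooth_on V' Z \<and> (\<forall>z\<in>V' \<inter> N. Z z \<in> tangent_space N z) \<and> Z y = dderiv U w x"
  proof (intro exI conjI ballI)
    let ?Z = "\<lambda>z. dderiv \<Psi> (dderiv \<Phi> (dderiv U w x) y) (\<Phi> z)"
    show "smooth_on V ?Z" unfolding smooth_on_def
      by (intro allI Ck_on_compose[OF slice_open(1)[OF sc] slice_smooth(1)[OF sc] Ck_on_dderiv[OF slice_smooth(2)[OF sc]] slice_Phi_in[OF sc]])
    show "?Z y = dderiv U w x" by (rule slice_inverse1[OF sc yV])
    have "dderiv \<Phi> (dderiv U w x) y \<in> T"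
      using tU[OF S(2), of w] tangent_space_iff[OF sc yV yN] by (simp add: y_def)
    then show "?Z z \<in> tangent_space N z" if "z \<in> V \<inter> N" for z
      using tangent_space_slice[OF sc, of z] that by auto
  qed (use slice_open[OF sc] yV in auto)
  have "second_fundamental_form N y (dderiv U v x) (dderiv U w x) = tangential N y B - B"
    unfolding second_fundamental_form_def
  proof (rule the_equality)
    show "\<forall>V Z. open V \<and> y \<in> V \<and> smooth_on V Z \<and> (\<forall>z\<in>V \<inter> N. Z z \<in> tangent_space N z) \<and> Z y = dderiv U w x \<longrightarrow>
      tangential N y B - B = - (frechet_derivative Z (at y) (dderiv U v x) - tangential N y (frechet_derivative Z (at y) (dderiv U v x)))"
      using key by (metis)
    fix a assume a: "\<forall>V Z. open V \<and> y \<in> V \<and> smooth_on V Z \<and> (\<forall>z\<in>V \<inter> N. Z z \<in> tangent_space N z) \<and> Z y = dderiv U w x \<longrightarrow>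
      a = - (frechet_derivative Z (at y) (dderiv U v x) - tangential N y (frechet_derivative Z (at y) (dderiv U v x)))"
    obtain V' Z where Z: "open V'" "y \<in> V'" "smooth_on V' Z" "\<forall>z\<in>V' \<inter> N. Z z \<in> tangent_space N z" "Z y = dderiv U w x"
      using ex by blast
    then have "a = - (frechet_derivative Z (at y) (dderiv U v x) - tangential N y (frechet_derivative Z (at y) (dderiv U v x)))"
      using a by blast
    also have "\<dots> = tangential N y B - B" using key[OF Z(1,2,3) _ Z(5)] Z(4) by blast
    finally show "a = tangential N y B - B" .
  qed
  then show ?thesis by (simp add: y_def B_def)
qed

section \<open>Orthonormal frames and the metric in coordinates\<close>

lemma matrix_inv_eqI:
  fixes A B :: "real^'n^'n"
  assumes "B ** A = mat 1"
  shows "matrix_inv A = B"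
proof -
  have AB: "A ** B = mat 1" using assms by (simp add: matrix_left_right_inverse)
  have "A ** matrix_inv A = mat 1 \<and> matrix_inv A ** A = mat 1"
    unfolding matrix_inv_def by (rule someI[of _ B]) (use AB assms in simp)
  then have "B ** (A ** matrix_inv A) = B" by simp
  then show ?thesis by (simp add: matrix_mul_assoc assms)
qed

definition pos_def :: "real^'n^'n \<Rightarrow> bool" where
  "pos_def A \<longleftrightarrow> transpose A = A \<and> (\<forall>v. v \<noteq> 0 \<longrightarrow> 0 < v \<bullet> (A *v v))"

text \<open>A frame is an orthonormal basis for the inner product with matrix \<open>A\<close>; its \<open>k\<close>-th vector is \<open>P k\<close>.\<close>

definition frame :: "real^'n^'n \<Rightarrow> ('n \<Rightarrow> real^'n) \<Rightarrow> bool" where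
  "frame A P \<longleftrightarrow> (\<forall>k l. P k \<bullet> (A *v P l) = (if k = l then 1 else 0))"

lemma pos_def_commute: "pos_def A \<Longrightarrow> v \<bullet> (A *v w) = w \<bullet> (A *v v)"
  unfolding pos_def_def by (metis dot_lmul_matrix inner_commute transpose_matrix_vector)

text \<open>As long as an orthonormal set \<open>B\<close> has fewer than \<open>n\<close> elements, the Euclidean orthogonal complement of
  \<open>A *v B\<close> contains a nonzero vector, and normalizing it enlarges \<open>B\<close>. Starting from \<open>{v}\<close> keeps \<open>v\<close> in the frame,
  and a transposition puts it at the index \<open>k0\<close>.\<close>

lemma frame_exists:
  fixes A :: "real^'n::finite^'n"
  assumes A: "pos_def A" and v: "v \<bullet> (A *v v) = 1"
  obtains P where "frame A P" "P k0 = v"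
proof -
  have ex: "\<exists>B. finite B \<and> card B = Suc m \<and> v \<in> B \<and> (\<forall>x\<in>B. \<forall>y\<in>B. x \<bullet> (A *v y) = (if x = y then 1 else 0))"
    if "m < CARD('n)" for m
    using that
  proof (induction m)
    case 0
    then show ?case using v by (intro exI[of _ "{v}"]) auto
  next
    case (Suc m)
    then obtain B where B: "finite B" "card B = Suc m" "v \<in> B"
      "\<And>x y. x \<in> B \<Longrightarrow> y \<in> B \<Longrightarrow> x \<bullet> (A *v y) = (if x = y then 1 else 0)" by auto
    have "dim ((*v) A ` B) \<le> card ((*v) A ` B)" using B(1) by (intro dim_le_card') auto
    also have "\<dots> \<le> card B" using B(1) by (rule card_image_le)
    finally have "dim ((*v) A ` B) < DIM(real^'n)" using B(2) Suc.prems by simp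
    then obtain x where x: "x \<noteq> 0" "\<And>y. y \<in> span ((*v) A ` B) \<Longrightarrow> orthogonal x y"
      using orthogonal_to_subspace_exists by blast
    have xb: "x \<bullet> (A *v b) = 0" if "b \<in> B" for b
      using x(2)[of "A *v b"] that by (auto simp: orthogonal_def intro: span_base)
    define r where "r = x \<bullet> (A *v x)"
    have r: "r > 0" using x(1) A by (auto simp: pos_def_def r_def)
    define z where "z = (1 / sqrt r) *\<^sub>R x"
    have zz: "z \<bullet> (A *v z) = 1"
      using r by (simp add: z_def matrix_vector_mult_scaleR r_def[symmetric])
    have zb: "z \<bullet> (A *v b) = 0" "b \<bullet> (A *v z) = 0" if "b \<in> B" for b
      using xb[OF that] pos_def_commute[OF A, of b z] by (auto simp: z_def)
    have "z \<notin> B" using zb zz by force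
    then show ?case using B zz zb by (intro exI[of _ "insert z B"]) auto
  qed
  have "CARD('n) > 0" by simp
  then obtain B where B: "finite B" "card B = CARD('n)" "v \<in> B"
    "\<And>x y. x \<in> B \<Longrightarrow> y \<in> B \<Longrightarrow> x \<bullet> (A *v y) = (if x = y then 1 else 0)"
    using ex[of "CARD('n) - 1"] by auto
  obtain f where f: "bij_betw f (UNIV :: 'n set) B"
    using finite_same_card_bij[OF _ B(1), of "UNIV :: 'n set"] B(2) by auto
  obtain k1 where k1: "f k1 = v" using f B(3) by (metis bij_betw_def imageE)
  define P where "P k = f (if k = k0 then k1 else if k = k1 then k0 else k)" for k
  have inj: "P k = P l \<longleftrightarrow> k = l" for k l
    using f by (auto simp: P_def bij_betw_def inj_eq split: if_splits)
  have "P k \<in> B" for k using f by (auto simp: P_def bij_betw_def)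
  then show ?thesis using inj B(4) k1 by (intro that[of P]) (auto simp: frame_def P_def[of k0])
qed

text \<open>If the matrix \<open>Q\<close> has the frame as its columns, orthonormality is \<open>transpose Q ** A ** Q = mat 1\<close>. This makes
  \<open>Q ** transpose Q\<close> the inverse of \<open>A\<close>, and comparing determinants shows that \<open>det A\<close> is positive.\<close>

lemma frame_facts:
  fixes A :: "real^'n::finite^'n"
  assumes P: "frame A P"
  shows matrix_inv_frame: "matrix_inv A $ i $ j = (\<Sum>k\<in>UNIV. P k $ i * P k $ j)"
    and det_frame: "det A > 0"
    and matrix_inv_left: "matrix_inv A ** A = mat 1"
proof -
  define Q where "Q = (\<chi> i k. P k $ i)"
  have "(transpose Q ** (A ** Q)) $ k $ l = P k \<bullet> (A *v P l)" for k l
    by (simp add: Q_def matrix_matrix_mult_def transpose_def inner_vec_def matrix_vector_mult_def)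
  then have QAQ: "transpose Q ** (A ** Q) = mat 1" using P
    by (simp add: vec_eq_iff frame_def mat_def)
  then have "(transpose Q ** A) ** Q = mat 1" by (simp add: matrix_mul_assoc)
  then have "Q ** (transpose Q ** A) = mat 1" by (simp add: matrix_left_right_inverse)
  then have QQ: "(Q ** transpose Q) ** A = mat 1" by (simp add: matrix_mul_assoc)
  then have "matrix_inv A = Q ** transpose Q" by (rule matrix_inv_eqI)
  then show "matrix_inv A $ i $ j = (\<Sum>k\<in>UNIV. P k $ i * P k $ j)" "matrix_inv A ** A = mat 1"
    using QQ by (simp_all add: Q_def matrix_matrix_mult_def transpose_def)
  have "det Q * (det A * det Q) = 1" using arg_cong[OF QAQ, of det] by (simp add: det_mul)
  then have "det A * (det Q)^2 = 1" by (simp add: power2_eq_square ac_simps)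
  then show "det A > 0" by (metis zero_less_mult_pos2 zero_less_one zero_less_power2 mult_zero_right zero_neq_one power_zero_numeral)
qed

lemma pos_def_frame_exists:
  fixes A :: "real^'n::finite^'n"
  assumes "pos_def A"
  obtains P where "frame A P"
proof -
  obtain x :: "real^'n" where x: "x \<noteq> 0" using axis_eq_0_iff by (metis zero_neq_one)
  define v where "v = (1 / sqrt (x \<bullet> (A *v x))) *\<^sub>R x"
  have "x \<bullet> (A *v x) > 0" using assms x by (simp add: pos_def_def)
  then have "v \<bullet> (A *v v) = 1" by (simp add: v_def matrix_vector_mult_scaleR)
  then show ?thesis using frame_exists[OF assms] that by metis
qed

text \<open>This and the next three lemmas rewrite contractions with the inverse metric as sums over a frame, in which all
  norms become sums of squares.\<close>

lemma frame_sum_inner: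
  fixes a b :: "'n::finite \<Rightarrow> 'l::real_inner"
  assumes "\<And>i j. G i j = (\<Sum>k\<in>UNIV. P k $ i * P k $ j)"
  shows "(\<Sum>i\<in>UNIV. \<Sum>j\<in>UNIV. G i j * (a i \<bullet> b j)) =
    (\<Sum>k\<in>UNIV. (\<Sum>i\<in>UNIV. P k $ i *\<^sub>R a i) \<bullet> (\<Sum>j\<in>UNIV. P k $ j *\<^sub>R (b j)))"
proof -
  have "(\<Sum>i\<in>UNIV. \<Sum>j\<in>UNIV. G i j * (a i \<bullet> b j))
     = (\<Sum>i\<in>UNIV. \<Sum>j\<in>UNIV. \<Sum>k\<in>UNIV. P k $ i * (P k $ j * (a i \<bullet> b j)))"
    by (simp add: assms sum_distrib_right mult.assoc)
  also have "\<dots> = (\<Sum>i\<in>UNIV. \<Sum>k\<in>UNIV. \<Sum>j\<in>UNIV. P k $ i * (P k $ j * (a i \<bullet> b j)))"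
    by (intro sum.cong refl sum.swap)
  also have "\<dots> = (\<Sum>k\<in>UNIV. \<Sum>i\<in>UNIV. \<Sum>j\<in>UNIV. P k $ i * (P k $ j * (a i \<bullet> b j)))"
    by (rule sum.swap)
  also have "\<dots> = (\<Sum>k\<in>UNIV. (\<Sum>i\<in>UNIV. P k $ i *\<^sub>R a i) \<bullet> (\<Sum>j\<in>UNIV. P k $ j *\<^sub>R (b j)))"
    by (simp add: inner_sum_left inner_sum_right sum_distrib_left)
      (rule sum.cong[OF refl], subst sum.swap, simp add: mult.left_commute)
  finally show ?thesis .
qed

lemma frame_sum_scaleR:
  fixes b :: "'n::finite \<Rightarrow> 'l::real_vector"
  assumes "\<And>i j. G i j = (\<Sum>k\<in>UNIV. P k $ i * P k $ j)"
  shows "(\<Sum>i\<in>UNIV. \<Sum>j\<in>UNIV. (G i j * a i) *\<^sub>R b j) =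
    (\<Sum>k\<in>UNIV. (\<Sum>i\<in>UNIV. P k $ i * a i) *\<^sub>R (\<Sum>j\<in>UNIV. P k $ j *\<^sub>R (b j)))"
proof -
  have "(\<Sum>i\<in>UNIV. \<Sum>j\<in>UNIV. (G i j * a i) *\<^sub>R b j)
     = (\<Sum>i\<in>UNIV. \<Sum>j\<in>UNIV. \<Sum>k\<in>UNIV. (P k $ i * a i) *\<^sub>R (P k $ j *\<^sub>R b j))"
    by (simp add: assms sum_distrib_right sum_distrib_left scaleR_sum_left ac_simps)
  also have "\<dots> = (\<Sum>i\<in>UNIV. \<Sum>k\<in>UNIV. \<Sum>j\<in>UNIV. (P k $ i * a i) *\<^sub>R (P k $ j *\<^sub>R b j))"
    by (intro sum.cong refl sum.swap)
  also have "\<dots> = (\<Sum>k\<in>UNIV. \<Sum>i\<in>UNIV. \<Sum>j\<in>UNIV. (P k $ i * a i) *\<^sub>R (P k $ j *\<^sub>R b j))"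
    by (rule sum.swap)
  finally show ?thesis
    unfolding scaleR_sum_left unfolding scaleR_sum_right .
qed

lemma frame_sum_matrix:
  fixes b :: "'n::finite \<Rightarrow> 'n \<Rightarrow> 'l::real_vector"
  assumes "\<And>i j. G i j = (\<Sum>k\<in>UNIV. P k $ i * P k $ j)"
  shows "(\<Sum>i\<in>UNIV. \<Sum>j\<in>UNIV. G i j *\<^sub>R b i j) =
    (\<Sum>k\<in>UNIV. \<Sum>i\<in>UNIV. \<Sum>j\<in>UNIV. (P k $ i * P k $ j) *\<^sub>R b i j)"
proof -
  have "(\<Sum>i\<in>UNIV. \<Sum>j\<in>UNIV. G i j *\<^sub>R b i j)
     = (\<Sum>i\<in>UNIV. \<Sum>j\<in>UNIV. \<Sum>k\<in>UNIV. (P k $ i * P k $ j) *\<^sub>R b i j)"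
    by (simp add: assms scaleR_sum_left)
  also have "\<dots> = (\<Sum>i\<in>UNIV. \<Sum>k\<in>UNIV. \<Sum>j\<in>UNIV. (P k $ i * P k $ j) *\<^sub>R b i j)"
    by (intro sum.cong refl sum.swap)
  also have "\<dots> = (\<Sum>k\<in>UNIV. \<Sum>i\<in>UNIV. \<Sum>j\<in>UNIV. (P k $ i * P k $ j) *\<^sub>R b i j)"
    by (rule sum.swap)
  finally show ?thesis .
qed

lemma frame_sum_hess:
  fixes h :: "'n::finite \<Rightarrow> 'n \<Rightarrow> 'l::real_inner"
  assumes G: "\<And>i j. G i j = (\<Sum>k\<in>UNIV. P k $ i * P k $ j)"
  shows "(\<Sum>i\<in>UNIV. \<Sum>j\<in>UNIV. \<Sum>k\<in>UNIV. \<Sum>l\<in>UNIV. G i k * G j l * (h i j \<bullet> h k l))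
    = (\<Sum>k\<in>UNIV. \<Sum>l\<in>UNIV. (norm (\<Sum>i\<in>UNIV. \<Sum>j\<in>UNIV. (P k $ i * P l $ j) *\<^sub>R h i j))\<^sup>2)"
proof -
  define a where "a m i = (\<Sum>j\<in>UNIV. P m $ j *\<^sub>R h i j)" for m i
  have "(\<Sum>i\<in>UNIV. \<Sum>j\<in>UNIV. \<Sum>k\<in>UNIV. \<Sum>l\<in>UNIV. G i k * G j l * (h i j \<bullet> h k l))
    = (\<Sum>i\<in>UNIV. \<Sum>k\<in>UNIV. \<Sum>j\<in>UNIV. \<Sum>l\<in>UNIV. G i k * G j l * (h i j \<bullet> h k l))"
    by (intro sum.cong refl sum.swap)
  also have "\<dots> = (\<Sum>i\<in>UNIV. \<Sum>k\<in>UNIV. G i k * (\<Sum>j\<in>UNIV. \<Sum>l\<in>UNIV. G j l * (h i j \<bullet> h k l)))"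
    by (simp add: sum_distrib_left mult.assoc)
  also have "\<dots> = (\<Sum>i\<in>UNIV. \<Sum>k\<in>UNIV. G i k * (\<Sum>m\<in>UNIV. a m i \<bullet> a m k))"
    unfolding a_def by (simp only: frame_sum_inner[OF G])
  also have "\<dots> = (\<Sum>i\<in>UNIV. \<Sum>k\<in>UNIV. \<Sum>m\<in>UNIV. G i k * (a m i \<bullet> a m k))"
    by (simp add: sum_distrib_left)
  also have "\<dots> = (\<Sum>i\<in>UNIV. \<Sum>m\<in>UNIV. \<Sum>k\<in>UNIV. G i k * (a m i \<bullet> a m k))"
    by (intro sum.cong refl sum.swap)
  also have "\<dots> = (\<Sum>m\<in>UNIV. \<Sum>i\<in>UNIV. \<Sum>k\<in>UNIV. G i k * (a m i \<bullet> a m k))"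
    by (rule sum.swap)
  also have "\<dots> = (\<Sum>m\<in>UNIV. \<Sum>k\<in>UNIV. (norm (\<Sum>i\<in>UNIV. P k $ i *\<^sub>R a m i))\<^sup>2)"
    by (simp only: frame_sum_inner[OF G] power2_norm_eq_inner)
  also have "\<dots> = (\<Sum>k\<in>UNIV. \<Sum>m\<in>UNIV. (norm (\<Sum>i\<in>UNIV. P k $ i *\<^sub>R a m i))\<^sup>2)"
    by (rule sum.swap)
  finally show ?thesis by (simp add: a_def scaleR_sum_right)
qed

lemma pos_def_inverse:
  fixes A :: "real^'n::finite^'n"
  assumes "pos_def A"
  shows pos_def_det: "det A > 0"
    and inverse_sym: "matrix_inv A $ i $ j = matrix_inv A $ j $ i"
    and inverse_mult: "(\<Sum>j\<in>UNIV. matrix_inv A $ i $ j * A $ j $ k) = (if i = k then 1 else 0)"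
proof -
  obtain P where P: "frame A P" using pos_def_frame_exists[OF assms] .
  show "det A > 0" "matrix_inv A $ i $ j = matrix_inv A $ j $ i"
    using frame_facts[OF P] by (simp_all add: mult.commute)
  show "(\<Sum>j\<in>UNIV. matrix_inv A $ i $ j * A $ j $ k) = (if i = k then 1 else 0)"
    using matrix_inv_left[OF P] by (simp add: vec_eq_iff matrix_matrix_mult_def mat_def)
qed

lemma Ck_on_det:
  fixes A :: "'a::real_normed_vector \<Rightarrow> real^'n::finite^'n"
  assumes "open S" "\<And>i j. Ck_on k S (\<lambda>x. A x $ i $ j)"
  shows "Ck_on k S (\<lambda>x. det (A x))"
  unfolding det_def by (intro Ck_on_sum Ck_on_mult Ck_on_prod Ck_on_const assms)

text \<open>By Cramer's rule the entries of the inverse are quotients of determinants, which are polynomials in the entries.\<close>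

lemma Ck_on_matrix_inv:
  fixes A :: "'a::real_normed_vector \<Rightarrow> real^'n::finite^'n"
  assumes S: "open S" and A: "\<And>i j. Ck_on k S (\<lambda>x. A x $ i $ j)" and pd: "\<And>x. x \<in> S \<Longrightarrow> pos_def (A x)"
  shows "Ck_on k S (\<lambda>x. matrix_inv (A x) $ i $ j)"
proof -
  have e: "det (\<chi> a b. if b = i then (axis j 1 :: real^'n) $ a else A x $ a $ b) / det (A x) = matrix_inv (A x) $ i $ j"
    if "x \<in> S" for x
  proof -
    have "matrix_inv (A x) ** A x = mat 1"
      using inverse_mult[OF pd[OF that]] by (simp add: vec_eq_iff matrix_matrix_mult_def mat_def)
    then have "A x ** matrix_inv (A x) = mat 1" by (simp add: matrix_left_right_inverse)
    then have "A x *v (matrix_inv (A x) *v axis j 1) = axis j 1"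
      by (simp add: matrix_vector_mul_assoc)
    then have "matrix_inv (A x) *v axis j 1 =
        (\<chi> k. det (\<chi> a b. if b = k then (axis j 1 :: real^'n) $ a else A x $ a $ b) / det (A x))"
      using pos_def_det[OF pd[OF that]] by (subst (asm) cramer) auto
    then have "(matrix_inv (A x) *v axis j 1) $ i =
        det (\<chi> a b. if b = i then (axis j 1 :: real^'n) $ a else A x $ a $ b) / det (A x)" by simp
    then show ?thesis by (simp add: matrix_vector_mult_basis column_def)
  qed
  have "Ck_on k S (\<lambda>x. det (\<chi> a b. if b = i then (axis j 1 :: real^'n) $ a else A x $ a $ b) / det (A x))"
  proof (intro Ck_on_divide S Ck_on_det A pos_def_det pd)
    show "Ck_on k S (\<lambda>x. (\<chi> a b. if b = i then (axis j 1 :: real^'n) $ a else A x $ a $ b) $ a $ b)" for a b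
      using A by (cases "b = i") simp_all
  qed
  then show ?thesis by (rule Ck_on_cong[OF S e, rotated])
qed

text \<open>Jacobi's formula at the identity matrix. A permutation other than the identity moves at least two points, so its
  product still contains an off-diagonal zero after one factor has been differentiated.\<close>

lemma has_derivative_det_identity:
  fixes A :: "'a::real_normed_vector \<Rightarrow> real^'n::finite^'n"
  assumes d: "\<And>i j. (\<lambda>x. A x $ i $ j) differentiable (at x)" and A: "A x = mat 1"
  shows "((\<lambda>x. det (A x)) has_derivative (\<lambda>v. \<Sum>i\<in>UNIV. dderiv (\<lambda>x. A x $ i $ i) v x)) (at x)"
proof -
  have "((\<lambda>x. det (A x)) has_derivative
     (\<lambda>v. \<Sum>p | p permutes (UNIV :: 'n set). of_int (sign p) *
        (\<Sum>i\<in>UNIV. dderiv (\<lambda>x. A x $ i $ p i) v x * (\<Prod>j\<in>UNIV - {i}. A x $ j $ p j)))) (at x)"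
    unfolding det_def
    by (intro has_derivative_sum has_derivative_mult_right has_derivative_prod differentiable_has_dderiv d)
  moreover have "(\<Sum>p | p permutes (UNIV :: 'n set). of_int (sign p) *
        (\<Sum>i\<in>UNIV. dderiv (\<lambda>x. A x $ i $ p i) v x * (\<Prod>j\<in>UNIV - {i}. A x $ j $ p j)))
     = (\<Sum>i\<in>UNIV. dderiv (\<lambda>x. A x $ i $ i) v x)" for v
  proof -
    have 0: "(\<Prod>j\<in>UNIV - {i}. A x $ j $ p j) = 0" if p: "p permutes UNIV" "p \<noteq> id" for p :: "'n \<Rightarrow> 'n" and i
    proof -
      have "\<exists>j. j \<noteq> i \<and> p j \<noteq> j"
      proof (rule ccontr)
        assume a: "\<not> (\<exists>j. j \<noteq> i \<and> p j \<noteq> j)"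
        have "p i = i"
        proof (rule ccontr)
          assume "p i \<noteq> i"
          then have "p (p i) = p i" using a by blast
          then show False using permutes_inj[OF p(1)] \<open>p i \<noteq> i\<close> by (meson injD)
        qed
        then have "p = id" using a by (auto simp: fun_eq_iff)
        then show False using p by simp
      qed
      then obtain j where "j \<noteq> i" "p j \<noteq> j" by auto
      then show ?thesis by (intro prod_zero) (auto simp: A mat_def intro!: bexI[of _ j])
    qed
    have "(\<Sum>p | p permutes (UNIV :: 'n set). of_int (sign p) *
        (\<Sum>i\<in>UNIV. dderiv (\<lambda>x. A x $ i $ p i) v x * (\<Prod>j\<in>UNIV - {i}. A x $ j $ p j)))
      = (\<Sum>p\<in>{id}. of_int (sign p) *
        (\<Sum>i\<in>UNIV. dderiv (\<lambda>x. A x $ i $ p i) v x * (\<Prod>j\<in>UNIV - {i}. A x $ j $ p j)))"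
      by (rule sum.mono_neutral_right) (auto simp: permutes_id 0 finite_permutations)
    then show ?thesis by (simp add: A mat_def sign_id)
  qed
  ultimately show ?thesis by simp
qed

lemma dderiv_diff:
  "f differentiable (at x) \<Longrightarrow> g differentiable (at x) \<Longrightarrow> dderiv (\<lambda>x. f x - g x) v x = dderiv f v x - dderiv g v x"
  by (rule dderiv_eqI) (intro has_derivative_diff differentiable_has_dderiv)

lemma dderiv_sum:
  "(\<And>i. i \<in> I \<Longrightarrow> f i differentiable (at x)) \<Longrightarrow> dderiv (\<lambda>x. \<Sum>i\<in>I. f i x) v x = (\<Sum>i\<in>I. dderiv (f i) v x)"
  by (rule dderiv_eqI) (intro has_derivative_sum differentiable_has_dderiv)

lemma dderiv_scaleR:
  "f differentiable (at x) \<Longrightarrow> g differentiable (at x) \<Longrightarrow>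
    dderiv (\<lambda>x. f x *\<^sub>R g x) v x = f x *\<^sub>R dderiv g v x + dderiv f v x *\<^sub>R g x"
  by (rule dderiv_eqI) (intro has_derivative_scaleR differentiable_has_dderiv)

lemma dderiv_mult:
  fixes f g :: "'a::real_normed_vector \<Rightarrow> real"
  shows "f differentiable (at x) \<Longrightarrow> g differentiable (at x) \<Longrightarrow>
    dderiv (\<lambda>x. f x * g x) v x = f x * dderiv g v x + dderiv f v x * g x"
  by (rule dderiv_eqI) (intro has_derivative_mult differentiable_has_dderiv)

lemma dderiv_inner_both:
  "f differentiable (at x) \<Longrightarrow> g differentiable (at x) \<Longrightarrow>
    dderiv (\<lambda>x. f x \<bullet> g x) v x = f x \<bullet> dderiv g v x + dderiv f v x \<bullet> g x"
  by (rule dderiv_eqI) (intro has_derivative_inner differentiable_has_dderiv)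

lemma dderiv_powr:
  fixes f :: "'a::real_normed_vector \<Rightarrow> real"
  assumes "f differentiable (at x)" "f x > 0"
  shows "dderiv (\<lambda>x. f x powr a) v x = a * f x powr (a - 1) * dderiv f v x"
proof (rule dderiv_eqI)
  have "((\<lambda>s. s powr a) has_derivative (\<lambda>h. h * (a * f x powr (a - 1)))) (at (f x))"
    using has_real_derivative_powr[OF assms(2), of a] by (simp add: has_field_derivative_def mult.commute[of _ "a * _"])
  from diff_chain_at[OF differentiable_has_dderiv[OF assms(1)] this]
  show "((\<lambda>x. f x powr a) has_derivative (\<lambda>v. a * f x powr (a - 1) * dderiv f v x)) (at x)"
    by (simp add: o_def mult.commute)
qed

section \<open>The p-harmonic equation in coordinates\<close>

lemma bilinear_frame_nonneg:
  fixes a :: "'n::finite \<Rightarrow> 'l::real_inner"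
  assumes "pos_def (A :: real^'n^'n)"
  shows "0 \<le> (\<Sum>i\<in>UNIV. \<Sum>j\<in>UNIV. matrix_inv A $ i $ j * (a i \<bullet> a j))"
proof -
  obtain P where P: "frame A P" using pos_def_frame_exists[OF assms] .
  show ?thesis
    by (subst frame_sum_inner[of "\<lambda>i j. matrix_inv A $ i $ j", OF matrix_inv_frame[OF P]]) (intro sum_nonneg inner_ge_zero)
qed

context
  fixes M :: "('m, 'n::finite) manifold" and c :: "('m, 'n) chart"
  assumes M: "riemannian_manifold M" and c: "c \<in> atlas M"
begin

lemma open_cimg: "open (cimg c)"
  using M c by (simp add: riemannian_manifold_def)

lemma pos_def_metric: "x \<in> cimg c \<Longrightarrow> pos_def (metric M c x)"
  using M c by (simp add: riemannian_manifold_def pos_def_def)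

lemma metric_smooth: "Ck_on k (cimg c) (\<lambda>x. metric M c x $ i $ j)"
  using M c by (simp add: riemannian_manifold_def smooth_on_def)

lemma metric_sym: "x \<in> cimg c \<Longrightarrow> metric M c x $ i $ j = metric M c x $ j $ i"
  using pos_def_metric[of x] by (simp add: pos_def_def transpose_def vec_eq_iff)

lemma ginv_smooth: "Ck_on k (cimg c) (\<lambda>x. ginv M c x i j)"
  unfolding ginv_def by (rule Ck_on_matrix_inv[OF open_cimg metric_smooth pos_def_metric])

lemma det_metric_smooth: "Ck_on k (cimg c) (\<lambda>x. det (metric M c x))"
  by (rule Ck_on_det[OF open_cimg metric_smooth])

lemma vol_density_smooth: "Ck_on k (cimg c) (vol_density M c)"
  unfolding vol_density_def[abs_def] by (rule Ck_on_sqrt[OF open_cimg det_metric_smooth pos_def_det[OF pos_def_metric]])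

lemma vol_density_pos: "x \<in> cimg c \<Longrightarrow> 0 < vol_density M c x"
  using pos_def_det[OF pos_def_metric] by (simp add: vol_density_def)

lemma ginv_sym: "x \<in> cimg c \<Longrightarrow> ginv M c x i j = ginv M c x j i"
  unfolding ginv_def by (rule inverse_sym[OF pos_def_metric])

lemma ginv_metric: "x \<in> cimg c \<Longrightarrow> (\<Sum>j\<in>UNIV. ginv M c x i j * metric M c x $ j $ k) = (if i = k then 1 else 0)"
  unfolding ginv_def by (rule inverse_mult[OF pos_def_metric])

lemma metric_ginv:
  assumes "x \<in> cimg c"
  shows "(\<Sum>j\<in>UNIV. metric M c x $ i $ j * ginv M c x j k) = (if i = k then 1 else 0)"
proof -
  have "(\<Sum>j\<in>UNIV. metric M c x $ i $ j * ginv M c x j k) = (\<Sum>j\<in>UNIV. ginv M c x k j * metric M c x $ j $ i)"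
    using assms by (simp add: metric_sym[of x i] ginv_sym[of x k] mult.commute)
  then show ?thesis using ginv_metric[OF assms] by (simp add: eq_commute)
qed

lemma metric_differentiable: "x \<in> cimg c \<Longrightarrow> (\<lambda>x. metric M c x $ i $ j) differentiable (at x)"
  by (rule Ck_on_imp_differentiable[OF metric_smooth[of 1]]) auto

lemma ginv_differentiable: "x \<in> cimg c \<Longrightarrow> (\<lambda>x. ginv M c x i j) differentiable (at x)"
  by (rule Ck_on_imp_differentiable[OF ginv_smooth[of 1]]) auto

lemma vol_density_differentiable: "x \<in> cimg c \<Longrightarrow> vol_density M c differentiable (at x)"
  by (rule Ck_on_imp_differentiable[OF vol_density_smooth[of 1]]) auto

definition christoffel1 :: "real^'n \<Rightarrow> 'n \<Rightarrow> 'n \<Rightarrow> 'n \<Rightarrow> real" where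
  "christoffel1 x l i j = (1/2) * (pd i (\<lambda>y. metric M c y $ j $ l) x + pd j (\<lambda>y. metric M c y $ i $ l) x
       - pd l (\<lambda>y. metric M c y $ i $ j) x)"

lemma christoffel_eq: "christoffel M c x k i j = (\<Sum>l\<in>UNIV. ginv M c x k l * christoffel1 x l i j)"
  unfolding christoffel_def christoffel1_def sum_distrib_left by (intro sum.cong refl) simp

lemma pd_metric_sym: "x \<in> cimg c \<Longrightarrow> pd k (\<lambda>y. metric M c y $ i $ j) x = pd k (\<lambda>y. metric M c y $ j $ i) x"
  unfolding pd_def by (rule dderiv_cong[OF open_cimg]) (auto simp: metric_sym metric_differentiable)

lemma christoffel_sym: "x \<in> cimg c \<Longrightarrow> christoffel M c x k i j = christoffel M c x k j i"
  unfolding christoffel_eq christoffel1_def by (simp add: pd_metric_sym[of x k i j] add.commute pd_metric_sym[of x _ i j])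

text \<open>Compatibility of the Levi-Civita connection with the metric.\<close>

lemma pd_metric: "x \<in> cimg c \<Longrightarrow> pd i (\<lambda>y. metric M c y $ a $ b) x = christoffel1 x a i b + christoffel1 x b i a"
  unfolding christoffel1_def
  using pd_metric_sym[of x i a b] pd_metric_sym[of x a i b] pd_metric_sym[of x b i a] by (simp add: field_simps)

text \<open>Differentiate the identity between the inverse metric and the metric, solve for the derivative of the
  inverse, and insert \<open>pd_metric\<close>.\<close>

lemma pd_ginv:
  assumes x: "x \<in> cimg c"
  shows "pd i (\<lambda>y. ginv M c y k m) x =
    - (\<Sum>l\<in>UNIV. christoffel M c x k i l * ginv M c x l m) - (\<Sum>b\<in>UNIV. ginv M c x k b * christoffel M c x m i b)"
proof -
  let ?G = "ginv M c x" and ?g = "metric M c x"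
  let ?dG = "\<lambda>b. pd i (\<lambda>y. ginv M c y k b) x" and ?dg = "\<lambda>b l. pd i (\<lambda>y. metric M c y $ b $ l) x"
  have 0: "(\<Sum>b\<in>UNIV. ?G k b * ?dg b l) + (\<Sum>b\<in>UNIV. ?dG b * ?g $ b $ l) = 0" for l
  proof -
    have "pd i (\<lambda>y. \<Sum>b\<in>UNIV. ginv M c y k b * metric M c y $ b $ l) x = pd i (\<lambda>y. if k = l then 1 else 0) x"
      unfolding pd_def
      by (rule dderiv_cong[OF open_cimg x])
        (use x in \<open>auto simp: ginv_metric intro!: differentiable_sum differentiable_mult metric_differentiable ginv_differentiable\<close>)
    moreover have "pd i (\<lambda>y. \<Sum>b\<in>UNIV. ginv M c y k b * metric M c y $ b $ l) x
       = (\<Sum>b\<in>UNIV. ?G k b * ?dg b l + ?dG b * ?g $ b $ l)"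
      unfolding pd_def using x
      by (subst dderiv_sum) (auto simp: dderiv_mult metric_differentiable ginv_differentiable)
    ultimately show ?thesis by (simp add: sum.distrib pd_def)
  qed
  have "?dG m = (\<Sum>b\<in>UNIV. ?dG b * (if b = m then 1 else 0))"
    by (simp add: if_distrib[of "\<lambda>z. _ * z"] cong: if_cong)
  also have "\<dots> = (\<Sum>b\<in>UNIV. ?dG b * (\<Sum>l\<in>UNIV. ?g $ b $ l * ?G l m))"
    by (simp only: metric_ginv[OF x])
  also have "\<dots> = (\<Sum>b\<in>UNIV. \<Sum>l\<in>UNIV. ?dG b * ?g $ b $ l * ?G l m)"
    by (simp add: sum_distrib_left mult.assoc)
  also have "\<dots> = (\<Sum>l\<in>UNIV. (\<Sum>b\<in>UNIV. ?dG b * ?g $ b $ l) * ?G l m)"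
    by (subst sum.swap) (simp add: sum_distrib_right)
  also have "\<dots> = (\<Sum>l\<in>UNIV. - ((\<Sum>b\<in>UNIV. ?G k b * ?dg b l) * ?G l m))"
  proof (rule sum.cong[OF refl])
    fix l
    have "(\<Sum>b\<in>UNIV. ?dG b * ?g $ b $ l) = - (\<Sum>b\<in>UNIV. ?G k b * ?dg b l)" using 0[of l] by linarith
    then show "(\<Sum>b\<in>UNIV. ?dG b * ?g $ b $ l) * ?G l m = - ((\<Sum>b\<in>UNIV. ?G k b * ?dg b l) * ?G l m)"
      by simp
  qed
  also have "\<dots> = - (\<Sum>l\<in>UNIV. \<Sum>b\<in>UNIV. ?G k b * (christoffel1 x b i l + christoffel1 x l i b) * ?G l m)"
    by (simp add: sum_negf sum_distrib_right pd_metric[OF x])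
  also have "\<dots> = - (\<Sum>l\<in>UNIV. \<Sum>b\<in>UNIV. ?G k b * christoffel1 x b i l * ?G l m)
     - (\<Sum>l\<in>UNIV. \<Sum>b\<in>UNIV. ?G k b * (?G m l * christoffel1 x l i b))"
    by (simp add: algebra_simps sum.distrib ginv_sym[OF x, of m])
  also have "(\<Sum>l\<in>UNIV. \<Sum>b\<in>UNIV. ?G k b * (?G m l * christoffel1 x l i b))
     = (\<Sum>b\<in>UNIV. ?G k b * christoffel M c x m i b)"
    by (subst sum.swap) (simp add: christoffel_eq sum_distrib_left)
  also have "(\<Sum>l\<in>UNIV. \<Sum>b\<in>UNIV. ?G k b * christoffel1 x b i l * ?G l m)
     = (\<Sum>l\<in>UNIV. christoffel M c x k i l * ?G l m)"
    by (simp add: christoffel_eq sum_distrib_right)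
  finally show ?thesis .
qed

text \<open>Multiplying by the constant inverse matrix at \<open>x\<close> reduces the derivative of the determinant to Jacobi's formula at
  the identity matrix.\<close>

lemma pd_det_metric:
  assumes x: "x \<in> cimg c"
  shows "pd i (\<lambda>y. det (metric M c y)) x = det (metric M c x) * (2 * (\<Sum>b\<in>UNIV. christoffel M c x b i b))"
proof -
  define B where "B = matrix_inv (metric M c x)"
  define A where "A y = B ** metric M c y" for y
  have d0: "det (metric M c x) \<noteq> 0" using pos_def_det[OF pos_def_metric[OF x]] by simp
  have A1: "A x = mat 1"
    using inverse_mult[OF pos_def_metric[OF x]]
    by (simp add: A_def B_def vec_eq_iff matrix_matrix_mult_def mat_def)
  have Aij: "A y $ a $ b = (\<Sum>k\<in>UNIV. ginv M c x a k * metric M c y $ k $ b)" for y a b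
    by (simp add: A_def B_def matrix_matrix_mult_def ginv_def)
  have dA: "(\<lambda>y. A y $ a $ b) differentiable (at x)" for a b
    unfolding Aij by (intro differentiable_sum ballI differentiable_mult metric_differentiable x) auto
  have "det B * det (metric M c x) = 1" using arg_cong[OF A1, of det] by (simp add: A_def det_mul)
  then have e: "det (metric M c y) = det (metric M c x) * det (A y)" for y
    by (simp add: A_def det_mul) (metis mult.assoc mult.commute mult.left_neutral)
  have "pd i (\<lambda>y. det (metric M c y)) x = pd i (\<lambda>y. det (metric M c x) * det (A y)) x"
    by (rule arg_cong[where f = "\<lambda>f. pd i f x"], rule ext, rule e)
  also have "\<dots> = det (metric M c x) * (\<Sum>a\<in>UNIV. pd i (\<lambda>y. A y $ a $ a) x)"
    unfolding pd_def
    by (rule dderiv_eqI) (intro has_derivative_mult_right has_derivative_det_identity dA A1)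
  also have "(\<Sum>a\<in>UNIV. pd i (\<lambda>y. A y $ a $ a) x) = (\<Sum>a\<in>UNIV. \<Sum>k\<in>UNIV. ginv M c x a k * pd i (\<lambda>y. metric M c y $ k $ a) x)"
    unfolding Aij pd_def
    by (intro sum.cong refl, subst dderiv_sum)
       (auto simp: dderiv_mult metric_differentiable[OF x] intro!: differentiable_mult metric_differentiable[OF x])
  also have "\<dots> = (\<Sum>a\<in>UNIV. \<Sum>k\<in>UNIV. ginv M c x a k * christoffel1 x k i a) + (\<Sum>a\<in>UNIV. \<Sum>k\<in>UNIV. ginv M c x k a * christoffel1 x a i k)"
    by (simp add: pd_metric[OF x] distrib_left sum.distrib ginv_sym[OF x])
  also have "(\<Sum>a\<in>UNIV. \<Sum>k\<in>UNIV. ginv M c x k a * christoffel1 x a i k) = (\<Sum>a\<in>UNIV. \<Sum>k\<in>UNIV. ginv M c x a k * christoffel1 x k i a)"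
    by (rule sum.swap)
  finally show ?thesis by (simp add: christoffel_eq)
qed

lemma pd_vol_density:
  assumes x: "x \<in> cimg c"
  shows "pd i (vol_density M c) x = vol_density M c x * (\<Sum>b\<in>UNIV. christoffel M c x b i b)"
proof -
  let ?D = "\<lambda>y. det (metric M c y)"
  have pos: "?D y > 0" if "y \<in> cimg c" for y using pos_def_det[OF pos_def_metric[OF that]] .
  have d: "?D differentiable (at x)" by (rule Ck_on_imp_differentiable[OF det_metric_smooth[of 1]]) (use x in auto)
  have "pd i (vol_density M c) x = pd i (\<lambda>y. ?D y powr (1/2)) x"
    unfolding pd_def using x pos
    by (intro dderiv_cong[OF open_cimg] vol_density_differentiable) (auto simp: vol_density_def powr_half_sqrt less_imp_le)
  also have "\<dots> = (1/2) * ?D x powr (- (1/2)) * (?D x * (2 * (\<Sum>b\<in>UNIV. christoffel M c x b i b)))"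
    using dderiv_powr[OF d pos[OF x], of "1/2" "axis i 1"] pd_det_metric[OF x, of i] by (simp add: pd_def)
  also have "\<dots> = (?D x powr (- (1/2)) * ?D x) * (\<Sum>b\<in>UNIV. christoffel M c x b i b)" by simp
  also have "?D x powr (- (1/2)) * ?D x = vol_density M c x"
    using pos[OF x] powr_add[of "?D x" "- (1/2)" 1] by (simp add: vol_density_def powr_half_sqrt)
  finally show ?thesis .
qed

text \<open>The derivative of the density cancels one of the two terms in the derivative of the inverse metric. What is left
  is the first order term of the Laplace-Beltrami operator.\<close>

lemma pd_vol_ginv:
  assumes x: "x \<in> cimg c"
  shows "(\<Sum>i\<in>UNIV. pd i (\<lambda>y. vol_density M c y * ginv M c y i j) x)
    = - vol_density M c x * (\<Sum>i\<in>UNIV. \<Sum>b\<in>UNIV. ginv M c x i b * christoffel M c x j i b)"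
proof -
  let ?G = "ginv M c x" and ?C = "christoffel M c x" and ?v = "vol_density M c x"
  have "pd i (\<lambda>y. vol_density M c y * ginv M c y i j) x =
     ?v * (\<Sum>b\<in>UNIV. ?C b i b * ?G i j) - ?v * (\<Sum>l\<in>UNIV. ?C i l i * ?G l j) - ?v * (\<Sum>b\<in>UNIV. ?G i b * ?C j i b)" for i
  proof -
    have "pd i (\<lambda>y. vol_density M c y * ginv M c y i j) x
      = ?v * pd i (\<lambda>y. ginv M c y i j) x + pd i (vol_density M c) x * ?G i j"
      unfolding pd_def by (rule dderiv_mult[OF vol_density_differentiable[OF x] ginv_differentiable[OF x]])
    then show ?thesis
      by (simp add: pd_ginv[OF x] pd_vol_density[OF x] algebra_simps sum_distrib_left sum_distrib_right christoffel_sym[OF x, of i i])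
  qed
  then have "(\<Sum>i\<in>UNIV. pd i (\<lambda>y. vol_density M c y * ginv M c y i j) x)
    = ?v * (\<Sum>i\<in>UNIV. \<Sum>b\<in>UNIV. ?C b i b * ?G i j) - ?v * (\<Sum>i\<in>UNIV. \<Sum>l\<in>UNIV. ?C i l i * ?G l j)
       - ?v * (\<Sum>i\<in>UNIV. \<Sum>b\<in>UNIV. ?G i b * ?C j i b)"
    by (simp add: sum_subtractf sum_distrib_left)
  also have "(\<Sum>i\<in>UNIV. \<Sum>l\<in>UNIV. ?C i l i * ?G l j) = (\<Sum>i\<in>UNIV. \<Sum>b\<in>UNIV. ?C b i b * ?G i j)"
    by (rule sum.swap)
  finally show ?thesis by simp
qed

text \<open>Unlike \<open>grad_norm\<close>, its square remains differentiable where the gradient vanishes.\<close>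

definition grad_sq :: "('m \<Rightarrow> 'l::euclidean_space) \<Rightarrow> real^'n \<Rightarrow> real" where
  "grad_sq u x = (\<Sum>i\<in>UNIV. \<Sum>j\<in>UNIV. ginv M c x i j * (pd i (loc c u) x \<bullet> pd j (loc c u) x))"

lemma grad_norm_eq: "grad_norm M c u x = sqrt (grad_sq u x)"
  by (simp add: grad_norm_def grad_sq_def)

lemma grad_sq_nonneg: "x \<in> cimg c \<Longrightarrow> 0 \<le> grad_sq u x"
  unfolding grad_sq_def ginv_def by (rule bilinear_frame_nonneg[OF pos_def_metric])

lemma grad_norm_pos_iff: "x \<in> cimg c \<Longrightarrow> grad_norm M c u x \<noteq> 0 \<longleftrightarrow> 0 < grad_sq u x"
  using grad_sq_nonneg[of x u] by (auto simp: grad_norm_eq)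

context
  fixes u :: "'m \<Rightarrow> 'l::euclidean_space" and V :: "(real^'n) set"
  assumes V: "open V" "V \<subseteq> cimg c" and u: "Ck_on 2 V (loc c u)"
begin

lemma pd_loc_Ck: "Ck_on 1 V (pd i (loc c u))"
  unfolding pd_def[abs_def] using u by (intro Ck_on_dderiv) (simp add: numeral_2_eq_2)

lemma pd_loc_diff: "x \<in> V \<Longrightarrow> pd i (loc c u) differentiable (at x)"
  by (rule Ck_on_imp_differentiable[OF pd_loc_Ck]) auto

lemma grad_sq_Ck: "Ck_on 1 V (grad_sq u)"
  unfolding grad_sq_def[abs_def]
  by (intro Ck_on_sum Ck_on_mult Ck_on_inner V pd_loc_Ck Ck_on_subset[OF ginv_smooth V(2)])

lemma open_grad_pos: "open {x \<in> V. 0 < grad_sq u x}"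
proof -
  have "open (V \<inter> grad_sq u -` {0<..})"
    by (intro continuous_open_preimage Ck_on_imp_continuous_on[OF grad_sq_Ck] V open_greaterThan)
  moreover have "V \<inter> grad_sq u -` {0<..} = {x \<in> V. 0 < grad_sq u x}" by auto
  ultimately show ?thesis by simp
qed

lemma grad_norm_Ck: "Ck_on 1 {x \<in> V. 0 < grad_sq u x} (grad_norm M c u)"
  unfolding grad_norm_eq[abs_def]
  by (rule Ck_on_sqrt[OF open_grad_pos Ck_on_subset[OF grad_sq_Ck]]) auto

lemma hess_sym:
  assumes "x \<in> V"
  shows "hess M c N u x i j = hess M c N u x j i"
  using dderiv_commute[OF V(1) assms u] christoffel_sym[of x] assms V(2)
  by (auto simp: hess_def pd_def[abs_def])

context
  fixes N :: "'l set" and d :: nat and x :: "real^'n"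
  assumes N: "embedded_submanifold d N" and uN: "\<And>x. x \<in> V \<Longrightarrow> loc c u x \<in> N"
    and x: "x \<in> V" and gpos: "0 < grad_sq u x"
begin

lemma xc: "x \<in> cimg c" using x V by auto

lemma gn_pos: "0 < grad_norm M c u x" using gpos by (simp add: grad_norm_eq)

lemma gn_diff: "grad_norm M c u differentiable (at x)"
  by (rule Ck_on_imp_differentiable[OF grad_norm_Ck]) (use x gpos in auto)

lemma sub_T: "subspace (tangent_space N (loc c u x))"
  by (rule subspace_tangent_space[OF N uN[OF x]])

lemma pd_loc_tangent: "pd i (loc c u) x \<in> tangent_space N (loc c u x)"
  unfolding pd_def
  by (rule dderiv_in_tangent_space[OF V(1) x uN]) (use u x in \<open>auto simp: numeral_2_eq_2\<close>)

text \<open>In the derivative of the contraction \<open>grad_sq\<close>, the derivative of the inverse metric supplies exactly the Christoffel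
  terms of the Hessian. The normal part of the second derivatives is invisible, because the first derivatives are
  tangent.\<close>

lemma pd_grad_norm:
  "grad_norm M c u x * pd i (grad_norm M c u) x =
    (\<Sum>k\<in>UNIV. \<Sum>l\<in>UNIV. ginv M c x k l * (hess M c N u x i k \<bullet> pd l (loc c u) x))"
proof -
  let ?G = "ginv M c x" and ?C = "christoffel M c x" and ?u = "\<lambda>k. pd k (loc c u) x"
  let ?dd = "\<lambda>k. pd i (pd k (loc c u)) x"
  have gs: "grad_sq u differentiable (at x)" by (rule Ck_on_imp_differentiable[OF grad_sq_Ck]) (use x in auto)
  have "pd i (grad_norm M c u) x = pd i (\<lambda>y. grad_sq u y powr (1/2)) x"
    unfolding pd_def
    by (rule dderiv_cong[OF open_grad_pos _ _ gn_diff]) (use x gpos in \<open>auto simp: grad_norm_eq powr_half_sqrt\<close>)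
  also have "\<dots> = (1/2) * grad_sq u x powr (- (1/2)) * pd i (grad_sq u) x"
    using dderiv_powr[OF gs gpos, of "1/2" "axis i 1"] by (simp add: pd_def)
  also have "grad_sq u x powr (- (1/2)) = 1 / grad_norm M c u x"
    using gpos by (simp add: grad_norm_eq powr_minus_divide powr_half_sqrt)
  finally have 1: "grad_norm M c u x * pd i (grad_norm M c u) x = pd i (grad_sq u) x / 2"
    using gn_pos by simp
  have "pd i (grad_sq u) x = (\<Sum>k\<in>UNIV. \<Sum>l\<in>UNIV. ?G k l * (?u k \<bullet> pd i (pd l (loc c u)) x + ?dd k \<bullet> ?u l) + pd i (\<lambda>y. ginv M c y k l) x * (?u k \<bullet> ?u l))"
    unfolding grad_sq_def[abs_def] pd_def[of i]
    using x xc by (simp add: dderiv_sum dderiv_mult dderiv_inner_both pd_loc_diff ginv_differentiable differentiable_sum differentiable_mult differentiable_inner)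
  also have "\<dots> = (\<Sum>k\<in>UNIV. \<Sum>l\<in>UNIV. ?G k l * (?u k \<bullet> ?dd l)) + (\<Sum>k\<in>UNIV. \<Sum>l\<in>UNIV. ?G k l * (?dd k \<bullet> ?u l))
     - (\<Sum>k\<in>UNIV. \<Sum>l\<in>UNIV. \<Sum>a\<in>UNIV. ?C k i a * ?G a l * (?u k \<bullet> ?u l)) - (\<Sum>k\<in>UNIV. \<Sum>l\<in>UNIV. \<Sum>a\<in>UNIV. ?G k a * ?C l i a * (?u k \<bullet> ?u l))"
    by (simp add: pd_ginv[OF xc] algebra_simps sum.distrib sum_subtractf sum_distrib_right sum_distrib_left)
  also have "(\<Sum>k\<in>UNIV. \<Sum>l\<in>UNIV. ?G k l * (?u k \<bullet> ?dd l)) = (\<Sum>k\<in>UNIV. \<Sum>l\<in>UNIV. ?G k l * (?dd k \<bullet> ?u l))"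
    by (subst sum.swap) (simp add: inner_commute ginv_sym[OF xc])
  also have "(\<Sum>k\<in>UNIV. \<Sum>l\<in>UNIV. \<Sum>a\<in>UNIV. ?C k i a * ?G a l * (?u k \<bullet> ?u l))
     = (\<Sum>k\<in>UNIV. \<Sum>l\<in>UNIV. \<Sum>a\<in>UNIV. ?C a i k * ?G k l * (?u a \<bullet> ?u l))"
    (is "_ = ?R")
  proof -
    have "(\<Sum>k\<in>UNIV. \<Sum>l\<in>UNIV. \<Sum>a\<in>UNIV. ?C k i a * ?G a l * (?u k \<bullet> ?u l))
      = (\<Sum>k\<in>UNIV. \<Sum>a\<in>UNIV. \<Sum>l\<in>UNIV. ?C k i a * ?G a l * (?u k \<bullet> ?u l))"
      by (intro sum.cong[OF refl] sum.swap)
    also have "\<dots> = (\<Sum>a\<in>UNIV. \<Sum>k\<in>UNIV. \<Sum>l\<in>UNIV. ?C k i a * ?G a l * (?u k \<bullet> ?u l))"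
      by (rule sum.swap)
    also have "\<dots> = (\<Sum>a\<in>UNIV. \<Sum>l\<in>UNIV. \<Sum>k\<in>UNIV. ?C k i a * ?G a l * (?u k \<bullet> ?u l))"
      by (rule sum.cong[OF refl], rule sum.swap)
    finally show ?thesis .
  qed
  also have "(\<Sum>k\<in>UNIV. \<Sum>l\<in>UNIV. \<Sum>a\<in>UNIV. ?G k a * ?C l i a * (?u k \<bullet> ?u l)) = ?R"
  proof -
    have "(\<Sum>k\<in>UNIV. \<Sum>l\<in>UNIV. \<Sum>a\<in>UNIV. ?G k a * ?C l i a * (?u k \<bullet> ?u l))
       = (\<Sum>k\<in>UNIV. \<Sum>a\<in>UNIV. \<Sum>l\<in>UNIV. ?G k a * ?C l i a * (?u k \<bullet> ?u l))"
      by (rule sum.cong[OF refl], rule sum.swap)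
    also have "\<dots> = (\<Sum>a\<in>UNIV. \<Sum>k\<in>UNIV. \<Sum>l\<in>UNIV. ?G k a * ?C l i a * (?u k \<bullet> ?u l))"
      by (rule sum.swap)
    finally show ?thesis by (simp add: inner_commute ginv_sym[OF xc] mult.commute)
  qed
  finally have 2: "pd i (grad_sq u) x / 2 = (\<Sum>k\<in>UNIV. \<Sum>l\<in>UNIV. ?G k l * (?dd k \<bullet> ?u l)) - ?R" by simp
  have "(\<Sum>k\<in>UNIV. \<Sum>l\<in>UNIV. ?G k l * (hess M c N u x i k \<bullet> ?u l)) =
     (\<Sum>k\<in>UNIV. \<Sum>l\<in>UNIV. ?G k l * (?dd k \<bullet> ?u l)) - ?R"
    unfolding hess_def
    by (simp add: inner_diff_left tangential_inner[OF sub_T pd_loc_tangent] inner_sum_left right_diff_distrib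
        sum_subtractf sum_distrib_left ac_simps)
  then show ?thesis using 1 2 by simp
qed

text \<open>The intrinsic p-Laplacian of \<open>u\<close>, divided by \<open>|\<nabla>u|\<close> to the power \<open>p - 2\<close>. It is a tangent vector of \<open>N\<close>.\<close>

definition p_tension :: "real \<Rightarrow> 'l" where
  "p_tension p = (\<Sum>i\<in>UNIV. \<Sum>j\<in>UNIV. ginv M c x i j *\<^sub>R hess M c N u x i j)
     + ((p - 2) / grad_norm M c u x) *\<^sub>R
        (\<Sum>i\<in>UNIV. \<Sum>j\<in>UNIV. (ginv M c x i j * pd i (grad_norm M c u) x) *\<^sub>R pd j (loc c u) x)"

text \<open>The product rule for the divergence, with \<open>pd_vol_ginv\<close> for the metric coefficients: the extrinsic p-Laplacian is
  the intrinsic one plus the trace of the normal parts of the second derivatives.\<close>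

lemma divergence_p_laplace:
  "divergence M c (\<lambda>i y. (grad_norm M c u y powr (p - 2)) *\<^sub>R
          (\<Sum>j\<in>UNIV. ginv M c y i j *\<^sub>R pd j (loc c u) y)) x
   = (grad_norm M c u x powr (p - 2)) *\<^sub>R
      (p_tension p + (\<Sum>i\<in>UNIV. \<Sum>j\<in>UNIV. ginv M c x i j *\<^sub>R
         (pd i (pd j (loc c u)) x - tangential N (loc c u x) (pd i (pd j (loc c u)) x))))"
proof -
  let ?G = "ginv M c x" and ?C = "christoffel M c x" and ?v = "vol_density M c x"
    and ?u = "\<lambda>k. pd k (loc c u) x" and ?dd = "\<lambda>i j. pd i (pd j (loc c u)) x" and ?gn = "grad_norm M c u"
  let ?s = "?gn x powr (p - 2)"
  have vg: "(\<lambda>y. vol_density M c y * ginv M c y i j) differentiable (at x)" for i j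
    by (intro differentiable_mult vol_density_differentiable ginv_differentiable xc)
  have gp: "(\<lambda>y. ?gn y powr (p - 2)) differentiable (at x)"
    by (rule Ck_on_imp_differentiable[OF Ck_on_powr_compose[OF open_grad_pos grad_norm_Ck]])
       (use x gpos in \<open>auto simp: grad_norm_eq\<close>)
  have dgp: "pd i (\<lambda>y. ?gn y powr (p - 2)) x = ?s * ((p - 2) / ?gn x) * pd i ?gn x" for i
  proof -
    have "pd i (\<lambda>y. ?gn y powr (p - 2)) x = (p - 2) * ?gn x powr (p - 2 - 1) * pd i ?gn x"
      unfolding pd_def by (rule dderiv_powr[OF gn_diff gn_pos])
    also have "?gn x powr (p - 2 - 1) = ?s / ?gn x"
      using gn_pos by (simp only: powr_diff[of _ "p - 2" 1] powr_one)
    finally show ?thesis by simp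
  qed
  have e: "vol_density M c y *\<^sub>R (?gn y powr (p - 2)) *\<^sub>R (\<Sum>j\<in>UNIV. ginv M c y i j *\<^sub>R pd j (loc c u) y)
     = (\<Sum>j\<in>UNIV. (?gn y powr (p - 2) * (vol_density M c y * ginv M c y i j)) *\<^sub>R pd j (loc c u) y)" for i y
    by (simp add: scaleR_sum_right ac_simps)
  have "pd i (\<lambda>y. vol_density M c y *\<^sub>R (?gn y powr (p - 2)) *\<^sub>R (\<Sum>j\<in>UNIV. ginv M c y i j *\<^sub>R pd j (loc c u) y)) x
     = (\<Sum>j\<in>UNIV. (?s * (?v * ?G i j)) *\<^sub>R ?dd i j + (?s * pd i (\<lambda>y. vol_density M c y * ginv M c y i j) x
         + ?s * ((p - 2) / ?gn x) * pd i ?gn x * (?v * ?G i j)) *\<^sub>R ?u j)" for i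
    unfolding e dgp[symmetric] unfolding pd_def[of i]
    by (subst dderiv_sum)
      (auto simp: dderiv_scaleR dderiv_mult vg gp pd_loc_diff[OF x] intro!: differentiable_scaleR differentiable_mult vg gp pd_loc_diff[OF x])
  then have "(\<Sum>i\<in>UNIV. pd i (\<lambda>y. vol_density M c y *\<^sub>R (?gn y powr (p - 2)) *\<^sub>R (\<Sum>j\<in>UNIV. ginv M c y i j *\<^sub>R pd j (loc c u) y)) x)
     = (?s * ?v) *\<^sub>R (\<Sum>i\<in>UNIV. \<Sum>j\<in>UNIV. ?G i j *\<^sub>R ?dd i j)
       + ?s *\<^sub>R (\<Sum>i\<in>UNIV. \<Sum>j\<in>UNIV. pd i (\<lambda>y. vol_density M c y * ginv M c y i j) x *\<^sub>R ?u j)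
       + (?s * ?v) *\<^sub>R (((p - 2) / ?gn x) *\<^sub>R (\<Sum>i\<in>UNIV. \<Sum>j\<in>UNIV. (?G i j * pd i ?gn x) *\<^sub>R ?u j))"
    by (simp add: scaleR_add_left sum.distrib scaleR_sum_right ac_simps)
  also have "(\<Sum>i\<in>UNIV. \<Sum>j\<in>UNIV. pd i (\<lambda>y. vol_density M c y * ginv M c y i j) x *\<^sub>R ?u j)
     = - ?v *\<^sub>R (\<Sum>i\<in>UNIV. \<Sum>b\<in>UNIV. ?G i b *\<^sub>R (\<Sum>j\<in>UNIV. ?C j i b *\<^sub>R ?u j))"
  proof -
    have "(\<Sum>i\<in>UNIV. \<Sum>j\<in>UNIV. pd i (\<lambda>y. vol_density M c y * ginv M c y i j) x *\<^sub>R ?u j)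
      = (\<Sum>j\<in>UNIV. (\<Sum>i\<in>UNIV. pd i (\<lambda>y. vol_density M c y * ginv M c y i j) x) *\<^sub>R ?u j)"
      by (subst sum.swap) (simp add: scaleR_sum_left)
    also have "\<dots> = - ?v *\<^sub>R (\<Sum>j\<in>UNIV. \<Sum>i\<in>UNIV. \<Sum>b\<in>UNIV. ?G i b *\<^sub>R (?C j i b *\<^sub>R ?u j))"
      by (simp add: pd_vol_ginv[OF xc] scaleR_sum_right scaleR_sum_left sum_distrib_left sum_negf ac_simps)
    also have "(\<Sum>j\<in>UNIV. \<Sum>i\<in>UNIV. \<Sum>b\<in>UNIV. ?G i b *\<^sub>R (?C j i b *\<^sub>R ?u j))
       = (\<Sum>i\<in>UNIV. \<Sum>j\<in>UNIV. \<Sum>b\<in>UNIV. ?G i b *\<^sub>R (?C j i b *\<^sub>R ?u j))"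
      by (rule sum.swap)
    also have "\<dots> = (\<Sum>i\<in>UNIV. \<Sum>b\<in>UNIV. \<Sum>j\<in>UNIV. ?G i b *\<^sub>R (?C j i b *\<^sub>R ?u j))"
      by (rule sum.cong[OF refl], rule sum.swap)
    finally show ?thesis by (simp add: scaleR_sum_right)
  qed
  finally have "divergence M c (\<lambda>i y. (?gn y powr (p - 2)) *\<^sub>R (\<Sum>j\<in>UNIV. ginv M c y i j *\<^sub>R pd j (loc c u) y)) x
    = ?s *\<^sub>R ((\<Sum>i\<in>UNIV. \<Sum>j\<in>UNIV. ?G i j *\<^sub>R ?dd i j) - (\<Sum>i\<in>UNIV. \<Sum>b\<in>UNIV. ?G i b *\<^sub>R (\<Sum>j\<in>UNIV. ?C j i b *\<^sub>R ?u j))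
      + ((p - 2) / ?gn x) *\<^sub>R (\<Sum>i\<in>UNIV. \<Sum>j\<in>UNIV. (?G i j * pd i ?gn x) *\<^sub>R ?u j))"
    using vol_density_pos[OF xc] by (simp add: divergence_def scaleR_add_right scaleR_diff_right)
  moreover have "p_tension p + (\<Sum>i\<in>UNIV. \<Sum>j\<in>UNIV. ?G i j *\<^sub>R (?dd i j - tangential N (loc c u x) (?dd i j)))
    = (\<Sum>i\<in>UNIV. \<Sum>j\<in>UNIV. ?G i j *\<^sub>R ?dd i j) - (\<Sum>i\<in>UNIV. \<Sum>b\<in>UNIV. ?G i b *\<^sub>R (\<Sum>j\<in>UNIV. ?C j i b *\<^sub>R ?u j))
      + ((p - 2) / ?gn x) *\<^sub>R (\<Sum>i\<in>UNIV. \<Sum>j\<in>UNIV. (?G i j * pd i ?gn x) *\<^sub>R ?u j)"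
    unfolding p_tension_def hess_def
    by (simp add: scaleR_diff_right sum_subtractf)
  ultimately show ?thesis by simp
qed

lemma hess_tangent: "hess M c N u x i j \<in> tangent_space N (loc c u x)"
  unfolding hess_def
  by (intro subspace_diff[OF sub_T] subspace_sum[OF sub_T] subspace_scale[OF sub_T] tangential_in[OF sub_T] pd_loc_tangent)

lemma p_tension_tangent: "p_tension p \<in> tangent_space N (loc c u x)"
  unfolding p_tension_def
  by (intro subspace_add[OF sub_T] subspace_sum[OF sub_T] subspace_scale[OF sub_T] hess_tangent pd_loc_tangent)

text \<open>The normal part of the equation holds for every map into \<open>N\<close>, by \<open>second_fundamental_form_dderiv\<close>.\<close>

lemma solves_p_harmonic_eq_iff:
  "solves_p_harmonic_eq_at M c N p u x \<longleftrightarrow> p_tension p = 0"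
proof -
  let ?n = "\<Sum>i\<in>UNIV. \<Sum>j\<in>UNIV. ginv M c x i j *\<^sub>R
         (pd i (pd j (loc c u)) x - tangential N (loc c u x) (pd i (pd j (loc c u)) x))"
  have "second_fundamental_form N (loc c u x) (pd i (loc c u) x) (pd j (loc c u) x)
     = - (pd i (pd j (loc c u)) x - tangential N (loc c u x) (pd i (pd j (loc c u)) x))" for i j
    using second_fundamental_form_dderiv[OF N V(1) x uN u, of "axis i 1" "axis j 1"] by (simp add: pd_def[abs_def])
  then have "(\<Sum>i\<in>UNIV. \<Sum>j\<in>UNIV. ginv M c x i j *\<^sub>R
            second_fundamental_form N (loc c u x) (pd i (loc c u) x) (pd j (loc c u) x)) = - ?n"
    by (simp add: scaleR_diff_right sum_subtractf)
  then show ?thesis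
    unfolding solves_p_harmonic_eq_at_def divergence_p_laplace
    using gn_pos by (simp add: scaleR_add_right)
qed

lemma tangential_divergence_zero:
  assumes "\<And>s. s \<in> tangent_space N (loc c u x) \<Longrightarrow>
    divergence M c (\<lambda>i y. (grad_norm M c u y powr (p - 2)) *\<^sub>R
          (\<Sum>j\<in>UNIV. ginv M c y i j *\<^sub>R pd j (loc c u) y)) x \<bullet> s = 0"
  shows "p_tension p = 0"
proof -
  let ?n = "\<Sum>i\<in>UNIV. \<Sum>j\<in>UNIV. ginv M c x i j *\<^sub>R
         (pd i (pd j (loc c u)) x - tangential N (loc c u x) (pd i (pd j (loc c u)) x))"
  have n: "?n \<bullet> s = 0" if "s \<in> tangent_space N (loc c u x)" for s
    using tangential_orth[OF sub_T that] by (simp add: inner_sum_left)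
  have "p_tension p \<bullet> s = 0" if "s \<in> tangent_space N (loc c u x)" for s
    using assms[OF that] n[OF that] gn_pos unfolding divergence_p_laplace by (simp add: inner_add_left)
  from this[OF p_tension_tangent[of p]] show ?thesis by simp
qed

text \<open>In an orthonormal frame all the norms are sums of squares, and the equation and the derivative of \<open>|\<nabla>u|\<close> take the
  form used in the algebraic estimate.\<close>

context
  fixes P :: "'n \<Rightarrow> real^'n"
  assumes P: "frame (metric M c x) P"
begin

definition "frame_grad k = (\<Sum>i\<in>UNIV. P k $ i *\<^sub>R pd i (loc c u) x)"
definition "frame_hess k l = (\<Sum>i\<in>UNIV. \<Sum>j\<in>UNIV. (P k $ i * P l $ j) *\<^sub>R hess M c N u x i j)"
definition "frame_dnorm k = (\<Sum>i\<in>UNIV. P k $ i * pd i (grad_norm M c u) x)"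

lemma ginv_frame: "ginv M c x i j = (\<Sum>k\<in>UNIV. P k $ i * P k $ j)"
  by (simp add: ginv_def matrix_inv_frame[OF P])

lemma frame_grad_norm: "(grad_norm M c u x)\<^sup>2 = (\<Sum>k\<in>UNIV. (norm (frame_grad k))\<^sup>2)"
  using gpos frame_sum_inner[of "ginv M c x" P "\<lambda>i. pd i (loc c u) x" "\<lambda>i. pd i (loc c u) x", OF ginv_frame]
  by (simp add: grad_norm_eq grad_sq_def frame_grad_def power2_norm_eq_inner)

lemma frame_hess_norm: "(hess_norm M c N u x)\<^sup>2 = (\<Sum>k\<in>UNIV. \<Sum>l\<in>UNIV. (norm (frame_hess k l))\<^sup>2)"
  unfolding hess_norm_def frame_sum_hess[OF ginv_frame] frame_hess_def[symmetric]
  by (simp add: sum_nonneg)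

lemma frame_grad_grad_norm: "(grad_grad_norm M c u x)\<^sup>2 = (\<Sum>k\<in>UNIV. (frame_dnorm k)\<^sup>2)"
proof -
  have "(\<Sum>i\<in>UNIV. \<Sum>j\<in>UNIV. ginv M c x i j * (pd i (grad_norm M c u) x * pd j (grad_norm M c u) x)) =
    (\<Sum>k\<in>UNIV. (frame_dnorm k)\<^sup>2)"
    using frame_sum_inner[of "ginv M c x" P "\<lambda>i. pd i (grad_norm M c u) x" "\<lambda>i. pd i (grad_norm M c u) x", OF ginv_frame]
    by (simp add: frame_dnorm_def power2_eq_square)
  then show ?thesis by (simp add: grad_grad_norm_def sum_nonneg)
qed

lemma frame_dnorm_eq: "grad_norm M c u x * frame_dnorm k = (\<Sum>l\<in>UNIV. frame_hess k l \<bullet> frame_grad l)"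
proof -
  have "grad_norm M c u x * frame_dnorm k = (\<Sum>i\<in>UNIV. P k $ i * (grad_norm M c u x * pd i (grad_norm M c u) x))"
    by (simp add: frame_dnorm_def sum_distrib_left ac_simps)
  also have "\<dots> = (\<Sum>i\<in>UNIV. P k $ i * (\<Sum>l\<in>UNIV. (\<Sum>j\<in>UNIV. P l $ j *\<^sub>R hess M c N u x i j) \<bullet> frame_grad l))"
    unfolding pd_grad_norm frame_grad_def frame_sum_inner[of "ginv M c x" P, OF ginv_frame] ..
  also have "\<dots> = (\<Sum>l\<in>UNIV. \<Sum>i\<in>UNIV. (P k $ i *\<^sub>R (\<Sum>j\<in>UNIV. P l $ j *\<^sub>R hess M c N u x i j)) \<bullet> frame_grad l)"
    by (subst sum.swap) (simp add: sum_distrib_left)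
  finally show ?thesis by (simp add: frame_hess_def inner_sum_left scaleR_sum_right)
qed

lemma frame_p_tension:
  "p_tension p = (\<Sum>k\<in>UNIV. frame_hess k k) + ((p - 2) / grad_norm M c u x) *\<^sub>R (\<Sum>k\<in>UNIV. frame_dnorm k *\<^sub>R frame_grad k)"
  unfolding p_tension_def frame_sum_scaleR[of "ginv M c x" P, OF ginv_frame] frame_sum_matrix[of "ginv M c x" P, OF ginv_frame]
    frame_hess_def frame_dnorm_def frame_grad_def ..

lemma frame_hess_sym: "frame_hess k l = frame_hess l k"
  unfolding frame_hess_def by (subst sum.swap) (simp add: hess_sym[OF x] mult.commute)

end
end
end
end

section \<open>The algebraic estimate and its constant\<close>

text \<open>The minimization behind the estimate. The sum \<open>W\<close> of \<open>x\<close> and \<open>y\<close> is given, where \<open>x\<close> and \<open>y\<close> are the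
  contributions of the \<open>k\<^sub>0\<close>-derivative and of the other derivatives to \<open>w k\<^sub>0\<close>. The lower bound for the Hessian is a
  quadratic polynomial in \<open>x\<close>; completing the square displays its minimum, the quotient \<open>F(\<sigma>)\<close> times \<open>W\<^sup>2\<close>, and
  the minimizer. Denominators are cleared, so that the identity also holds at \<open>\<sigma> = 0\<close> and \<open>\<sigma> = 1\<close>.\<close>

lemma complete_square_identity:
  fixes n q \<sigma> x W :: real
  shows "(n + (n - 2) * \<sigma>) * (n * (1 - \<sigma>) * x\<^sup>2 + 2 * (n - 1) * \<sigma> * (W - x)\<^sup>2 + \<sigma> * (1 - \<sigma>) * (2 * q * W * x + q\<^sup>2 * W\<^sup>2 * \<sigma>))
    = \<sigma> * (1 - \<sigma>) * (n - 1) * (q\<^sup>2 * \<sigma>\<^sup>2 + (q\<^sup>2 + 4 * q) * \<sigma> + 2 * n) * W\<^sup>2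
      + ((n + (n - 2) * \<sigma>) * x - W * \<sigma> * (2 * (n - 1) - q * (1 - \<sigma>)))\<^sup>2"
  by algebra

text \<open>With \<open>t\<^sup>2 = 2 - kappa p n\<close>, the middle value of the constant is the one for which the quadratic polynomial
  \<open>(F(\<sigma>) - kappa p n) (n + (n - 2) \<sigma>)\<close> in \<open>\<sigma>\<close> has a double root.\<close>

lemma middle_square:
  fixes n p :: real
  assumes n: "n > 2" and t: "t = (p - sqrt (2 * n)) / (sqrt n - sqrt 2)"
  shows "(p - 2)\<^sup>2 * \<sigma>\<^sup>2 + (p\<^sup>2 - 2 * n) * \<sigma> + t\<^sup>2 * (n + (n - 2) * \<sigma>) = ((p - 2) * \<sigma> + sqrt n * t)\<^sup>2"
proof -
  define a b where "a = sqrt n" and "b = sqrt 2"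
  have ab: "a\<^sup>2 = n" "b\<^sup>2 = 2" "sqrt (2 * n) = a * b" "a - b \<noteq> 0" using n by (auto simp: a_def b_def real_sqrt_mult)
  have t': "t * (a - b) = p - a * b" using t ab by (simp add: a_def[symmetric] b_def[symmetric])
  have "p\<^sup>2 - (a * b)\<^sup>2 + t\<^sup>2 * (a\<^sup>2 - b\<^sup>2) = 2 * (p - b\<^sup>2) * a * t"
  proof -
    have "p\<^sup>2 - (a * b)\<^sup>2 + t\<^sup>2 * (a\<^sup>2 - b\<^sup>2) = (p - a * b) * (p + a * b) + t * (t * (a - b)) * (a + b)" by algebra
    also have "\<dots> = t * ((a - b) * (p + a * b) + (p - a * b) * (a + b))"
      unfolding t' using t' by algebra
    also have "\<dots> = 2 * (p - b\<^sup>2) * a * t" by algebra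
    finally show ?thesis .
  qed
  then have k: "p\<^sup>2 - 2 * n + t\<^sup>2 * (n - 2) = 2 * (p - 2) * a * t" using ab by (simp add: power_mult_distrib mult.commute)
  have "(p - 2)\<^sup>2 * \<sigma>\<^sup>2 + (p\<^sup>2 - 2 * n) * \<sigma> + t\<^sup>2 * (n + (n - 2) * \<sigma>)
     = (p - 2)\<^sup>2 * \<sigma>\<^sup>2 + (p\<^sup>2 - 2 * n + t\<^sup>2 * (n - 2)) * \<sigma> + t\<^sup>2 * n" by algebra
  also have "\<dots> = ((p - 2) * \<sigma> + a * t)\<^sup>2" unfolding k unfolding ab(1)[symmetric] by algebra
  finally show ?thesis by (simp add: a_def)
qed

text \<open>In the first range the difference of the two sides has the factor \<open>1 - \<sigma>\<close>, in the second it is a square, and in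
  the third it has the factor \<open>\<sigma>\<close>. The bounds on \<open>p\<close> in the first and third range make the other factor nonnegative.\<close>

lemma kappa_le_quotient:
  fixes \<sigma> p :: real
  assumes n: "n \<ge> 2" and p: "p > 1" and \<sigma>: "0 \<le> \<sigma>" "\<sigma> \<le> 1"
  shows "kappa p n * (n + (real n - 2) * \<sigma>) \<le> (p - 2)\<^sup>2 * \<sigma>\<^sup>2 + ((p - 2)\<^sup>2 + 4 * (p - 2)) * \<sigma> + 2 * n"
proof -
  define N where "N = real n"
  have N: "N \<ge> 2" using n by (simp add: N_def)
  define r where "r = sqrt (2 * N)"
  have r: "r \<ge> 2" "r\<^sup>2 = 2 * N" using N real_sqrt_le_mono[of 4 "2 * N"] by (auto simp: r_def)
  have D: "N + (N - 2) * \<sigma> > 0" using N \<sigma> by (intro add_pos_nonneg) auto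
  have num: "(p - 2)\<^sup>2 * \<sigma>\<^sup>2 + ((p - 2)\<^sup>2 + 4 * (p - 2)) * \<sigma> + 2 * N
    = 2 * (N + (N - 2) * \<sigma>) + ((p - 2)\<^sup>2 * \<sigma>\<^sup>2 + (p\<^sup>2 - 2 * N) * \<sigma>)" by algebra
  consider (a) "p \<le> 1 + (N - 1) / (r - 1)" | (b) "p > 1 + (N - 1) / (r - 1)" "p \<le> r"
    | (c) "p > 1 + (N - 1) / (r - 1)" "p > r" by linarith
  then have "kappa p n * (N + (N - 2) * \<sigma>) \<le> (p - 2)\<^sup>2 * \<sigma>\<^sup>2 + ((p - 2)\<^sup>2 + 4 * (p - 2)) * \<sigma> + 2 * N"
  proof cases
    case a
    then have k: "kappa p n = 1 + (p - 1)\<^sup>2 / (N - 1)" by (simp add: kappa_def N_def r_def)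
    define y where "y = p - 1"
    have y: "y > 0" "y * (r - 1) \<le> N - 1" using a p r by (auto simp: y_def field_simps)
    have "(r * y)\<^sup>2 \<le> (N - 1 + y)\<^sup>2" using y r by (intro power_mono) (auto simp: algebra_simps)
    then have "2 * N * y\<^sup>2 \<le> (N - 1 + y)\<^sup>2" by (simp add: power_mult_distrib r)
    then have "0 \<le> N * (N - 1) - N * y\<^sup>2 - (N - 1) * (y - 1)\<^sup>2" by (simp add: power2_eq_square algebra_simps)
    then have "0 \<le> (N * (N - 1) - N * y\<^sup>2 - (N - 1) * (y - 1)\<^sup>2) / (N - 1)" using N by simp
    also have "\<dots> = N * (2 - kappa p n) - (p - 2)\<^sup>2"
      using N by (simp add: k y_def field_simps)
    finally have "(p - 2)\<^sup>2 * \<sigma> \<le> N * (2 - kappa p n)"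
      using \<sigma> mult_left_le[of \<sigma> "(p - 2)\<^sup>2"] by simp
    then have "0 \<le> (1 - \<sigma>) * (N * (2 - kappa p n) - (p - 2)\<^sup>2 * \<sigma>)" using \<sigma> by simp
    also have "\<dots> = (p - 2)\<^sup>2 * \<sigma>\<^sup>2 + ((p - 2)\<^sup>2 + 4 * (p - 2)) * \<sigma> + 2 * N - kappa p n * (N + (N - 2) * \<sigma>)
       + \<sigma> * (kappa p n * (2 * (N - 1)) - (2 * (p - 2)\<^sup>2 + 4 * (p - 2) + 2 * N))"
      by algebra
    also have "kappa p n * (2 * (N - 1)) = 2 * (p - 2)\<^sup>2 + 4 * (p - 2) + 2 * N"
    proof -
      have "kappa p n * (N - 1) = (N - 1) + (p - 1)\<^sup>2" using N by (simp add: k field_simps)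
      then show ?thesis by algebra
    qed
    finally show ?thesis by simp
  next
    case b
    have N2: "N > 2"
    proof (rule ccontr)
      assume "\<not> N > 2"
      then have "N = 2" using N by simp
      then show False using b by (simp add: r_def)
    qed
    define t where "t = (p - sqrt (2 * N)) / (sqrt N - sqrt 2)"
    have k: "kappa p n = 2 - t\<^sup>2" using b by (simp add: kappa_def N_def r_def t_def power_divide)
    have "0 \<le> (p - 2)\<^sup>2 * \<sigma>\<^sup>2 + (p\<^sup>2 - 2 * N) * \<sigma> + t\<^sup>2 * (N + (N - 2) * \<sigma>)"
      unfolding middle_square[OF N2 t_def] by simp
    then show ?thesis unfolding num k by (simp add: left_diff_distrib)
  next
    case c
    have k: "kappa p n = 2" using c by (simp add: kappa_def N_def r_def)
    have "r\<^sup>2 \<le> p\<^sup>2" using c r by (intro power_mono) auto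
    then have "0 \<le> (p - 2)\<^sup>2 * \<sigma>\<^sup>2 + (p\<^sup>2 - 2 * N) * \<sigma>" using \<sigma> r by simp
    then show ?thesis unfolding num k by simp
  qed
  then show ?thesis by (simp add: N_def)
qed

text \<open>Here \<open>A\<close> stands for the squared norm of the diagonal entry at \<open>k\<^sub>0\<close>, \<open>B\<close> for that of the rest of its row, and the
  quotient for the least squared norm of the other diagonal entries with the prescribed sum. The bounds for \<open>x\<close> and
  \<open>y\<close> come from the Cauchy-Schwarz inequality.\<close>

lemma kappa_scalar_inequality:
  fixes p x y A B \<sigma> :: real
  assumes n: "n \<ge> 2" and p: "p > 1" and \<sigma>: "0 \<le> \<sigma>" "\<sigma> \<le> 1"
    and A: "x\<^sup>2 \<le> \<sigma> * A" "0 \<le> A" and B: "y\<^sup>2 \<le> (1 - \<sigma>) * B" "0 \<le> B"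
  shows "kappa p n * (x + y)\<^sup>2 \<le> A + 2 * B + (A + 2 * (p - 2) * (x + y) * x + (p - 2)\<^sup>2 * (x + y)\<^sup>2 * \<sigma>) / (real n - 1)"
proof -
  define N where "N = real n"
  have N: "N \<ge> 2" using n by (simp add: N_def)
  define W q where "W = x + y" and "q = p - 2"
  define D Q where "D = N + (N - 2) * \<sigma>" and "Q = q\<^sup>2 * \<sigma>\<^sup>2 + (q\<^sup>2 + 4 * q) * \<sigma> + 2 * N"
  have D: "D > 0" unfolding D_def using N \<sigma> by (intro add_pos_nonneg) auto
  have kQ: "kappa p n * D \<le> Q"
    using kappa_le_quotient[OF n p \<sigma>] by (simp add: D_def Q_def N_def q_def)
  define T where "T = N * A + 2 * (N - 1) * B + 2 * q * W * x + q\<^sup>2 * W\<^sup>2 * \<sigma>"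
  have "(N - 1) * Q * W\<^sup>2 \<le> D * T"
  proof -
    consider "\<sigma> = 0" | "\<sigma> = 1" | "0 < \<sigma>" "\<sigma> < 1" using \<sigma> by linarith
    then show ?thesis
    proof cases
      case 1
      then have "x = 0" "y\<^sup>2 \<le> B" using A B by auto
      moreover have "2 * (N - 1) * y\<^sup>2 \<le> 2 * (N - 1) * B" using \<open>y\<^sup>2 \<le> B\<close> N by (intro mult_left_mono) auto
      moreover have "0 \<le> N * A" using A(2) N by simp
      ultimately have "2 * (N - 1) * W\<^sup>2 \<le> T" using 1 by (simp add: T_def W_def)
      then have "N * (2 * (N - 1) * W\<^sup>2) \<le> N * T" using N by (intro mult_left_mono) auto
      then show ?thesis using 1 by (simp add: D_def Q_def algebra_simps)
    next
      case 2
      then have "y = 0" "x\<^sup>2 \<le> A" using A B by auto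
      moreover have "N * x\<^sup>2 \<le> N * A" using \<open>x\<^sup>2 \<le> A\<close> N by (intro mult_left_mono) auto
      moreover have "0 \<le> 2 * (N - 1) * B" using B(2) N by simp
      moreover have "T = N * A + 2 * (N - 1) * B + 2 * q * x\<^sup>2 + q\<^sup>2 * x\<^sup>2"
        using 2 \<open>y = 0\<close> by (simp add: T_def W_def power2_eq_square)
      ultimately have "N * x\<^sup>2 + 2 * q * x\<^sup>2 + q\<^sup>2 * x\<^sup>2 \<le> T" by linarith
      then have "D * (N * x\<^sup>2 + 2 * q * x\<^sup>2 + q\<^sup>2 * x\<^sup>2) \<le> D * T" using D by (intro mult_left_mono) auto
      moreover have "D * (N * x\<^sup>2 + 2 * q * x\<^sup>2 + q\<^sup>2 * x\<^sup>2) = (N - 1) * Q * W\<^sup>2"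
        using 2 \<open>y = 0\<close> unfolding D_def Q_def W_def by algebra
      ultimately show ?thesis by simp
    next
      case 3
      have "N * (1 - \<sigma>) * x\<^sup>2 \<le> N * (1 - \<sigma>) * (\<sigma> * A)" using A 3 N by (intro mult_left_mono) auto
      moreover have "2 * (N - 1) * \<sigma> * y\<^sup>2 \<le> 2 * (N - 1) * \<sigma> * ((1 - \<sigma>) * B)" using B 3 N by (intro mult_left_mono) auto
      ultimately have "N * (1 - \<sigma>) * x\<^sup>2 + 2 * (N - 1) * \<sigma> * (W - x)\<^sup>2 + \<sigma> * (1 - \<sigma>) * (2 * q * W * x + q\<^sup>2 * W\<^sup>2 * \<sigma>)
         \<le> \<sigma> * (1 - \<sigma>) * T"
        unfolding T_def W_def by (simp add: algebra_simps)
      then have "D * (N * (1 - \<sigma>) * x\<^sup>2 + 2 * (N - 1) * \<sigma> * (W - x)\<^sup>2 + \<sigma> * (1 - \<sigma>) * (2 * q * W * x + q\<^sup>2 * W\<^sup>2 * \<sigma>))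
         \<le> D * (\<sigma> * (1 - \<sigma>) * T)" using D by (intro mult_left_mono) auto
      then have "\<sigma> * (1 - \<sigma>) * (N - 1) * Q * W\<^sup>2 \<le> D * (\<sigma> * (1 - \<sigma>) * T)"
        unfolding D_def complete_square_identity Q_def
        by (rule order_trans[rotated]) simp
      then have "(\<sigma> * (1 - \<sigma>)) * ((N - 1) * Q * W\<^sup>2) \<le> (\<sigma> * (1 - \<sigma>)) * (D * T)" by (simp add: ac_simps)
      then show ?thesis using 3 by (simp only: mult_le_cancel_left_pos mult_pos_pos diff_gt_0_iff_gt)
    qed
  qed
  moreover have "(N - 1) * (kappa p n * D) * W\<^sup>2 \<le> (N - 1) * Q * W\<^sup>2"
    using kQ N by (intro mult_right_mono mult_left_mono) auto
  ultimately have "D * ((N - 1) * (kappa p n * W\<^sup>2)) \<le> D * T" by (simp add: ac_simps)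
  then have "(N - 1) * (kappa p n * W\<^sup>2) \<le> T" using D by simp
  then have "kappa p n * W\<^sup>2 \<le> T / (N - 1)" using N by (simp add: field_simps)
  also have "T / (N - 1) = A + 2 * B + (A + 2 * q * W * x + q\<^sup>2 * W\<^sup>2 * \<sigma>) / (N - 1)"
    using N by (simp add: T_def field_simps)
  finally show ?thesis by (simp add: W_def q_def N_def)
qed

lemma norm_sum_squared_le:
  fixes v :: "'i \<Rightarrow> 'l::real_inner"
  assumes "finite I"
  shows "(norm (\<Sum>i\<in>I. v i))\<^sup>2 \<le> card I * (\<Sum>i\<in>I. (norm (v i))\<^sup>2)"
proof -
  have "(norm (\<Sum>i\<in>I. v i))\<^sup>2 \<le> (\<Sum>i\<in>I. 1 * norm (v i))\<^sup>2"
    by (intro power_mono) (auto intro: norm_sum)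
  also have "\<dots> \<le> (\<Sum>i\<in>I. 1\<^sup>2) * (\<Sum>i\<in>I. (norm (v i))\<^sup>2)" by (rule Cauchy_Schwarz_ineq_sum)
  finally show ?thesis by simp
qed

lemma inner_sum_squared_le:
  fixes a b :: "'i \<Rightarrow> 'l::real_inner"
  shows "(\<Sum>i\<in>I. a i \<bullet> b i)\<^sup>2 \<le> (\<Sum>i\<in>I. (norm (a i))\<^sup>2) * (\<Sum>i\<in>I. (norm (b i))\<^sup>2)"
proof -
  have "\<bar>\<Sum>i\<in>I. a i \<bullet> b i\<bar> \<le> (\<Sum>i\<in>I. norm (a i) * norm (b i))"
    by (intro order_trans[OF sum_abs] sum_mono Cauchy_Schwarz_ineq2)
  then have "(\<Sum>i\<in>I. a i \<bullet> b i)\<^sup>2 \<le> (\<Sum>i\<in>I. norm (a i) * norm (b i))\<^sup>2"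
    using power_mono[of "\<bar>\<Sum>i\<in>I. a i \<bullet> b i\<bar>" _ 2] by simp
  also have "\<dots> \<le> (\<Sum>i\<in>I. (norm (a i))\<^sup>2) * (\<Sum>i\<in>I. (norm (b i))\<^sup>2)" by (rule Cauchy_Schwarz_ineq_sum)
  finally show ?thesis .
qed

text \<open>Only the row and the column of \<open>k0\<close> and the diagonal of \<open>H\<close> enter. By symmetry the off-diagonal entries of the row
  count twice; the remaining diagonal entries are estimated by their sum, which the equation determines.\<close>

lemma refined_Kato_pointwise:
  fixes E :: "'n::finite \<Rightarrow> 'l::real_inner" and H :: "'n \<Rightarrow> 'n \<Rightarrow> 'l" and w :: "'n \<Rightarrow> real"
  assumes n: "CARD('n) \<ge> 2" and p: "p > 1" and g: "g > 0"
    and E: "(\<Sum>k\<in>UNIV. (norm (E k))\<^sup>2) = g\<^sup>2"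
    and w: "\<And>k. g * w k = (\<Sum>l\<in>UNIV. H k l \<bullet> E l)" and w0: "\<And>k. k \<noteq> k0 \<Longrightarrow> w k = 0"
    and H: "\<And>k l. H k l = H l k"
    and eq: "(\<Sum>k\<in>UNIV. H k k) + ((p - 2) / g) *\<^sub>R (\<Sum>k\<in>UNIV. w k *\<^sub>R E k) = 0"
  shows "kappa p CARD('n) * (\<Sum>k\<in>UNIV. (w k)\<^sup>2) \<le> (\<Sum>k\<in>UNIV. \<Sum>l\<in>UNIV. (norm (H k l))\<^sup>2)"
proof -
  define I where "I = UNIV - {k0}"
  have split: "sum f UNIV = f k0 + sum f I" for f :: "'n \<Rightarrow> 'z::comm_monoid_add"
    unfolding I_def by (rule sum.remove) auto
  have cI: "card I = CARD('n) - 1" "real (card I) = real CARD('n) - 1" using n by (simp_all add: I_def of_nat_diff)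
  define \<beta> where "\<beta> k = (1 / g) *\<^sub>R E k" for k
  define h where "h = H k0"
  define \<sigma> where "\<sigma> = (norm (\<beta> k0))\<^sup>2"
  define A B where "A = (norm (h k0))\<^sup>2" and "B = (\<Sum>j\<in>I. (norm (h j))\<^sup>2)"
  define x y where "x = h k0 \<bullet> \<beta> k0" and "y = (\<Sum>j\<in>I. h j \<bullet> \<beta> j)"
  have "(\<Sum>k\<in>UNIV. (norm (\<beta> k))\<^sup>2) = (1 / g\<^sup>2) * (\<Sum>k\<in>UNIV. (norm (E k))\<^sup>2)"
    using g by (simp add: \<beta>_def power_divide sum_divide_distrib)
  then have "(\<Sum>k\<in>UNIV. (norm (\<beta> k))\<^sup>2) = 1" using E g by simp
  then have s1: "(\<Sum>k\<in>I. (norm (\<beta> k))\<^sup>2) = 1 - \<sigma>" unfolding split \<sigma>_def by simp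
  have \<sigma>: "0 \<le> \<sigma>" "\<sigma> \<le> 1" using s1 sum_nonneg[of I "\<lambda>k. (norm (\<beta> k))\<^sup>2"] by (auto simp: \<sigma>_def)
  have W: "w k0 = x + y"
  proof -
    have "w k0 = (1 / g) * (\<Sum>l\<in>UNIV. h l \<bullet> E l)" using w[of k0] g by (simp add: h_def field_simps)
    also have "\<dots> = (\<Sum>l\<in>UNIV. h l \<bullet> \<beta> l)" by (simp add: \<beta>_def sum_distrib_left sum_divide_distrib)
    finally show ?thesis by (simp add: split x_def y_def)
  qed
  have wE: "(\<Sum>k\<in>UNIV. w k *\<^sub>R E k) = w k0 *\<^sub>R E k0"
    unfolding split by (simp add: I_def w0)
  have tr: "(\<Sum>i\<in>I. H i i) = - (h k0 + ((p - 2) * (x + y)) *\<^sub>R \<beta> k0)"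
  proof -
    have "((p - 2) / g) *\<^sub>R (w k0 *\<^sub>R E k0) = ((p - 2) * (x + y)) *\<^sub>R \<beta> k0" by (simp add: \<beta>_def W)
    then have "h k0 + (\<Sum>i\<in>I. H i i) + ((p - 2) * (x + y)) *\<^sub>R \<beta> k0 = 0"
      using eq unfolding wE unfolding split by (simp add: h_def)
    then show ?thesis unfolding eq_neg_iff_add_eq_0 by (simp only: ac_simps)
  qed
  have trn: "(norm (\<Sum>i\<in>I. H i i))\<^sup>2 = A + 2 * (p - 2) * (x + y) * x + (p - 2)\<^sup>2 * (x + y)\<^sup>2 * \<sigma>"
    unfolding tr norm_minus_cancel A_def x_def \<sigma>_def power2_norm_eq_inner
    by (simp add: inner_add_left inner_add_right inner_commute power2_eq_square algebra_simps)
  have "x\<^sup>2 \<le> \<sigma> * A"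
    using inner_sum_squared_le[of "\<lambda>_. h k0" "\<lambda>_. \<beta> k0" "{k0}"] by (simp add: x_def \<sigma>_def A_def mult.commute)
  moreover have "y\<^sup>2 \<le> (1 - \<sigma>) * B"
    using inner_sum_squared_le[of h \<beta> I] by (simp add: y_def s1 B_def mult.commute)
  ultimately have "kappa p CARD('n) * (x + y)\<^sup>2 \<le>
     A + 2 * B + (A + 2 * (p - 2) * (x + y) * x + (p - 2)\<^sup>2 * (x + y)\<^sup>2 * \<sigma>) / (real CARD('n) - 1)"
    using \<sigma> by (intro kappa_scalar_inequality n p) (auto simp: A_def B_def sum_nonneg)
  also have "(A + 2 * (p - 2) * (x + y) * x + (p - 2)\<^sup>2 * (x + y)\<^sup>2 * \<sigma>) / (real CARD('n) - 1)
     \<le> (\<Sum>i\<in>I. (norm (H i i))\<^sup>2)"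
    using norm_sum_squared_le[of I "\<lambda>i. H i i"] n unfolding trn cI(2) by (simp add: I_def divide_le_eq mult.commute)
  also have "A + 2 * B + (\<Sum>i\<in>I. (norm (H i i))\<^sup>2) \<le> (\<Sum>k\<in>UNIV. \<Sum>l\<in>UNIV. (norm (H k l))\<^sup>2)"
  proof -
    have "(\<Sum>k\<in>UNIV. \<Sum>l\<in>UNIV. (norm (H k l))\<^sup>2) = A + B + (\<Sum>k\<in>I. (norm (H k k0))\<^sup>2 + (\<Sum>l\<in>I. (norm (H k l))\<^sup>2))"
      unfolding split by (simp add: A_def B_def h_def)
    also have "\<dots> = A + 2 * B + (\<Sum>k\<in>I. \<Sum>l\<in>I. (norm (H k l))\<^sup>2)"
      by (simp add: sum.distrib B_def h_def H[of _ k0])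
    finally have "(\<Sum>k\<in>UNIV. \<Sum>l\<in>UNIV. (norm (H k l))\<^sup>2) = A + 2 * B + (\<Sum>k\<in>I. \<Sum>l\<in>I. (norm (H k l))\<^sup>2)" .
    moreover have "(\<Sum>k\<in>I. (norm (H k k))\<^sup>2) \<le> (\<Sum>k\<in>I. \<Sum>l\<in>I. (norm (H k l))\<^sup>2)"
      by (intro sum_mono member_le_sum) auto
    ultimately show ?thesis by simp
  qed
  finally have "kappa p CARD('n) * (x + y)\<^sup>2 \<le> (\<Sum>k\<in>UNIV. \<Sum>l\<in>UNIV. (norm (H k l))\<^sup>2)" by simp
  moreover have "(\<Sum>k\<in>UNIV. (w k)\<^sup>2) = (x + y)\<^sup>2" unfolding split by (simp add: I_def w0 W)
  ultimately show ?thesis by simp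
qed

text \<open>The cases of equality: \<open>s\<^sup>2\<close> is the value of \<open>\<sigma>\<close> at which \<open>F\<close> is minimal, \<open>a\<close>, \<open>h\<close> and \<open>b\<close> are the entries of the
  minimizing Hessian. The three ranges of \<open>p\<close> have \<open>\<sigma> = 1\<close>, \<open>0 < \<sigma> < 1\<close> and \<open>\<sigma> = 0\<close>.\<close>

lemma kappa_extremal:
  assumes n: "n \<ge> 2" and p: "p > 1"
  obtains s c a b h :: real where "s\<^sup>2 + c\<^sup>2 = 1" "a * s + c * h = 1" "a + (real n - 1) * b + (p - 2) * s = 0"
    "a\<^sup>2 + (real n - 1) * b\<^sup>2 + 2 * h\<^sup>2 = kappa p n"
proof -
  define N where "N = real n"
  have N: "N \<ge> 2" using n by (simp add: N_def)
  define r where "r = sqrt (2 * N)"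
  have r: "r \<ge> 2" "r\<^sup>2 = 2 * N" using N real_sqrt_le_mono[of 4 "2 * N"] by (auto simp: r_def)
  consider (a) "p \<le> 1 + (N - 1) / (r - 1)" | (b) "p > 1 + (N - 1) / (r - 1)" "p < r"
    | (c) "p > 1 + (N - 1) / (r - 1)" "p \<ge> r" by linarith
  then show ?thesis
  proof cases
    case a
    then have k: "kappa p n = 1 + (p - 1)\<^sup>2 / (N - 1)" by (simp add: kappa_def N_def r_def)
    have z: "(N - 1) * (- (p - 1) / (N - 1))\<^sup>2 = (p - 1)\<^sup>2 / (N - 1)"
      "(N - 1) * (- (p - 1) / (N - 1)) = 1 - p"
      using N by (auto simp: power2_eq_square) algebra
    show ?thesis
      by (rule that[of 1 0 1 0 "- (p - 1) / (N - 1)"]) (simp_all only: k N_def[symmetric] z, simp_all)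
  next
    case c
    have k: "kappa p n = 2" using c by (auto simp: kappa_def N_def r_def)
    show ?thesis by (rule that[of 0 1 0 1 0]) (auto simp: k)
  next
    case b
    have N2: "N > 2"
    proof (rule ccontr)
      assume "\<not> N > 2"
      then have "N = 2" using N by simp
      then show False using b by (simp add: r_def)
    qed
    define q where "q = p - 2"
    define \<delta> where "\<delta> = sqrt N - sqrt 2"
    have \<delta>: "\<delta> > 0" using N2 by (simp add: \<delta>_def)
    have rN: "r \<le> N" unfolding r_def using N by (intro real_le_lsqrt) (auto simp: power2_eq_square)
    have pr: "p * (r - 1) > r + N - 2"
      using b(1) r by (simp add: field_simps)
    have "2 * (r - 1) < p * (r - 1)" using pr rN by simp
    moreover have "r - 1 > 0" using r by simp
    ultimately have "2 < p" by (simp only: mult_less_cancel_right_pos)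
    then have q: "q > 0" by (simp add: q_def)
    have s2: "sqrt N * sqrt 2 = r" "sqrt 2 > 0" "(sqrt N)\<^sup>2 = N" "(sqrt 2)\<^sup>2 = (2::real)"
      using N by (auto simp: r_def real_sqrt_mult)
    \<comment> \<open>The root of the square in \<open>middle_square\<close>; it is below \<open>1\<close> exactly above the first threshold.\<close>
    define \<sigma> where "\<sigma> = sqrt N * (r - p) / (\<delta> * q)"
    have \<sigma>0: "\<sigma> > 0" unfolding \<sigma>_def using b q \<delta> N by (intro divide_pos_pos mult_pos_pos) auto
    have "sqrt 2 * (r + N - 2) < sqrt 2 * (p * (r - 1))" using pr by simp
    moreover have "sqrt 2 * (r + N - 2) = sqrt N * r + 2 * \<delta>"
      unfolding s2(1)[symmetric] \<delta>_def using s2(3,4) by (simp add: algebra_simps power2_eq_square)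
    moreover have "sqrt 2 * (p * (r - 1)) = p * (2 * sqrt N - sqrt 2)"
      unfolding s2(1)[symmetric] using s2(3,4) by (simp add: algebra_simps power2_eq_square)
    ultimately have "sqrt N * r + 2 * \<delta> < p * (2 * sqrt N - sqrt 2)" by linarith
    then have "sqrt N * (r - p) < \<delta> * q" by (simp add: \<delta>_def q_def algebra_simps)
    then have \<sigma>1: "\<sigma> < 1" unfolding \<sigma>_def using q \<delta> by simp
    define t where "t = (p - sqrt (2 * N)) / (sqrt N - sqrt 2)"
    have k: "kappa p n = 2 - t\<^sup>2" using b by (simp add: kappa_def N_def r_def t_def power_divide)
    have tr: "t = (p - r) / \<delta>" by (simp only: t_def r_def \<delta>_def)
    have "q * \<sigma> + sqrt N * t = 0" using q \<delta> by (simp add: \<sigma>_def tr field_simps)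
    then have ms: "(p - 2)\<^sup>2 * \<sigma>\<^sup>2 + (p\<^sup>2 - 2 * N) * \<sigma> + t\<^sup>2 * (N + (N - 2) * \<sigma>) = 0"
      unfolding middle_square[OF N2 t_def] by (simp add: q_def)
    define D Q where "D = N + (N - 2) * \<sigma>" and "Q = q\<^sup>2 * \<sigma>\<^sup>2 + (q\<^sup>2 + 4 * q) * \<sigma> + 2 * N"
    have D: "D > 0" unfolding D_def using N2 \<sigma>0 by (intro add_pos_pos) auto
    have "Q = 2 * D + ((p - 2)\<^sup>2 * \<sigma>\<^sup>2 + (p\<^sup>2 - 2 * N) * \<sigma>)" unfolding Q_def D_def q_def by algebra
    then have kD: "kappa p n * D = Q" using ms by (simp add: k D_def algebra_simps)
    \<comment> \<open>The minimizer in \<open>complete_square_identity\<close> for \<open>W = 1\<close>.\<close>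
    define x where "x = \<sigma> * (2 * (N - 1) - q * (1 - \<sigma>)) / D"
    define s c where "s = sqrt \<sigma>" and "c = sqrt (1 - \<sigma>)"
    have sc: "s > 0" "c > 0" "s\<^sup>2 = \<sigma>" "c\<^sup>2 = 1 - \<sigma>" using \<sigma>0 \<sigma>1 by (auto simp: s_def c_def)
    define a h b' where "a = x / s" and "h = (1 - x) / c" and "b' = - (a + q * s) / (N - 1)"
    have as: "a * s = x" "a\<^sup>2 = x\<^sup>2 / \<sigma>" "c * h = 1 - x" "h\<^sup>2 = (1 - x)\<^sup>2 / (1 - \<sigma>)"
      using sc by (auto simp: a_def h_def power_divide)
    have id: "(N + (N - 2) * \<sigma>) * (N * (1 - \<sigma>) * x\<^sup>2 + 2 * (N - 1) * \<sigma> * (1 - x)\<^sup>2 + \<sigma> * (1 - \<sigma>) * (2 * q * x + q\<^sup>2 * \<sigma>))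
      = \<sigma> * (1 - \<sigma>) * (N - 1) * Q"
      using complete_square_identity[of N \<sigma> x 1 q] D unfolding Q_def x_def D_def by simp
    have "(N - 1) * (a\<^sup>2 + (N - 1) * b'\<^sup>2 + 2 * h\<^sup>2) = (N - 1) * a\<^sup>2 + (a + q * s)\<^sup>2 + 2 * (N - 1) * h\<^sup>2"
    proof -
      have "(N - 1) * b' = - (a + q * s)" using N by (simp add: b'_def)
      moreover have "(N - 1) * (a\<^sup>2 + (N - 1) * b'\<^sup>2 + 2 * h\<^sup>2) = (N - 1) * a\<^sup>2 + ((N - 1) * b')\<^sup>2 + 2 * (N - 1) * h\<^sup>2"
        by algebra
      ultimately show ?thesis by (simp only: power2_minus)
    qed
    also have "(a + q * s)\<^sup>2 = a\<^sup>2 + 2 * q * x + q\<^sup>2 * \<sigma>"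
      unfolding as(1)[symmetric] sc(3)[symmetric] by algebra
    also have "(N - 1) * a\<^sup>2 + (a\<^sup>2 + 2 * q * x + q\<^sup>2 * \<sigma>) + 2 * (N - 1) * h\<^sup>2
      = (N * (1 - \<sigma>) * x\<^sup>2 + 2 * (N - 1) * \<sigma> * (1 - x)\<^sup>2 + \<sigma> * (1 - \<sigma>) * (2 * q * x + q\<^sup>2 * \<sigma>)) / (\<sigma> * (1 - \<sigma>))"
      unfolding as using \<sigma>0 \<sigma>1 by (simp add: field_simps)
    also have "\<dots> = (N - 1) * Q / D"
      using id D \<sigma>0 \<sigma>1 unfolding D_def[symmetric] by (simp add: field_simps)
    also have "\<dots> = (N - 1) * kappa p n" using kD D by (simp add: field_simps)
    finally have "a\<^sup>2 + (N - 1) * b'\<^sup>2 + 2 * h\<^sup>2 = kappa p n" using N by simp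
    then show ?thesis
      by (intro that[of s c a h b']) (use sc as N in \<open>auto simp: N_def[symmetric] b'_def q_def\<close>)
  qed
qed

lemma continuous_measurable_restrict_lborel:
  fixes f :: "'a::euclidean_space \<Rightarrow> 'b::topological_space"
  assumes "continuous_on K f"
  shows "f \<in> borel_measurable (restrict_space lborel K)"
proof -
  have "measurable (restrict_space lborel K) borel = (measurable (restrict_space borel K) borel :: ('a \<Rightarrow> 'b) set)"
    by (rule measurable_cong_sets) (simp_all add: sets_restrict_space)
  then show ?thesis using borel_measurable_continuous_on_restrict[OF assms] by simp
qed

section \<open>Changing a map inside one chart\<close>

context
  fixes M :: "('m, 'n::finite) manifold"
  assumes M: "riemannian_manifold M"
begin

lemma hausdorff: "Hausdorff_space (mtop M)"
  using M by (simp add: riemannian_manifold_def)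

lemma topspace_atlas: "topspace (mtop M) = (\<Union>c\<in>atlas M. cdom c)"
  using M by (simp add: riemannian_manifold_def)

context
  fixes c :: "('m, 'n) chart"
  assumes c: "c \<in> atlas M"
begin

lemma openin_cdom: "openin (mtop M) (cdom c)"
  using M c by (simp add: riemannian_manifold_def)

lemma cdom_subset: "cdom c \<subseteq> topspace (mtop M)"
  using openin_cdom by (rule openin_subset)

lemma topspace_cdom: "topspace (subtopology (mtop M) (cdom c)) = cdom c"
  using cdom_subset by auto

lemma homeo_cmap: "homeomorphic_map (subtopology (mtop M) (cdom c)) (top_of_set (cimg c)) (cmap c)"
  using M c by (simp add: riemannian_manifold_def)

lemma inj_cmap: "inj_on (cmap c) (cdom c)"
  using homeo_cmap unfolding homeomorphic_map_def topspace_cdom by blast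

lemma cinv_cmap: "m \<in> cdom c \<Longrightarrow> cinv c (cmap c m) = m"
  unfolding cinv_def using inj_cmap by (rule inv_into_f_f)

lemma cmap_in: "m \<in> cdom c \<Longrightarrow> cmap c m \<in> cimg c"
  by (simp add: cimg_def)

lemma cinv_in: "x \<in> cimg c \<Longrightarrow> cinv c x \<in> cdom c"
  unfolding cimg_def cinv_def by (rule inv_into_into)

lemma cmap_cinv: "x \<in> cimg c \<Longrightarrow> cmap c (cinv c x) = x"
  unfolding cimg_def cinv_def by (rule f_inv_into_f)

lemma cinv_image_eq: "A \<subseteq> cimg c \<Longrightarrow> cinv c ` A = {m \<in> cdom c. cmap c m \<in> A}"
  using cinv_in cmap_cinv cinv_cmap by (auto intro!: image_eqI[of _ "cinv c"])

lemma cinv_image_subset: "A \<subseteq> cimg c \<Longrightarrow> cinv c ` A \<subseteq> cdom c"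
  by (simp add: cinv_image_eq)

lemma open_cmap_image:
  assumes "openin (mtop M) T" "T \<subseteq> cdom c"
  shows "open (cmap c ` T)"
proof -
  have "openin (subtopology (mtop M) (cdom c)) T"
    using assms openin_subset_topspace_eq by (auto simp: openin_subtopology)
  then have "openin (top_of_set (cimg c)) (cmap c ` T)"
    using homeomorphic_imp_open_map[OF homeo_cmap] by (simp add: open_map_def)
  then show ?thesis using open_cimg[OF M c] openin_open_trans by blast
qed

lemma openin_cinv_image:
  assumes "open A" "A \<subseteq> cimg c"
  shows "openin (mtop M) (cinv c ` A)"
proof -
  have "continuous_map (subtopology (mtop M) (cdom c)) (top_of_set (cimg c)) (cmap c)"
    using homeo_cmap homeomorphic_imp_continuous_map by blast
  moreover have "openin (top_of_set (cimg c)) A" using assms by (auto simp: openin_open)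
  ultimately have "openin (subtopology (mtop M) (cdom c)) {m \<in> topspace (subtopology (mtop M) (cdom c)). cmap c m \<in> A}"
    by (rule openin_continuous_map_preimage)
  then have "openin (subtopology (mtop M) (cdom c)) (cinv c ` A)"
    unfolding topspace_cdom cinv_image_eq[OF assms(2)] .
  then show ?thesis using openin_trans_full[OF _ openin_cdom] by blast
qed

lemma continuous_map_cinv: "continuous_map (top_of_set (cimg c)) (subtopology (mtop M) (cdom c)) (cinv c)"
proof -
  obtain g where g: "homeomorphic_maps (subtopology (mtop M) (cdom c)) (top_of_set (cimg c)) (cmap c) g"
    using homeo_cmap homeomorphic_map_maps by blast
  have cg: "continuous_map (top_of_set (cimg c)) (subtopology (mtop M) (cdom c)) g"
    using g by (simp add: homeomorphic_maps_def)
  have "g x = cinv c x" if "x \<in> cimg c" for x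
  proof -
    have "g (cmap c (cinv c x)) = cinv c x"
      using g cinv_in[OF that] unfolding homeomorphic_maps_def topspace_cdom by blast
    then show ?thesis by (simp add: cmap_cinv[OF that])
  qed
  then show ?thesis using continuous_map_eq[OF cg] by simp
qed

lemma compactin_cinv_image:
  assumes "compact K" "K \<subseteq> cimg c"
  shows "compactin (mtop M) (cinv c ` K)"
proof -
  have "compactin (top_of_set (cimg c)) K" using assms by (simp add: compactin_subtopology)
  from image_compactin[OF this continuous_map_cinv] show ?thesis by (simp add: compactin_subtopology)
qed

lemma openin_compl_cinv_image:
  assumes "compact K" "K \<subseteq> cimg c"
  shows "openin (mtop M) (topspace (mtop M) - cinv c ` K)"
  using compactin_imp_closedin[OF hausdorff compactin_cinv_image[OF assms]] by blast

end

lemma transition_smooth: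
  assumes "c \<in> atlas M" "c' \<in> atlas M"
  shows "Ck_on k (cmap c ` (cdom c \<inter> cdom c')) (\<lambda>x. cmap c' (cinv c x))"
  using M assms by (auto simp: riemannian_manifold_def smooth_on_def o_def)

lemma open_transition: "c \<in> atlas M \<Longrightarrow> c' \<in> atlas M \<Longrightarrow> open (cmap c ` (cdom c \<inter> cdom c'))"
  by (rule open_cmap_image) (auto intro: openin_cdom)

text \<open>Inside the first chart the transition maps carry the regularity over; elsewhere the function vanishes on an open
  set, since compact sets are closed in a Hausdorff space. The parameter \<open>s\<close> is needed for deformations, which also
  depend on time and on the point of the target.\<close>

lemma Ck_on_all_charts:
  fixes w :: "'m \<Rightarrow> 'p::euclidean_space \<Rightarrow> 'b::real_normed_vector"
  assumes c: "c \<in> atlas M" and c': "c' \<in> atlas M" and K: "compact K" "K \<subseteq> cimg c" and Q: "open Q"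
    and w: "Ck_on k (cimg c \<times> Q) (\<lambda>(x, s). w (cinv c x) s)"
    and w0: "\<And>m s. m \<in> topspace (mtop M) \<Longrightarrow> m \<notin> cinv c ` K \<Longrightarrow> s \<in> Q \<Longrightarrow> w m s = 0"
  shows "Ck_on k (cimg c' \<times> Q) (\<lambda>(x, s). w (cinv c' x) s)"
proof (rule Ck_on_local)
  fix z assume z: "z \<in> cimg c' \<times> Q"
  show "\<exists>T. open T \<and> z \<in> T \<and> Ck_on k T (\<lambda>(x, s). w (cinv c' x) s)"
  proof (cases "cinv c' (fst z) \<in> cdom c")
    case True
    let ?O = "cmap c' ` (cdom c' \<inter> cdom c)"
    have O: "open (?O \<times> Q)" by (intro open_Times open_transition c c' Q)
    have t: "Ck_on k ?O (\<lambda>x. cmap c (cinv c' x))" by (rule transition_smooth[OF c' c])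
    have "Ck_on k (?O \<times> Q) (\<lambda>z. (cmap c (cinv c' (fst z)), snd z))"
      by (intro Ck_on_Pair O Ck_on_compose[OF O Ck_on_linear t] Ck_on_linear bounded_linear_fst bounded_linear_snd) auto
    then have "Ck_on k (?O \<times> Q) (\<lambda>z. (\<lambda>(x, s). w (cinv c x) s) (cmap c (cinv c' (fst z)), snd z))"
      by (rule Ck_on_compose[OF O _ w]) (auto simp: cinv_cmap[OF c'] cmap_in[OF c])
    then have "Ck_on k (?O \<times> Q) (\<lambda>(x, s). w (cinv c' x) s)"
      by (rule Ck_on_cong[OF O, rotated]) (auto simp: cinv_cmap[OF c'] cinv_cmap[OF c])
    moreover have "fst z \<in> ?O" using True z cinv_in[OF c', of "fst z"] cmap_cinv[OF c', of "fst z"] by (auto intro!: image_eqI[of _ _ "cinv c' (fst z)"])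
    ultimately show ?thesis using O z by (intro exI[of _ "?O \<times> Q"]) (auto simp: mem_Times_iff)
  next
    case False
    let ?O = "cmap c' ` (cdom c' \<inter> (topspace (mtop M) - cinv c ` K))"
    have O: "open (?O \<times> Q)"
      by (intro open_Times Q open_cmap_image[OF c'] openin_Int openin_cdom[OF c'] openin_compl_cinv_image[OF c K]) auto
    have "Ck_on k (?O \<times> Q) (\<lambda>(x, s). w (cinv c' x) s)"
      by (rule Ck_on_cong[OF O _ Ck_on_const[of _ _ 0]]) (use w0 in \<open>auto simp: cinv_cmap[OF c']\<close>)
    moreover have "fst z \<in> ?O"
      using False z cinv_in[OF c', of "fst z"] cmap_cinv[OF c', of "fst z"] cdom_subset[OF c'] cinv_image_subset[OF c K(2)]
      by (auto intro!: image_eqI[of _ _ "cinv c' (fst z)"])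
    ultimately show ?thesis using O z by (intro exI[of _ "?O \<times> Q"]) (auto simp: mem_Times_iff)
  qed
qed

lemma Ck_on_all_charts':
  fixes w :: "'m \<Rightarrow> 'b::real_normed_vector"
  assumes c: "c \<in> atlas M" and c': "c' \<in> atlas M" and K: "compact K" "K \<subseteq> cimg c"
    and w: "Ck_on k (cimg c) (\<lambda>x. w (cinv c x))"
    and w0: "\<And>m. m \<in> topspace (mtop M) \<Longrightarrow> m \<notin> cinv c ` K \<Longrightarrow> w m = 0"
  shows "Ck_on k (cimg c') (\<lambda>x. w (cinv c' x))"
proof -
  have oc: "open (cimg c \<times> (UNIV :: real set))" by (intro open_Times open_cimg[OF M c]) auto
  have "Ck_on k (cimg c \<times> (UNIV :: real set)) (\<lambda>z. w (cinv c (fst z)))"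
    by (rule Ck_on_compose_linear[OF bounded_linear_fst oc w]) auto
  then have "Ck_on k (cimg c \<times> (UNIV :: real set)) (\<lambda>(x, s). w (cinv c x))"
    unfolding case_prod_unfold .
  then have "Ck_on k (cimg c' \<times> (UNIV :: real set)) (\<lambda>(x, s). w (cinv c' x))"
    by (rule Ck_on_all_charts[OF c c' K open_UNIV]) (use w0 in auto)
  then have "Ck_on k (cimg c') (\<lambda>x. (\<lambda>(x, s). w (cinv c' x)) (x, 0 :: real))"
    by (rule Ck_on_compose[OF open_cimg[OF M c'] Ck_on_Pair, rotated 3])
       (auto intro: Ck_on_id open_cimg[OF M c'])
  then show ?thesis by simp
qed

lemma dderiv_coordinates:
  fixes f :: "real^'k::finite \<Rightarrow> 'b::real_normed_vector"
  assumes "f differentiable (at x)"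
  shows "dderiv f v x = (\<Sum>i\<in>UNIV. v $ i *\<^sub>R pd i f x)"
proof -
  interpret linear "\<lambda>v. dderiv f v x" using assms by (rule linear_frechet_derivative)
  have "dderiv f v x = dderiv f (\<Sum>i\<in>UNIV. v $ i *\<^sub>R axis i 1) x"
    using basis_expansion[of v] by (simp add: scalar_mult_eq_scaleR)
  then show ?thesis by (simp add: sum scale pd_def)
qed

lemma grad_sq_dderiv:
  assumes c: "c \<in> atlas M" and P: "frame (metric M c x) P" and d: "loc c u differentiable (at x)"
  shows "grad_sq M c u x = (\<Sum>k\<in>UNIV. (norm (dderiv (loc c u) (P k) x))\<^sup>2)"
  unfolding grad_sq_def[OF M c] dderiv_coordinates[OF d] power2_norm_eq_inner
  by (rule frame_sum_inner) (simp add: ginv_def matrix_inv_frame[OF P])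

text \<open>The norm of the gradient does not depend on the chart: the differential of a transition map
  takes orthonormal frames to orthonormal frames.\<close>

lemma grad_sq_chart:
  fixes u :: "'m \<Rightarrow> 'l::euclidean_space"
  assumes c: "c \<in> atlas M" and c': "c' \<in> atlas M" and m: "m \<in> cdom c" "m \<in> cdom c'"
    and d: "loc c' u differentiable (at (cmap c' m))"
  shows "grad_sq M c u (cmap c m) = grad_sq M c' u (cmap c' m)"
proof -
  define x where "x = cmap c m"
  define t where "t = (\<lambda>x. cmap c' (cinv c x))"
  let ?O = "cmap c ` (cdom c \<inter> cdom c')"
  have O: "open ?O" "x \<in> ?O" using open_transition[OF c c'] m by (auto simp: x_def)
  have tx: "t x = cmap c' m" by (simp add: t_def x_def cinv_cmap[OF c m(1)])
  have dt: "t differentiable (at x)"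
    unfolding t_def by (rule Ck_on_imp_differentiable[OF transition_smooth[OF c c', of 1]]) (use O in auto)
  have dlt: "(\<lambda>y. loc c' u (t y)) differentiable (at x)"
    using differentiable_chain_at[OF dt, of "loc c' u"] d by (simp add: o_def tx)
  have eq: "loc c' u (t y) = loc c u y" if "y \<in> ?O" for y
    using that by (auto simp: loc_def t_def cinv_cmap[OF c] cinv_cmap[OF c'])
  have du: "loc c u differentiable (at x)"
    using dlt has_derivative_transform_within_open[OF differentiable_has_dderiv[OF dlt] O(1,2) eq] by (auto simp: differentiable_def)
  have dd: "dderiv (loc c u) v x = dderiv (loc c' u) (dderiv t v x) (cmap c' m)" for v
    using dderiv_cong[OF O eq dlt, of v] dderiv_compose[OF dt, of "loc c' u" v] d by (simp add: tx)
  have xc: "x \<in> cimg c" using m by (simp add: x_def cimg_def)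
  obtain P where P: "frame (metric M c x) P" using pos_def_frame_exists[OF pos_def_metric[OF M c xc]] .
  define J where "J = matrix (frechet_derivative t (at x))"
  have Jv: "J *v v = dderiv t v x" for v
    unfolding J_def by (rule fun_cong[OF matrix_vector_mul(2)[OF linear_frechet_derivative[OF dt]]])
  have "metric M c x = transpose J ** metric M c' (t x) ** J"
  proof -
    have "\<forall>c\<in>atlas M. \<forall>c'\<in>atlas M. \<forall>x\<in>cmap c ` (cdom c \<inter> cdom c').
        (let J = matrix (frechet_derivative (cmap c' \<circ> cinv c) (at x)) in
         metric M c x = transpose J ** metric M c' ((cmap c' \<circ> cinv c) x) ** J)"
      using M unfolding riemannian_manifold_def by (elim conjE)
    from this[rule_format, OF c c' O(2)] show ?thesis by (simp add: Let_def J_def t_def o_def)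
  qed
  moreover have "v \<bullet> (transpose J *v z) = (J *v v) \<bullet> z" for v z
    using dot_lmul_matrix[of v "transpose J" z] by (simp only: vector_transpose_matrix)
  ultimately have "v \<bullet> (metric M c x *v w) = (J *v v) \<bullet> (metric M c' (t x) *v (J *v w))" for v w
    by (simp only: matrix_vector_mul_assoc[symmetric])
  then have Q: "frame (metric M c' (t x)) (\<lambda>k. dderiv t (P k) x)"
    using P by (simp add: frame_def Jv)
  show ?thesis
    using grad_sq_dderiv[OF c P du] grad_sq_dderiv[OF c' Q[unfolded tx] d] unfolding x_def[symmetric] dd by simp
qed

section \<open>The energy of a localized change\<close>

context
  fixes \<mu> :: "'m measure"
  assumes \<mu>: "is_riemannian_volume M \<mu>"
begin

lemma space_vol: "space \<mu> = topspace (mtop M)"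
  using \<mu> by (simp add: is_riemannian_volume_def)

lemma openin_sets: "openin (mtop M) U \<Longrightarrow> U \<in> sets \<mu>"
  using \<mu> by (auto simp: is_riemannian_volume_def)

lemma emeasure_vol:
  assumes "c \<in> atlas M" "A \<in> sets \<mu>" "A \<subseteq> cdom c"
  shows "emeasure \<mu> A = (\<integral>\<^sup>+x\<in>cmap c ` A. ennreal (vol_density M c x) \<partial>lborel)"
  using \<mu> assms by (simp add: is_riemannian_volume_def)

text \<open>Weak derivatives are unique in each chart, so the set where the two functions differ meets each chart in a null
  set; countably many charts suffice, because a second countable space has the Lindelof property.\<close>

lemma weak_grad_norm_unique:
  assumes e: "weak_grad_norm M \<mu> u e" and e': "weak_grad_norm M \<mu> u e'"
  shows "AE m in \<mu>. e m = e' m"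
proof -
  have [measurable]: "e \<in> borel_measurable \<mu>" "e' \<in> borel_measurable \<mu>"
    using e e' by (auto simp: weak_grad_norm_def)
  define B where "B = {m \<in> space \<mu>. e m \<noteq> e' m}"
  have B: "B \<in> sets \<mu>" unfolding B_def by measurable
  have chart: "B \<inter> cdom c \<in> null_sets \<mu>" if c: "c \<in> atlas M" for c
  proof -
    obtain D where D: "\<And>i. weak_pd (cimg c) i (loc c u) (D i)"
        "AE x in lborel. x \<in> cimg c \<longrightarrow> e (cinv c x) = sqrt (\<Sum>i\<in>UNIV. \<Sum>j\<in>UNIV. ginv M c x i j * (D i x \<bullet> D j x))"
      using e c unfolding weak_grad_norm_def by meson
    obtain D' where D': "\<And>i. weak_pd (cimg c) i (loc c u) (D' i)"
        "AE x in lborel. x \<in> cimg c \<longrightarrow> e' (cinv c x) = sqrt (\<Sum>i\<in>UNIV. \<Sum>j\<in>UNIV. ginv M c x i j * (D' i x \<bullet> D' j x))"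
      using e' c unfolding weak_grad_norm_def by meson
    have "AE x in lborel. \<forall>i\<in>UNIV. x \<in> cimg c \<longrightarrow> D i x = D' i x"
      by (rule AE_finite_allI) (auto intro: weak_pd_unique[OF open_cimg[OF M c] D(1) D'(1)])
    with D(2) D'(2) have ae: "AE x in lborel. x \<in> cimg c \<longrightarrow> e (cinv c x) = e' (cinv c x)"
      by eventually_elim auto
    have Bc: "B \<inter> cdom c \<in> sets \<mu>" using B openin_sets[OF openin_cdom[OF c]] by auto
    have "emeasure \<mu> (B \<inter> cdom c) = (\<integral>\<^sup>+x\<in>cmap c ` (B \<inter> cdom c). ennreal (vol_density M c x) \<partial>lborel)"
      by (rule emeasure_vol[OF c Bc]) auto
    also have "\<dots> = (\<integral>\<^sup>+(x::real^'n). 0 \<partial>lborel)"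
    proof (rule nn_integral_cong_AE)
      show "AE x in lborel. ennreal (vol_density M c x) * indicator (cmap c ` (B \<inter> cdom c)) x = 0"
        using ae
      proof eventually_elim
        case (elim x)
        have "x \<notin> cmap c ` (B \<inter> cdom c)" using elim by (auto simp: B_def cinv_cmap[OF c] cmap_in[OF c])
        then show ?case by simp
      qed
    qed
    finally show ?thesis using Bc by (auto simp: null_sets_def)
  qed
  have L1: "Lindelof_space (mtop M)"
    using M second_countable_imp_Lindelof_space by (auto simp: riemannian_manifold_def)
  have L2: "\<And>U. U \<in> cdom ` atlas M \<Longrightarrow> openin (mtop M) U" using openin_cdom by auto
  have L3: "\<Union>(cdom ` atlas M) = topspace (mtop M)" by (simp add: topspace_atlas)
  obtain \<V> where \<V>: "countable \<V>" "\<V> \<subseteq> cdom ` atlas M" "\<Union>\<V> = topspace (mtop M)"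
    using Lindelof_spaceD[of "mtop M" "cdom ` atlas M", OF L1 _ L3] L2 by meson
  have "(\<Union>V\<in>\<V>. B \<inter> V) \<in> null_sets \<mu>"
    using \<V>(2) chart by (intro null_sets_UN'[OF \<V>(1)]) auto
  moreover have "(\<Union>V\<in>\<V>. B \<inter> V) = B" using \<V>(3) by (auto simp: B_def space_vol)
  ultimately have "B \<in> null_sets \<mu>" by simp
  then show ?thesis by (rule AE_I'[of B]) (auto simp: B_def)
qed

context
  fixes c :: "('m, 'n) chart" and K :: "(real^'n) set"
  assumes c: "c \<in> atlas M" and K: "compact K" "K \<subseteq> cimg c"
begin

lemma cinv_K_sets: "cinv c ` K \<in> sets \<mu>"
proof -
  have "topspace (mtop M) - (topspace (mtop M) - cinv c ` K) \<in> sets \<mu>"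
    using openin_sets[OF openin_compl_cinv_image[OF c K]] openin_sets[OF openin_topspace] by blast
  moreover have "topspace (mtop M) - (topspace (mtop M) - cinv c ` K) = cinv c ` K"
    using cinv_image_subset[OF c K(2)] cdom_subset[OF c] by blast
  ultimately show ?thesis by simp
qed

lemma cinv_measurable: "cinv c \<in> measurable (restrict_space lborel K) (restrict_space \<mu> (cinv c ` K))"
proof (rule measurable_restrict_space2)
  show "cinv c \<in> space (restrict_space lborel K) \<rightarrow> cinv c ` K" by (auto simp: space_restrict_space)
  have s: "sets \<mu> = sigma_sets (topspace (mtop M)) {U. openin (mtop M) U}"
    using \<mu> by (simp add: is_riemannian_volume_def)
  show "cinv c \<in> measurable (restrict_space lborel K) \<mu>"
  proof (rule measurable_sigma_sets[OF s])
    show "{U. openin (mtop M) U} \<subseteq> Pow (topspace (mtop M))" using openin_subset by auto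
    show "cinv c \<in> space (restrict_space lborel K) \<rightarrow> topspace (mtop M)"
      using K(2) cinv_in[OF c] cdom_subset[OF c] by (auto simp: space_restrict_space)
    fix U assume "U \<in> {U. openin (mtop M) U}"
    then have "open (cmap c ` (cdom c \<inter> U))"
      by (intro open_cmap_image[OF c] openin_Int openin_cdom[OF c]) auto
    moreover have "cinv c -` U \<inter> space (restrict_space lborel K) = K \<inter> cmap c ` (cdom c \<inter> U)"
      using K(2) by (auto simp: space_restrict_space cinv_cmap[OF c] cinv_in[OF c] cmap_cinv[OF c] intro!: image_eqI[of _ "cmap c" "cinv c _"])
    ultimately show "cinv c -` U \<inter> space (restrict_space lborel K) \<in> sets (restrict_space lborel K)"
      by (auto simp: sets_restrict_space)
  qed
qed

lemma cmap_measurable: "cmap c \<in> measurable (restrict_space \<mu> (cinv c ` K)) (restrict_space borel K)"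
proof (rule measurable_restrict_space2)
  have sp: "space (restrict_space \<mu> (cinv c ` K)) = cinv c ` K"
    using sets.sets_into_space[OF cinv_K_sets] by (auto simp: space_restrict_space)
  show "cmap c \<in> space (restrict_space \<mu> (cinv c ` K)) \<rightarrow> K"
    using K(2) unfolding sp by (auto simp: cmap_cinv[OF c] subset_iff)
  show "cmap c \<in> borel_measurable (restrict_space \<mu> (cinv c ` K))"
  proof (rule borel_measurableI)
    fix S :: "(real^'n) set" assume "open S"
    then have "cinv c ` (S \<inter> cimg c) \<in> sets \<mu>"
      by (intro openin_sets openin_cinv_image[OF c] open_Int open_cimg[OF M c]) auto
    moreover have "cmap c -` S \<inter> space (restrict_space \<mu> (cinv c ` K)) = cinv c ` K \<inter> cinv c ` (S \<inter> cimg c)"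
      using K(2) unfolding sp by (auto simp: cmap_cinv[OF c] subset_iff)
    ultimately show "cmap c -` S \<inter> space (restrict_space \<mu> (cinv c ` K)) \<in> sets (restrict_space \<mu> (cinv c ` K))"
      by (auto simp: sets_restrict_space)
  qed
qed

text \<open>The defining property of the volume measure, read as an equality of measures on a compact part of one chart.\<close>

lemma restrict_vol_eq_distr:
  "restrict_space \<mu> (cinv c ` K) =
     distr (density (restrict_space lborel K) (\<lambda>x. ennreal (vol_density M c x))) (restrict_space \<mu> (cinv c ` K)) (cinv c)"
proof (rule measure_eqI)
  have Kb: "K \<in> sets borel" using K(1) by (simp add: borel_compact)
  have vm: "(\<lambda>x. ennreal (vol_density M c x)) \<in> borel_measurable (restrict_space lborel K)"
    by (intro measurable_compose[OF _ measurable_ennreal] continuous_measurable_restrict_lborel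
          continuous_on_subset[OF Ck_on_imp_continuous_on[OF vol_density_smooth[OF M c, of 0]] K(2)])
  fix A assume A: "A \<in> sets (restrict_space \<mu> (cinv c ` K))"
  then have A': "A \<in> sets \<mu>" "A \<subseteq> cinv c ` K"
    using cinv_K_sets by (auto simp: sets_restrict_space)
  have "emeasure (restrict_space \<mu> (cinv c ` K)) A = emeasure \<mu> A"
    using A' cinv_K_sets by (intro emeasure_restrict_space) auto
  also have "\<dots> = (\<integral>\<^sup>+x\<in>cmap c ` A. ennreal (vol_density M c x) \<partial>lborel)"
    by (rule emeasure_vol[OF c A'(1)]) (use A'(2) cinv_image_subset[OF c K(2)] in auto)
  also have "\<dots> = (\<integral>\<^sup>+x. (ennreal (vol_density M c x) * indicator (cinv c -` A \<inter> K) x) * indicator K x \<partial>lborel)"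
  proof (rule nn_integral_cong)
    fix x
    have "x \<in> cmap c ` A \<longleftrightarrow> x \<in> cinv c -` A \<inter> K"
      using A'(2) K(2) by (auto simp: cmap_cinv[OF c] subset_iff image_iff) (metis cmap_cinv[OF c] subsetD K(2))+
    then show "ennreal (vol_density M c x) * indicator (cmap c ` A) x =
       (ennreal (vol_density M c x) * indicator (cinv c -` A \<inter> K) x) * indicator K x"
      by (auto simp: indicator_def)
  qed
  also have "\<dots> = (\<integral>\<^sup>+x. ennreal (vol_density M c x) * indicator (cinv c -` A \<inter> K) x \<partial>restrict_space lborel K)"
    using Kb by (subst nn_integral_restrict_space) auto
  also have "\<dots> = emeasure (density (restrict_space lborel K) (\<lambda>x. ennreal (vol_density M c x))) (cinv c -` A \<inter> K)"
    using measurable_sets[OF cinv_measurable A] by (intro emeasure_density[symmetric] vm) (auto simp: space_restrict_space)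
  also have "\<dots> = emeasure (distr (density (restrict_space lborel K) (\<lambda>x. ennreal (vol_density M c x))) (restrict_space \<mu> (cinv c ` K)) (cinv c)) A"
    using cinv_measurable A by (subst emeasure_distr) (auto simp: space_restrict_space)
  finally show "emeasure (restrict_space \<mu> (cinv c ` K)) A = \<dots>" .
qed simp

lemma integral_over_chart:
  fixes h :: "real^'n \<Rightarrow> real"
  assumes h: "continuous_on K h"
  shows "integrable \<mu> (\<lambda>m. indicator (cinv c ` K) m * h (cmap c m))"
    and "(\<integral>m. indicator (cinv c ` K) m * h (cmap c m) \<partial>\<mu>) = integral K (\<lambda>x. h x * vol_density M c x)"
proof -
  let ?B = "cinv c ` K" and ?v = "vol_density M c"
  have Kb: "K \<in> sets borel" using K(1) by (simp add: borel_compact)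
  have Bs: "?B \<inter> space \<mu> \<in> sets \<mu>" using cinv_K_sets by auto
  have cv: "continuous_on K ?v"
    using Ck_on_imp_continuous_on[OF vol_density_smooth[OF M c, of 0]] K(2) by (rule continuous_on_subset)
  have hm: "h \<in> borel_measurable (restrict_space borel K)"
    using h by (rule borel_measurable_continuous_on_restrict)
  have vm: "?v \<in> borel_measurable (restrict_space lborel K)"
    by (rule continuous_measurable_restrict_lborel[OF cv])
  have fm: "(\<lambda>m. h (cmap c m)) \<in> borel_measurable (restrict_space \<mu> ?B)"
    using measurable_compose[OF cmap_measurable hm] .
  have vpos: "AE x in restrict_space lborel K. 0 \<le> ?v x"
    using vol_density_pos[OF M c] K(2) Kb
    by (intro AE_I2) (auto simp: space_restrict_space intro: less_imp_le)
  have i0: "integrable lborel (\<lambda>x. indicator K x *\<^sub>R (h x * ?v x))"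
    by (intro borel_integrable_compact K continuous_intros h cv)
  have i1: "integrable (restrict_space lborel K) (\<lambda>x. ?v x *\<^sub>R h (cmap c (cinv c x)))"
  proof -
    have "integrable (restrict_space lborel K) (\<lambda>x. h x * ?v x)"
      using i0 Kb by (subst integrable_restrict_space) auto
    moreover have "h x * ?v x = ?v x *\<^sub>R h (cmap c (cinv c x))" if "x \<in> space (restrict_space lborel K)" for x
      using that K(2) by (auto simp: space_restrict_space cmap_cinv[OF c] subset_iff)
    ultimately show ?thesis using Bochner_Integration.integrable_cong by (metis (mono_tags, lifting))
  qed
  have f2: "(\<lambda>x. h (cmap c (cinv c x))) \<in> borel_measurable (restrict_space lborel K)"
    using measurable_compose[OF cinv_measurable fm] .
  have i2: "integrable (density (restrict_space lborel K) (\<lambda>x. ennreal (?v x))) (\<lambda>x. h (cmap c (cinv c x)))"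
    using i1 by (subst integrable_density[OF f2 vm vpos]) simp
  have cm: "cinv c \<in> measurable (density (restrict_space lborel K) (\<lambda>x. ennreal (?v x))) (restrict_space \<mu> ?B)"
    using cinv_measurable by simp
  have "integrable (restrict_space \<mu> ?B) (\<lambda>m. h (cmap c m))"
    using i2 integrable_distr_eq[OF cm fm] by (simp add: restrict_vol_eq_distr[symmetric])
  then show "integrable \<mu> (\<lambda>m. indicator ?B m * h (cmap c m))"
    using Bs by (subst (asm) integrable_restrict_space) auto
  have "(\<integral>m. indicator ?B m * h (cmap c m) \<partial>\<mu>) = (\<integral>m. h (cmap c m) \<partial>restrict_space \<mu> ?B)"
    using Bs by (subst integral_restrict_space) auto
  also have "\<dots> = (\<integral>x. h (cmap c (cinv c x)) \<partial>density (restrict_space lborel K) (\<lambda>x. ennreal (?v x)))"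
    using integral_distr[OF cm fm] by (simp add: restrict_vol_eq_distr[symmetric])
  also have "\<dots> = (\<integral>x. ?v x *\<^sub>R h (cmap c (cinv c x)) \<partial>restrict_space lborel K)"
    by (rule integral_density[OF f2 vm vpos])
  also have "\<dots> = (\<integral>x. indicator K x *\<^sub>R (?v x *\<^sub>R h (cmap c (cinv c x))) \<partial>lborel)"
    using Kb by (subst integral_restrict_space) auto
  also have "\<dots> = (\<integral>x. indicator K x *\<^sub>R (h x * ?v x) \<partial>lborel)"
    using K(2) by (intro Bochner_Integration.integral_cong) (auto simp: indicator_def cmap_cinv[OF c] subset_iff)
  also have "\<dots> = integral K (\<lambda>x. h x * ?v x)"
    using set_borel_integral_eq_integral(2)[of K "\<lambda>x. h x * ?v x"] i0
    by (simp add: set_integrable_def set_lebesgue_integral_def)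
  finally show "(\<integral>m. indicator ?B m * h (cmap c m) \<partial>\<mu>) = integral K (\<lambda>x. h x * ?v x)" .
qed

context
  fixes u v :: "'m \<Rightarrow> 'l::euclidean_space" and O' :: "(real^'n) set" and e0 :: "'m \<Rightarrow> real"
  assumes O': "open O'" "O' \<subseteq> cimg c" "K \<subseteq> O'"
    and u: "Ck_on 1 O' (loc c u)" and v: "Ck_on 1 O' (loc c v)"
    and eq: "\<And>m. m \<in> topspace (mtop M) \<Longrightarrow> m \<notin> cinv c ` K \<Longrightarrow> v m = u m"
    and e0: "weak_grad_norm M \<mu> u e0"
begin

lemma continuous_on_grad_norm_K: "continuous_on K (grad_norm M c v)"
proof -
  have "continuous_on O' (grad_sq M c v)"
  proof -
    have d: "Ck_on 0 O' (pd i (loc c v))" for i using v by (simp add: pd_def[abs_def])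
    have "Ck_on 0 O' (\<lambda>x. grad_sq M c v x)"
      unfolding grad_sq_def[OF M c] by (intro Ck_on_sum Ck_on_mult Ck_on_inner d O'(1) Ck_on_subset[OF ginv_smooth[OF M c] O'(2)])
    then show ?thesis by simp
  qed
  then show ?thesis
    unfolding grad_norm_eq[OF M c, abs_def] using continuous_on_subset[OF _ O'(3)]
    by (intro continuous_intros) auto
qed

text \<open>In any chart \<open>v - u\<close> is continuously differentiable, so adding its classical derivatives to weak derivatives of \<open>u\<close>
  gives weak derivatives of \<open>v\<close>. Off the modified set nothing is added. On it, the weak derivatives of \<open>u\<close> are the
  classical ones by uniqueness, hence so are those of \<open>v\<close>, and the classical norm may be computed in the chart \<open>c\<close>.\<close>

lemma weak_grad_norm_modified:
  "weak_grad_norm M \<mu> v (\<lambda>m. if m \<in> cinv c ` K then grad_norm M c v (cmap c m) else e0 m)"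
  (is "weak_grad_norm M \<mu> v ?e")
  unfolding weak_grad_norm_def
proof (intro conjI ballI)
  have "(\<lambda>m. grad_norm M c v (cmap c m)) \<in> borel_measurable (restrict_space \<mu> {m. m \<in> cinv c ` K})"
    using measurable_compose[OF cmap_measurable borel_measurable_continuous_on_restrict[OF continuous_on_grad_norm_K]] by simp
  moreover have "e0 \<in> borel_measurable (restrict_space \<mu> {m. m \<notin> cinv c ` K})"
    using e0 by (auto simp: weak_grad_norm_def intro: measurable_restrict_space1)
  moreover have "{m \<in> space \<mu>. m \<in> cinv c ` K} \<in> sets \<mu>"
    using cinv_K_sets sets.sets_into_space[OF cinv_K_sets] by (simp add: Collect_conj_eq Int_absorb1)
  ultimately show "?e \<in> borel_measurable \<mu>"
    by (subst measurable_If_restrict_space_iff) auto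
next
  fix c' assume c': "c' \<in> atlas M"
  obtain D where D: "\<And>i. weak_pd (cimg c') i (loc c' u) (D i)"
      "AE x in lborel. x \<in> cimg c' \<longrightarrow> e0 (cinv c' x) = sqrt (\<Sum>i\<in>UNIV. \<Sum>j\<in>UNIV. ginv M c' x i j * (D i x \<bullet> D j x))"
    using e0 c' unfolding weak_grad_norm_def by meson
  define w where "w m = v m - u m" for m
  have w0: "w m = 0" if "m \<in> topspace (mtop M)" "m \<notin> cinv c ` K" for m
    using eq[OF that] by (simp add: w_def)
  have wc: "Ck_on 1 (cimg c) (\<lambda>x. w (cinv c x))"
  proof (rule Ck_on_local)
    fix x assume x: "x \<in> cimg c"
    show "\<exists>T. open T \<and> x \<in> T \<and> Ck_on 1 T (\<lambda>x. w (cinv c x))"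
    proof (cases "x \<in> O'")
      case True
      have "Ck_on 1 O' (\<lambda>x. loc c v x - loc c u x)" by (rule Ck_on_diff[OF O'(1) v u])
      then show ?thesis using True O'(1) by (intro exI[of _ O']) (simp add: loc_def w_def)
    next
      case False
      have o: "open (cimg c - K)" using open_cimg[OF M c] K(1) by (simp add: compact_imp_closed open_Diff)
      have "Ck_on 1 (cimg c - K) (\<lambda>x. w (cinv c x))"
      proof (rule Ck_on_cong[OF o _ Ck_on_const[of _ _ 0]])
        fix x assume "x \<in> cimg c - K"
        then show "0 = w (cinv c x)"
          using cinv_in[OF c, of x] cdom_subset[OF c] cmap_cinv[OF c, of x] cinv_image_eq[OF c K(2)]
          by (intro w0[symmetric]) auto
      qed
      then show ?thesis using o x False O'(3) by (intro exI[of _ "cimg c - K"]) auto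
    qed
  qed
  have wc': "Ck_on 1 (cimg c') (\<lambda>x. w (cinv c' x))"
    by (rule Ck_on_all_charts'[OF c c' K wc w0])
  have oc': "open (cimg c')" by (rule open_cimg[OF M c'])
  define D' where "D' i x = D i x + pd i (\<lambda>x. w (cinv c' x)) x" for i x
  have "weak_pd (cimg c') i (\<lambda>x. loc c' u x + w (cinv c' x)) (\<lambda>x. D i x + pd i (\<lambda>x. w (cinv c' x)) x)" for i
    by (rule weak_pd_add[OF D(1) weak_pd_classical[OF oc' wc']])
  then have W: "weak_pd (cimg c') i (loc c' v) (D' i)" for i
    by (simp add: D'_def[abs_def] loc_def w_def o_def)
  let ?O = "cmap c' ` (cdom c' \<inter> cinv c ` O')"
  have oO: "open ?O" by (intro open_cmap_image[OF c'] openin_Int openin_cdom[OF c'] openin_cinv_image[OF c O'(1,2)]) auto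
  have Osub: "?O \<subseteq> cimg c'" by (auto simp: cimg_def)
  have Cl: "Ck_on 1 ?O (loc c' f)" if f: "Ck_on 1 O' (loc c f)" for f :: "'m \<Rightarrow> 'l"
  proof -
    have t: "Ck_on 1 ?O (\<lambda>x. cmap c (cinv c' x))"
      using cinv_image_subset[OF c O'(2)] by (intro Ck_on_subset[OF transition_smooth[OF c' c]]) auto
    have in': "cmap c (cinv c' x) \<in> O'" if "x \<in> ?O" for x
      using that O'(2) by (auto simp: cinv_cmap[OF c'] cmap_cinv[OF c] subset_iff)
    have "Ck_on 1 ?O (\<lambda>x. loc c f (cmap c (cinv c' x)))"
      by (rule Ck_on_compose[OF oO t f in'])
    then show ?thesis
      by (rule Ck_on_cong[OF oO, rotated])
         (use cinv_image_subset[OF c O'(2)] in \<open>auto simp: loc_def cinv_cmap[OF c'] cinv_cmap[OF c] subset_iff\<close>)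
  qed
  have "AE x in lborel. \<forall>i\<in>UNIV. x \<in> ?O \<longrightarrow> D i x = pd i (loc c' u) x"
    by (rule AE_finite_allI)
       (auto intro: weak_pd_unique[OF oO weak_pd_subset[OF D(1) Osub] weak_pd_classical[OF oO Cl[OF u]]])
  with D(2) have "AE x in lborel. x \<in> cimg c' \<longrightarrow>
      ?e (cinv c' x) = sqrt (\<Sum>i\<in>UNIV. \<Sum>j\<in>UNIV. ginv M c' x i j * (D' i x \<bullet> D' j x))"
  proof (eventually_elim, intro impI)
    fix x assume 1: "x \<in> cimg c' \<longrightarrow> e0 (cinv c' x) = sqrt (\<Sum>i\<in>UNIV. \<Sum>j\<in>UNIV. ginv M c' x i j * (D i x \<bullet> D j x))"
      and 2: "\<forall>i\<in>UNIV. x \<in> ?O \<longrightarrow> D i x = pd i (loc c' u) x" and x: "x \<in> cimg c'"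
    define m where "m = cinv c' x"
    have m: "m \<in> cdom c'" "cmap c' m = x" using cinv_in[OF c' x] cmap_cinv[OF c' x] by (auto simp: m_def)
    show "?e (cinv c' x) = sqrt (\<Sum>i\<in>UNIV. \<Sum>j\<in>UNIV. ginv M c' x i j * (D' i x \<bullet> D' j x))"
    proof (cases "m \<in> cinv c ` K")
      case True
      have mO: "m \<in> cinv c ` O'" using True O'(3) by blast
      have xO: "x \<in> ?O" using m mO by blast
      have dl: "loc c' f differentiable (at x)" if f: "Ck_on 1 O' (loc c f)" for f :: "'m \<Rightarrow> 'l"
        by (rule Ck_on_imp_differentiable[OF Cl[OF f] _ xO]) simp
      have wl: "(\<lambda>x. w (cinv c' x)) = (\<lambda>x. loc c' v x - loc c' u x)" by (simp add: w_def loc_def fun_eq_iff)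
      have "D' i x = pd i (loc c' v) x" for i
        using 2 xO dderiv_diff[OF dl[OF v] dl[OF u], of "axis i 1"] by (simp add: D'_def wl pd_def)
      then have "(\<Sum>i\<in>UNIV. \<Sum>j\<in>UNIV. ginv M c' x i j * (D' i x \<bullet> D' j x)) = grad_sq M c' v x"
        by (simp add: grad_sq_def[OF M c'])
      moreover have "grad_sq M c v (cmap c m) = grad_sq M c' v (cmap c' m)"
        by (rule grad_sq_chart[OF c c' _ m(1)]) (use mO cinv_image_subset[OF c O'(2)] dl[OF v] m(2) in auto)
      ultimately show ?thesis using True by (simp add: m_def[symmetric] grad_norm_eq[OF M c] m(2))
    next
      case False
      let ?T = "cmap c' ` (cdom c' \<inter> (topspace (mtop M) - cinv c ` K))"
      have oT: "open ?T"
        by (intro open_cmap_image[OF c'] openin_Int openin_cdom[OF c'] openin_compl_cinv_image[OF c K]) auto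
      have xT: "x \<in> ?T" using False m cdom_subset[OF c'] by blast
      have "dderiv (\<lambda>_. 0) (axis i 1) x = dderiv (\<lambda>x. w (cinv c' x)) (axis i 1) x" for i
        by (rule dderiv_cong[OF oT xT]) (auto simp: cinv_cmap[OF c'] w0)
      then have "D' i x = D i x" for i by (simp add: D'_def pd_def)
      then show ?thesis using False 1 x by (simp add: m_def)
    qed
  qed
  then show "\<exists>D. (\<forall>i. weak_pd (cimg c') i (loc c' v) (D i)) \<and>
        (AE x in lborel. x \<in> cimg c' \<longrightarrow> ?e (cinv c' x) = sqrt (\<Sum>i\<in>UNIV. \<Sum>j\<in>UNIV. ginv M c' x i j * (D i x \<bullet> D j x)))"
    using W by blast
qed

text \<open>The first summand is the same for all \<open>v\<close> that differ from \<open>u\<close> only in \<open>K\<close>.\<close>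

lemma energy_modified:
  assumes p: "p > 0" and int: "integrable \<mu> (\<lambda>m. \<bar>e0 m\<bar> powr p)"
  shows "energy M \<mu> p v = (\<integral>m. indicator (- cinv c ` K) m * \<bar>e0 m\<bar> powr p \<partial>\<mu>)
    + integral K (\<lambda>x. grad_norm M c v x powr p * vol_density M c x)"
proof -
  let ?B = "cinv c ` K"
  let ?e = "\<lambda>m. if m \<in> ?B then grad_norm M c v (cmap c m) else e0 m"
  have some: "weak_grad_norm M \<mu> v (SOME e. weak_grad_norm M \<mu> v e)"
    by (rule someI[where P = "weak_grad_norm M \<mu> v", OF weak_grad_norm_modified])
  have ae: "AE m in \<mu>. (SOME e. weak_grad_norm M \<mu> v e) m = ?e m"
    by (rule weak_grad_norm_unique[OF some weak_grad_norm_modified])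
  have gpos: "0 \<le> grad_norm M c v x" if "x \<in> cimg c" for x
    using grad_sq_nonneg[OF M c that] by (simp add: grad_norm_eq[OF M c])
  have cont: "continuous_on K (\<lambda>x. grad_norm M c v x powr p)"
    using gpos K(2) p by (intro continuous_on_powr' continuous_on_grad_norm_K continuous_intros) auto
  note I = integral_over_chart[OF cont]
  have i2: "integrable \<mu> (\<lambda>m. indicator (- ?B) m * \<bar>e0 m\<bar> powr p)"
  proof -
    have "integrable \<mu> (\<lambda>m. indicator (space \<mu> - ?B) m *\<^sub>R (\<bar>e0 m\<bar> powr p))"
      using cinv_K_sets by (intro integrable_mult_indicator int) auto
    then show ?thesis
      by (rule Bochner_Integration.integrable_cong[THEN iffD1, OF refl, rotated]) (auto simp: indicator_def)
  qed
  have m1: "(SOME e. weak_grad_norm M \<mu> v e) \<in> borel_measurable \<mu>" and m2: "?e \<in> borel_measurable \<mu>"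
    using some weak_grad_norm_modified by (auto simp: weak_grad_norm_def)
  have "energy M \<mu> p v = (\<integral>m. \<bar>?e m\<bar> powr p \<partial>\<mu>)"
    unfolding energy_def
    by (rule integral_cong_AE) (use m1 m2 ae in \<open>auto elim!: eventually_mono\<close>)
  also have "\<dots> = (\<integral>m. indicator (- ?B) m * \<bar>e0 m\<bar> powr p + indicator ?B m * grad_norm M c v (cmap c m) powr p \<partial>\<mu>)"
    by (rule Bochner_Integration.integral_cong)
       (use gpos K(2) in \<open>auto simp: indicator_def cmap_cinv[OF c] subset_iff\<close>)
  also have "\<dots> = (\<integral>m. indicator (- ?B) m * \<bar>e0 m\<bar> powr p \<partial>\<mu>) + (\<integral>m. indicator ?B m * grad_norm M c v (cmap c m) powr p \<partial>\<mu>)"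
    by (rule Bochner_Integration.integral_add[OF i2 I(1)])
  finally show ?thesis unfolding I(2) .
qed

end
end
end
end

section \<open>The first variation\<close>

text \<open>The functions \<open>X i \<bullet> \<xi>\<close>, extended by zero, have compact support, so their derivatives have integral zero.\<close>

lemma integral_by_parts_box:
  fixes X :: "'n::finite \<Rightarrow> real^'n \<Rightarrow> 'l::euclidean_space" and \<xi> :: "real^'n \<Rightarrow> 'l"
  assumes V: "open V" "cbox a b \<subseteq> V" and K: "compact K" "K \<subseteq> cbox a b"
    and X: "\<And>i. Ck_on 1 V (X i)" and \<xi>: "Ck_on 1 V \<xi>" "\<And>x. x \<in> V \<Longrightarrow> x \<notin> K \<Longrightarrow> \<xi> x = 0"
  shows "integral (cbox a b) (\<lambda>x. \<Sum>i\<in>UNIV. X i x \<bullet> pd i \<xi> x)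
    = - integral (cbox a b) (\<lambda>x. \<Sum>i\<in>UNIV. pd i (X i) x \<bullet> \<xi> x)"
proof -
  have clK: "closed K" using K(1) by (rule compact_imp_closed)
  have KV: "K \<subseteq> V" using K V by auto
  define g where "g i x = (if x \<in> V then X i x \<bullet> \<xi> x else 0)" for i x
  have g: "Ck_on 1 UNIV (g i)" for i unfolding g_def
    by (rule Ck_on_zero_extend[OF V(1) clK KV Ck_on_inner[OF V(1) X \<xi>(1)]]) (use \<xi>(2) in auto)
  have g0: "g i x = 0" if "x \<notin> K" for i x using \<xi>(2) that by (auto simp: g_def)
  have pg0: "pd i (g i) x = 0" if "x \<notin> K" for i x
    unfolding pd_def by (rule dderiv_zero_outside[OF clK g0 that])
  have cpg: "continuous_on UNIV (pd i (g i))" for i using g[of i] by (simp add: pd_def)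
  have pgV: "pd i (g i) x = X i x \<bullet> pd i \<xi> x + pd i (X i) x \<bullet> \<xi> x" if "x \<in> V" for i x
  proof -
    have d: "X i differentiable (at x)" "\<xi> differentiable (at x)"
      using Ck_on_imp_differentiable[OF X _ that] Ck_on_imp_differentiable[OF \<xi>(1) _ that] by auto
    have "dderiv (\<lambda>x. X i x \<bullet> \<xi> x) (axis i 1) x = dderiv (g i) (axis i 1) x"
      by (rule dderiv_cong[OF V(1) that]) (auto simp: g_def intro!: differentiable_inner d)
    then show ?thesis using dderiv_inner_both[OF d] by (simp add: pd_def)
  qed
  have "integral (cbox a b) (pd i (g i)) = 0" for i
  proof -
    have "integrable lborel (pd i (g i))"
      by (rule integrable_compact_support[OF continuous_on_subset[OF cpg] K(1) pg0]) auto
    then have "integral UNIV (pd i (g i)) = (\<integral>x. pd i (g i) x \<partial>lborel)" by (rule integral_lborel)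
    also have "\<dots> = 0" unfolding pd_def by (rule integral_dderiv_compact_support[OF g K(1) g0])
    also have "integral UNIV (pd i (g i)) = integral UNIV (\<lambda>x. if x \<in> cbox a b then pd i (g i) x else 0)"
      by (rule integral_cong) (use pg0 K(2) in auto)
    finally show ?thesis by (simp add: integral_restrict_UNIV)
  qed
  moreover have "pd i (g i) integrable_on cbox a b" for i
    by (rule integrable_continuous[OF continuous_on_subset[OF cpg]]) auto
  ultimately have "integral (cbox a b) (\<lambda>x. \<Sum>i\<in>UNIV. pd i (g i) x) = 0"
    by (subst integral_sum) auto
  moreover have "integral (cbox a b) (\<lambda>x. \<Sum>i\<in>UNIV. pd i (g i) x) =
     integral (cbox a b) (\<lambda>x. (\<Sum>i\<in>UNIV. X i x \<bullet> pd i \<xi> x) + (\<Sum>i\<in>UNIV. pd i (X i) x \<bullet> \<xi> x))"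
    by (rule integral_cong) (use V(2) in \<open>auto simp: pgV sum.distrib\<close>)
  moreover have "integral (cbox a b) (\<lambda>x. (\<Sum>i\<in>UNIV. X i x \<bullet> pd i \<xi> x) + (\<Sum>i\<in>UNIV. pd i (X i) x \<bullet> \<xi> x))
     = integral (cbox a b) (\<lambda>x. \<Sum>i\<in>UNIV. X i x \<bullet> pd i \<xi> x) + integral (cbox a b) (\<lambda>x. \<Sum>i\<in>UNIV. pd i (X i) x \<bullet> \<xi> x)"
  proof (rule integral_add)
    have c: "continuous_on V (X i)" "continuous_on V \<xi>" "continuous_on V (pd i (X i))" "continuous_on V (pd i \<xi>)" for i
      using Ck_on_imp_continuous_on[OF X[of i]] Ck_on_imp_continuous_on[OF \<xi>(1)] X[of i] \<xi>(1)
      by (simp_all add: pd_def[abs_def])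
    show "(\<lambda>x. \<Sum>i\<in>UNIV. X i x \<bullet> pd i \<xi> x) integrable_on cbox a b"
      "(\<lambda>x. \<Sum>i\<in>UNIV. pd i (X i) x \<bullet> \<xi> x) integrable_on cbox a b"
      by (intro integrable_continuous continuous_intros continuous_on_subset[OF c(1) V(2)] continuous_on_subset[OF c(2) V(2)]
         continuous_on_subset[OF c(3) V(2)] continuous_on_subset[OF c(4) V(2)])+
  qed
  ultimately show ?thesis by linarith
qed

text \<open>The integrand is only known to be regular near \<open>{0} \<times> cbox a b\<close>. By compactness this neighbourhood contains a
  whole strip, in which the Leibniz rule applies.\<close>

lemma parametric_integral_derivative:
  fixes f :: "real \<times> 'a::euclidean_space \<Rightarrow> real"
  assumes Z: "open Z" "Ck_on 1 Z f" and K: "{0} \<times> cbox a b \<subseteq> Z"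
  obtains e where "e > 0" "\<And>t x. \<bar>t\<bar> < e \<Longrightarrow> x \<in> cbox a b \<Longrightarrow> (t, x) \<in> Z"
    "((\<lambda>t. integral (cbox a b) (\<lambda>x. f (t, x))) has_real_derivative
       integral (cbox a b) (\<lambda>x. dderiv f (1, 0) (0, x))) (at 0)"
proof -
  obtain X0 where X0: "0 \<in> X0" "open X0" "X0 \<times> cbox a b \<subseteq> Z"
    using Elementary_Topology.tube_lemma[OF compact_cbox Z(1) K] by blast
  then obtain e where e: "e > 0" "ball 0 e \<subseteq> X0" using open_contains_ball by blast
  have in': "(t, x) \<in> Z" if "t \<in> ball 0 e" "x \<in> cbox a b" for t x using X0 e that by auto
  have cf: "continuous_on Z f" "continuous_on Z (dderiv f (1, 0))"
    using Ck_on_imp_continuous_on[OF Z(2)] Z(2) by auto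
  have "((\<lambda>t. integral (cbox a b) (\<lambda>x. f (t, x))) has_field_derivative
       integral (cbox a b) (\<lambda>x. dderiv f (1, 0) (0, x))) (at 0 within ball 0 e)"
  proof (rule leibniz_rule_field_derivative)
    fix t x assume tx: "t \<in> ball (0::real) e" "x \<in> cbox a b"
    have d: "f differentiable (at (t, x))" using Ck_on_imp_differentiable[OF Z(2) _ in'[OF tx]] by simp
    have "((\<lambda>s. f ((0, x) + s *\<^sub>R (1, 0))) has_vector_derivative dderiv f (1, 0) ((0, x) + t *\<^sub>R (1, 0))) (at t)"
      by (rule has_vector_derivative_along_line) (use d in simp)
    then have "((\<lambda>s. f (s, x)) has_vector_derivative dderiv f (1, 0) (t, x)) (at t)" by simp
    then show "((\<lambda>t. f (t, x)) has_field_derivative dderiv f (1, 0) (t, x)) (at t within ball 0 e)"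
      by (simp add: has_real_derivative_iff_has_vector_derivative has_vector_derivative_at_within)
  next
    fix t assume "t \<in> ball (0::real) e"
    then show "(\<lambda>x. f (t, x)) integrable_on cbox a b"
      using in' by (intro integrable_continuous continuous_on_compose2[OF cf(1)] continuous_intros) auto
  next
    show "continuous_on (ball 0 e \<times> cbox a b) (\<lambda>(t, x). dderiv f (1, 0) (t, x))"
      using continuous_on_subset[OF cf(2), of "ball 0 e \<times> cbox a b"] in' by (simp add: case_prod_unfold subset_iff)
  qed (use e in auto)
  moreover have "at (0::real) within ball 0 e = at 0" using e(1) by (intro at_within_open) auto
  ultimately have "((\<lambda>t. integral (cbox a b) (\<lambda>x. f (t, x))) has_real_derivative
       integral (cbox a b) (\<lambda>x. dderiv f (1, 0) (0, x))) (at 0)"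
    by (simp only:)
  then show ?thesis using e(1) in' by (intro that[of e]) auto
qed

text \<open>In the straightened picture \<open>y\<close> moves with constant velocity in the direction \<open>v\<close>, with a speed that is cut off both
  in the domain, near \<open>x0\<close>, and in the target, near \<open>y0\<close>. For \<open>v\<close> in the subspace \<open>S\<close> this preserves \<open>N\<close>.\<close>

definition slice_variation ::
  "('m, 'n::finite) chart \<Rightarrow> real^'n \<Rightarrow> real \<Rightarrow> 'l::euclidean_space set \<Rightarrow> ('l \<Rightarrow> 'l) \<Rightarrow> ('l \<Rightarrow> 'l) \<Rightarrow> 'l \<Rightarrow> real \<Rightarrow> 'l
     \<Rightarrow> real \<Rightarrow> 'm \<Rightarrow> 'l \<Rightarrow> 'l" where
  "slice_variation c x0 r V \<Phi> \<Psi> y0 R v t m y =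
     (if m \<in> cdom c \<and> y \<in> V then \<Psi> (\<Phi> y + (t * bump x0 r (cmap c m) * bump y0 (R / 2) y) *\<^sub>R v) else y)"

text \<open>Since the cut-offs are at most \<open>1\<close>, the displacement is shorter than \<open>\<delta>\<close>, and \<open>\<Phi> y\<close> has distance less than \<open>\<delta>\<close> from
  the centre \<open>\<Phi> y0\<close>.\<close>

lemma slice_variation_stays:
  assumes sc: "slice_chart d N V W \<Phi> \<Psi> S"
    and R: "R > 0" "ball y0 R \<subseteq> V" and \<delta>: "ball (\<Phi> y0) (2 * \<delta>) \<subseteq> W" "\<And>y. y \<in> ball y0 R \<Longrightarrow> dist (\<Phi> y0) (\<Phi> y) < \<delta>"
    and \<epsilon>: "\<bar>t\<bar> * norm v < \<delta>" and y: "y \<in> ball y0 R"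
  shows "\<Phi> y + (t * bump x0 r x * bump y0 (R / 2) y) *\<^sub>R v \<in> W"
proof -
  have b: "\<bar>bump x0 r x * bump y0 (R / 2) y\<bar> \<le> 1"
    using mult_le_one[OF bump_le_1[of x0 r x] bump_nonneg bump_le_1[of y0 "R/2" y]] bump_nonneg[of x0 r x] bump_nonneg[of y0 "R/2" y]
    by (simp add: abs_mult)
  have "norm ((t * bump x0 r x * bump y0 (R / 2) y) *\<^sub>R v) = \<bar>bump x0 r x * bump y0 (R / 2) y\<bar> * (\<bar>t\<bar> * norm v)"
    by (simp add: abs_mult ac_simps)
  also have "\<dots> \<le> 1 * (\<bar>t\<bar> * norm v)" using b by (intro mult_right_mono) auto
  also have "\<dots> < \<delta>" using \<epsilon> by simp
  finally have 1: "norm ((t * bump x0 r x * bump y0 (R / 2) y) *\<^sub>R v) < \<delta>" .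
  have "dist (\<Phi> y0) (\<Phi> y + (t * bump x0 r x * bump y0 (R / 2) y) *\<^sub>R v)
     \<le> dist (\<Phi> y0) (\<Phi> y) + dist (\<Phi> y) (\<Phi> y + (t * bump x0 r x * bump y0 (R / 2) y) *\<^sub>R v)"
    by (rule dist_triangle)
  also have "\<dots> < \<delta> + \<delta>" using 1 \<delta>(2)[OF y] by (intro add_strict_mono) (simp_all add: dist_norm)
  finally show ?thesis using \<delta>(1) by auto
qed

text \<open>Smoothness holds on two overlapping regions: in the ball of radius \<open>R\<close> the formula is a composition of smooth
  maps, and outside the ball of radius \<open>R / 2\<close> the deformation is trivial. The support in the target is a closed part
  of a ball inside the slice chart, hence compact although \<open>N\<close> need not be closed.\<close>

lemma slice_variation_variation:
  fixes M :: "('m, 'n::finite) manifold" and N :: "'l::euclidean_space set"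
  assumes M: "riemannian_manifold M" and c: "c \<in> atlas M" and sc: "slice_chart d N V W \<Phi> \<Psi> S"
    and R: "R > 0" "ball y0 R \<subseteq> V" and \<delta>: "ball (\<Phi> y0) (2 * \<delta>) \<subseteq> W" "\<And>y. y \<in> ball y0 R \<Longrightarrow> dist (\<Phi> y0) (\<Phi> y) < \<delta>"
    and v: "v \<in> S" and r: "r > 0" "cball x0 r \<subseteq> cimg c"
  shows "variation M N (slice_variation c x0 r V \<Phi> \<Psi> y0 R v)"
proof -
  let ?F = "slice_variation c x0 r V \<Phi> \<Psi> y0 R v"
  have \<delta>0: "\<delta> > 0" using \<delta>(2)[of y0] R by simp
  define \<epsilon> where "\<epsilon> = \<delta> / (norm v + 1)"
  have nv: "norm v + 1 > 0" by (simp add: add_nonneg_pos)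
  have \<epsilon>: "\<epsilon> > 0" using \<delta>0 nv by (simp add: \<epsilon>_def)
  define I where "I = {-\<epsilon><..<\<epsilon>}"
  have It: "\<bar>t\<bar> * norm v < \<delta>" if "t \<in> I" for t
  proof -
    have "\<bar>t\<bar> * norm v \<le> \<epsilon> * norm v" using that by (intro mult_right_mono) (auto simp: I_def)
    also have "\<dots> < \<epsilon> * (norm v + 1)" using \<epsilon> by simp
    also have "\<dots> = \<delta>" using nv by (simp add: \<epsilon>_def)
    finally show ?thesis .
  qed
  have R2: "R / 2 > 0" using R by simp
  have inW: "\<Phi> y + (t * bump x0 r x * bump y0 (R / 2) y) *\<^sub>R v \<in> W" if "t \<in> I" "y \<in> ball y0 R" for t x y
    by (rule slice_variation_stays[OF sc R \<delta> It[OF that(1)] that(2)])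
  have trivial: "?F t m y = y" if "t * bump x0 r (cmap c m) * bump y0 (R / 2) y = 0" for t m y
    using slice_Psi_Phi[OF sc] unfolding slice_variation_def that by simp
  have smooth: "Ck_on k (I \<times> cimg c' \<times> UNIV) (\<lambda>(t, x, y). ?F t (cinv c' x) y)" if c': "c' \<in> atlas M" for k c'
  proof -
    define w where "w m s = ?F (fst s) m (snd s) - snd s" for m and s :: "real \<times> 'l"
    have Q: "open (I \<times> (UNIV :: 'l set))" by (intro open_Times) (auto simp: I_def)
    have oc: "open (cimg c)" by (rule open_cimg[OF M c])
    have chart: "Ck_on k (cimg c \<times> (I \<times> UNIV)) (\<lambda>(x, s). w (cinv c x) s)"
    proof (rule Ck_on_local)
      fix z assume z: "z \<in> cimg c \<times> (I \<times> (UNIV :: 'l set))"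
      show "\<exists>T. open T \<and> z \<in> T \<and> Ck_on k T (\<lambda>(x, s). w (cinv c x) s)"
      proof (cases "snd (snd z) \<in> ball y0 R")
        case True
        let ?T = "cimg c \<times> (I \<times> ball y0 R)"
        have T: "open ?T" by (intro open_Times oc) (auto simp: I_def)
        have l: "Ck_on k ?T (\<lambda>z. fst (snd z))" "Ck_on k ?T (\<lambda>z. snd (snd z))"
          by (rule Ck_on_linear, intro bounded_linear_intros)+
        have comp: "Ck_on k ?T (\<lambda>z. \<Psi> (\<Phi> (snd (snd z)) + (fst (snd z) * bump x0 r (fst z) * bump y0 (R / 2) (snd (snd z))) *\<^sub>R v) - snd (snd z))"
        proof (intro Ck_on_diff Ck_on_compose[OF T _ slice_smooth(2)[OF sc]] Ck_on_add Ck_on_scaleR Ck_on_mult Ck_on_const T l)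
          show "Ck_on k ?T (\<lambda>z. \<Phi> (snd (snd z)))"
            by (rule Ck_on_compose_linear[OF _ T slice_smooth(1)[OF sc]]) (use R in \<open>auto intro!: bounded_linear_intros\<close>)
          show "Ck_on k ?T (\<lambda>z. bump x0 r (fst z))"
            by (rule Ck_on_compose_linear[OF _ T Ck_on_bump[OF open_UNIV]]) (auto intro!: bounded_linear_intros)
          show "Ck_on k ?T (\<lambda>z. bump y0 (R / 2) (snd (snd z)))"
            by (rule Ck_on_compose_linear[OF _ T Ck_on_bump[OF open_UNIV]]) (auto intro!: bounded_linear_intros)
          show "\<And>z. z \<in> ?T \<Longrightarrow> \<Phi> (snd (snd z)) + (fst (snd z) * bump x0 r (fst z) * bump y0 (R / 2) (snd (snd z))) *\<^sub>R v \<in> W"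
            using inW by auto
        qed
        have "Ck_on k ?T (\<lambda>(x, s). w (cinv c x) s)"
          by (rule Ck_on_cong[OF T _ comp])
            (use R in \<open>auto simp: w_def slice_variation_def cinv_in[OF M c] cmap_cinv[OF M c] subset_iff\<close>)
        then show ?thesis using T z True by (intro exI[of _ ?T]) (auto simp: mem_Times_iff)
      next
        case False
        let ?T = "cimg c \<times> (I \<times> (- cball y0 (R / 2)))"
        have T: "open ?T" by (intro open_Times oc) (auto simp: I_def)
        have "Ck_on k ?T (\<lambda>(x, s). w (cinv c x) s)"
        proof (rule Ck_on_cong[OF T _ Ck_on_const[of _ _ 0]])
          fix z assume "z \<in> ?T"
          then have "bump y0 (R / 2) (snd (snd z)) = 0" using R2 by (intro bump_eq_0) auto
          then show "0 = (case z of (x, s) \<Rightarrow> w (cinv c x) s)"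
            by (auto simp: w_def case_prod_unfold trivial)
        qed
        then show ?thesis using T z False R by (intro exI[of _ ?T]) (auto simp: mem_Times_iff)
      qed
    qed
    have "Ck_on k (cimg c' \<times> (I \<times> UNIV)) (\<lambda>(x, s). w (cinv c' x) s)"
    proof (rule Ck_on_all_charts[OF M c c' compact_cball r(2) Q chart])
      fix m s assume "m \<in> topspace (mtop M)" "m \<notin> cinv c ` cball x0 r" "s \<in> I \<times> (UNIV :: 'l set)"
      then have "m \<in> cdom c \<Longrightarrow> bump x0 r (cmap c m) = 0"
        using cinv_image_eq[OF M c r(2)] r(1) by (intro bump_eq_0) auto
      then have "?F (fst s) m (snd s) = snd s"
        by (cases "m \<in> cdom c") (simp_all only: trivial mult_zero_left mult_zero_right, simp add: slice_variation_def)
      then show "w m s = 0" by (simp add: w_def)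
    qed
    moreover have T: "open (I \<times> cimg c' \<times> (UNIV :: 'l set))"
      by (intro open_Times open_cimg[OF M c']) (auto simp: I_def)
    ultimately have "Ck_on k (I \<times> cimg c' \<times> UNIV) (\<lambda>z. (\<lambda>(x, s). w (cinv c' x) s) (fst (snd z), (fst z, snd (snd z))))"
      by (intro Ck_on_compose_linear[where f = "\<lambda>z. (fst (snd z), (fst z, snd (snd z)))"] bounded_linear_intros) auto
    then have "Ck_on k (I \<times> cimg c' \<times> UNIV) (\<lambda>z. (\<lambda>(x, s). w (cinv c' x) s) (fst (snd z), (fst z, snd (snd z))) + snd (snd z))"
      by (rule Ck_on_add[OF T]) (rule Ck_on_linear, intro bounded_linear_intros)
    then show ?thesis
      by (rule Ck_on_cong[OF T, rotated]) (auto simp: w_def)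
  qed
  have stays: "?F t m y \<in> N" if "t \<in> I" "y \<in> N" for t m y
  proof (cases "m \<in> cdom c \<and> y \<in> V \<and> y \<in> ball y0 R")
    case True
    have "\<Phi> y + (t * bump x0 r (cmap c m) * bump y0 (R / 2) y) *\<^sub>R v \<in> S"
      using slice_Phi_S[OF sc] slice_subspace[OF sc] True that v by (intro subspace_add subspace_scale) auto
    then show ?thesis using slice_Psi_N[OF sc inW] True that by (simp add: slice_variation_def)
  next
    case False
    have "?F t m y = y"
    proof (cases "y \<in> ball y0 R")
      case True
      then show ?thesis using False by (auto simp: slice_variation_def)
    next
      case False
      then have "bump y0 (R / 2) y = 0" using R2 R by (intro bump_eq_0) auto
      then show ?thesis by (simp add: trivial)
    qed
    then show ?thesis using that by simp
  qed
  have compactC: "compact (N \<inter> cball y0 (R / 2))"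
  proof -
    have sub: "cball y0 (R / 2) \<subseteq> V" using R by auto
    have cl: "closed (cball y0 (R / 2) \<inter> \<Phi> -` S)"
      using Ck_on_imp_continuous_on[OF slice_smooth(1)[OF sc, of 0]] sub slice_subspace[OF sc]
      by (intro continuous_closed_preimage closed_cball closed_subspace) (auto intro: continuous_on_subset)
    have "N \<inter> cball y0 (R / 2) = cball y0 (R / 2) \<inter> (cball y0 (R / 2) \<inter> \<Phi> -` S)"
    proof (intro equalityI subsetI)
      fix y assume "y \<in> N \<inter> cball y0 (R / 2)"
      then show "y \<in> cball y0 (R / 2) \<inter> (cball y0 (R / 2) \<inter> \<Phi> -` S)" using slice_Phi_S[OF sc, of y] sub by auto
    next
      fix y assume y: "y \<in> cball y0 (R / 2) \<inter> (cball y0 (R / 2) \<inter> \<Phi> -` S)"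
      then have "y \<in> V" using sub by auto
      then have "\<Psi> (\<Phi> y) \<in> N" using y by (intro slice_Psi_N[OF sc] slice_Phi_in[OF sc]) auto
      then show "y \<in> N \<inter> cball y0 (R / 2)" using y slice_Psi_Phi[OF sc \<open>y \<in> V\<close>] by auto
    qed
    then show ?thesis using compact_Int_closed[OF compact_cball cl, of y0 "R / 2"] by simp
  qed
  show ?thesis
    unfolding variation_def
  proof (rule exI[of _ \<epsilon>], intro conjI)
    show "\<epsilon> > 0" by (rule \<epsilon>)
    show "\<forall>c\<in>atlas M. smooth_on ({- \<epsilon><..<\<epsilon>} \<times> cimg c \<times> UNIV) (\<lambda>(t, x, y). ?F t (cinv c x) y)"
      using smooth unfolding smooth_on_def I_def by blast
    show "\<forall>x\<in>topspace (mtop M). \<forall>y\<in>N. ?F 0 x y = y \<and> (\<forall>t\<in>{- \<epsilon><..<\<epsilon>}. ?F t x y \<in> N)"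
      using stays trivial[of 0] by (auto simp: I_def)
    show "\<exists>K C. compactin (mtop M) K \<and> compact C \<and> C \<subseteq> N \<and>
        (\<forall>t\<in>{- \<epsilon><..<\<epsilon>}. \<forall>x\<in>topspace (mtop M). \<forall>y\<in>N. (x, y) \<notin> K \<times> C \<longrightarrow> ?F t x y = y)"
    proof (intro exI conjI ballI impI)
      show "compactin (mtop M) (cinv c ` cball x0 r)" by (rule compactin_cinv_image[OF M c compact_cball r(2)])
      show "compact (N \<inter> cball y0 (R / 2))" by (rule compactC)
      fix t m y assume "y \<in> N" "(m, y) \<notin> cinv c ` cball x0 r \<times> (N \<inter> cball y0 (R / 2))"
      then consider "m \<notin> cinv c ` cball x0 r" | "y \<notin> cball y0 (R / 2)" by auto
      then show "?F t m y = y"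
      proof cases
        case 1
        then have "m \<in> cdom c \<Longrightarrow> bump x0 r (cmap c m) = 0"
          using cinv_image_eq[OF M c r(2)] r(1) by (intro bump_eq_0) auto
        then show ?thesis
          by (cases "m \<in> cdom c") (simp_all only: trivial mult_zero_left mult_zero_right, simp add: slice_variation_def)
      next
        case 2
        then have "bump y0 (R / 2) y = 0" using R2 by (intro bump_eq_0) auto
        then show ?thesis by (simp add: trivial)
      qed
    qed auto
  qed
qed


text \<open>The product rule, with the two equal terms from the symmetry of \<open>G\<close> collected. Exchanging the mixed second
  derivatives of \<open>U2\<close> turns the time derivative of the gradient into the gradient of the velocity field, which is the
  form needed for integration by parts.\<close>

lemma dderiv_density:
  fixes U2 :: "real \<times> (real^'n::finite) \<Rightarrow> 'l::euclidean_space" and G :: "real^'n \<Rightarrow> 'n \<Rightarrow> 'n \<Rightarrow> real" and vol :: "real^'n \<Rightarrow> real"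
  assumes Z: "open Z" and U2: "Ck_on 2 Z U2"
    and O': "open O'" "\<And>z. z \<in> Z \<Longrightarrow> snd z \<in> O'"
    and G: "\<And>i j. Ck_on 1 O' (\<lambda>x. G x i j)" "\<And>x i j. x \<in> O' \<Longrightarrow> G x i j = G x j i" and vol: "Ck_on 1 O' vol"
    and E: "E = (\<lambda>z. \<Sum>i\<in>UNIV. \<Sum>j\<in>UNIV. G (snd z) i j * (dderiv U2 (0, axis i 1) z \<bullet> dderiv U2 (0, axis j 1) z))"
    and Epos: "\<And>z. z \<in> Z \<Longrightarrow> E z > 0"
  shows density_Ck: "Ck_on 1 Z (\<lambda>z. E z powr (p / 2) * vol (snd z))"
    and density_dderiv: "z \<in> Z \<Longrightarrow> dderiv (\<lambda>z. E z powr (p / 2) * vol (snd z)) (1, 0) z =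
      p * (\<Sum>i\<in>UNIV. (vol (snd z) *\<^sub>R (sqrt (E z) powr (p - 2)) *\<^sub>R (\<Sum>j\<in>UNIV. G (snd z) i j *\<^sub>R dderiv U2 (0, axis j 1) z))
         \<bullet> dderiv (dderiv U2 (1, 0)) (0, axis i 1) z)"
proof -
  let ?a = "\<lambda>i. dderiv U2 (0, axis i 1)"
  have a: "Ck_on 1 Z (?a i)" for i using U2 by (intro Ck_on_dderiv) (simp add: numeral_2_eq_2)
  have snd': "Ck_on 1 Z (\<lambda>z. g (snd z))" if "Ck_on 1 O' g" for g :: "real^'n \<Rightarrow> real"
    by (rule Ck_on_compose_linear[OF bounded_linear_snd Z that O'(2)])
  have E1: "Ck_on 1 Z E" unfolding E by (intro Ck_on_sum Ck_on_mult Ck_on_inner Z a snd' G)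
  show "Ck_on 1 Z (\<lambda>z. E z powr (p / 2) * vol (snd z))"
    by (intro Ck_on_mult Ck_on_powr_compose Z E1 Epos snd' vol)
  assume z: "z \<in> Z"
  have d: "?a i differentiable (at z)" "E differentiable (at z)" "(\<lambda>z. G (snd z) i j) differentiable (at z)"
     "(\<lambda>z. vol (snd z)) differentiable (at z)" for i j
    using Ck_on_imp_differentiable[OF a _ z] Ck_on_imp_differentiable[OF E1 _ z] Ck_on_imp_differentiable[OF snd'[OF G(1)] _ z]
      Ck_on_imp_differentiable[OF snd'[OF vol] _ z] by auto
  have const: "dderiv (\<lambda>z. g (snd z)) (1, 0) z = 0" if "Ck_on 1 O' g" for g :: "real^'n \<Rightarrow> real"
  proof -
    have dg: "g differentiable (at (snd z))" using Ck_on_imp_differentiable[OF that _ O'(2)[OF z]] by simp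
    have "dderiv snd (1, 0 :: real^'n) z = 0"
      by (subst dderiv_eqI[OF bounded_linear_imp_has_derivative[OF bounded_linear_snd]]) simp
    moreover have "snd differentiable (at z)" by (rule bounded_linear_imp_differentiable[OF bounded_linear_snd])
    ultimately show ?thesis
      using dderiv_compose[of snd z g "(1, 0)"] dg linear_0[OF linear_frechet_derivative[OF dg]] by simp
  qed
  define b where "b i = dderiv (?a i) (1, 0) z" for i
  have bi: "b i = dderiv (dderiv U2 (1, 0)) (0, axis i 1) z" for i
    unfolding b_def by (rule dderiv_commute[OF Z z U2])
  have "dderiv E (1, 0) z = (\<Sum>i\<in>UNIV. \<Sum>j\<in>UNIV. G (snd z) i j * (?a i z \<bullet> b j + b i \<bullet> ?a j z))"
    unfolding E b_def
    by (simp add: dderiv_sum dderiv_mult dderiv_inner_both d const[OF G(1)] differentiable_sum differentiable_mult differentiable_inner)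
  also have "\<dots> = (\<Sum>i\<in>UNIV. \<Sum>j\<in>UNIV. G (snd z) i j * (?a i z \<bullet> b j)) + (\<Sum>i\<in>UNIV. \<Sum>j\<in>UNIV. G (snd z) i j * (b i \<bullet> ?a j z))"
    by (simp add: distrib_left sum.distrib)
  also have "(\<Sum>i\<in>UNIV. \<Sum>j\<in>UNIV. G (snd z) i j * (?a i z \<bullet> b j)) = (\<Sum>i\<in>UNIV. \<Sum>j\<in>UNIV. G (snd z) i j * (b i \<bullet> ?a j z))"
    by (subst sum.swap) (simp add: inner_commute G(2)[OF O'(2)[OF z]])
  finally have dE: "dderiv E (1, 0) z = 2 * (\<Sum>i\<in>UNIV. \<Sum>j\<in>UNIV. G (snd z) i j * (b i \<bullet> ?a j z))" by simp
  have pw: "(\<lambda>z. E z powr (p / 2)) differentiable (at z)"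
    using Ck_on_imp_differentiable[OF Ck_on_powr_compose[OF Z E1 Epos] _ z] by simp
  have "dderiv (\<lambda>z. E z powr (p / 2) * vol (snd z)) (1, 0) z = (p / 2 * E z powr (p / 2 - 1) * dderiv E (1, 0) z) * vol (snd z)"
    using dderiv_mult[OF pw d(4), of "(1, 0)"] const[OF vol] dderiv_powr[OF d(2) Epos[OF z], of "p / 2" "(1, 0)"] by simp
  also have "E z powr (p / 2 - 1) = sqrt (E z) powr (p - 2)"
    using Epos[OF z] by (simp add: powr_half_sqrt[symmetric] powr_powr diff_divide_distrib)
  finally show "dderiv (\<lambda>z. E z powr (p / 2) * vol (snd z)) (1, 0) z =
      p * (\<Sum>i\<in>UNIV. (vol (snd z) *\<^sub>R (sqrt (E z) powr (p - 2)) *\<^sub>R (\<Sum>j\<in>UNIV. G (snd z) i j *\<^sub>R ?a j z))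
         \<bullet> dderiv (dderiv U2 (1, 0)) (0, axis i 1) z)"
    by (simp add: dE bi[symmetric] inner_sum_left sum_distrib_left sum_distrib_right inner_commute[of _ "dderiv U2 _ _"] ac_simps)
qed


text \<open>Suppose that the p-Laplacian has a nonzero component along a tangent vector \<open>s\<close> of \<open>N\<close>. Transported to the points
  near \<open>x0\<close>, the vector \<open>s\<close> becomes a field \<open>\<zeta>\<close>, and the pairing \<open>f0\<close> of the p-Laplacian with \<open>\<zeta>\<close> has a constant sign
  on a box around \<open>x0\<close>. The first variation along \<open>s\<close>, after integration by parts, is a multiple of the integral of
  \<open>\<kappa> f0\<close>, where the cut-off \<open>\<kappa>\<close> is nonnegative and positive at \<open>x0\<close>. This cannot vanish.\<close>

lemma p_harmonic_imp_tension_zero: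
  fixes M :: "('m, 'n::finite) manifold" and N :: "'l::euclidean_space set"
  assumes M: "riemannian_manifold M" and c: "c \<in> atlas M" and N: "embedded_submanifold d N" and p: "p > 1"
    and ph: "p_harmonic_map M N p u"
    and V: "open V" "V \<subseteq> cimg c" and u: "Ck_on 2 V (loc c u)" and x0: "x0 \<in> V" and gpos: "0 < grad_sq M c u x0"
  shows "p_tension M c u N x0 p = 0"
proof -
  let ?U = "loc c u"
  obtain \<mu> where \<mu>: "is_riemannian_volume M \<mu>" and uW: "u \<in> W1p M \<mu> N p"
    and var: "\<And>F. variation M N F \<Longrightarrow> ((\<lambda>t. energy M \<mu> p (\<lambda>x. F t x (u x))) has_real_derivative 0) (at 0)"
    using ph unfolding p_harmonic_map_def by blast
  obtain e0 where e0: "weak_grad_norm M \<mu> u e0" "integrable \<mu> (\<lambda>x. \<bar>e0 x\<bar> powr p)"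
    using uW by (auto simp: W1p_def)
  have uN: "?U x \<in> N" if "x \<in> V" for x
    using uW that V(2) cinv_in[OF M c, of x] cdom_subset[OF M c] by (auto simp: W1p_def loc_def)
  define y0 where "y0 = ?U x0"
  have y0N: "y0 \<in> N" using uN x0 by (simp add: y0_def)
  obtain Y W \<Phi> \<Psi> S where sc: "slice_chart d N Y W \<Phi> \<Psi> S" and y0Y: "y0 \<in> Y"
    using slice_chart_exists[OF N y0N] by metis
  have oY: "open Y" and oW: "open W" using slice_open[OF sc] by auto
  obtain \<delta>' where \<delta>': "\<delta>' > 0" "ball (\<Phi> y0) \<delta>' \<subseteq> W"
    using oW slice_Phi_in[OF sc y0Y] open_contains_ball by blast
  define \<delta> where "\<delta> = \<delta>' / 2"
  have \<delta>: "\<delta> > 0" "ball (\<Phi> y0) (2 * \<delta>) \<subseteq> W" using \<delta>' by (auto simp: \<delta>_def)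
  have "isCont \<Phi> y0" using slice_Phi_diff[OF sc y0Y] differentiable_imp_continuous_within by blast
  then obtain R1 where R1: "R1 > 0" "\<And>y. dist y y0 < R1 \<Longrightarrow> dist (\<Phi> y) (\<Phi> y0) < \<delta>"
    using \<delta>(1) by (auto simp: continuous_at_eps_delta)
  obtain R2 where R2: "R2 > 0" "ball y0 R2 \<subseteq> Y" using oY y0Y open_contains_ball by blast
  define R where "R = min R1 R2"
  have R: "R > 0" "ball y0 R \<subseteq> Y" "\<And>y. y \<in> ball y0 R \<Longrightarrow> dist (\<Phi> y0) (\<Phi> y) < \<delta>"
    using R1 R2 by (auto simp: R_def dist_commute)
  \<comment> \<open>Here the gradient does not vanish and the values of \<open>u\<close> are in the part of the slice chart where the deformation is defined.\<close>
  define V1 where "V1 = {x \<in> V. 0 < grad_sq M c u x} \<inter> (V \<inter> ?U -` ball y0 R)"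
  have oV1: "open V1" unfolding V1_def
    by (intro open_Int open_grad_pos[OF M c V u] continuous_open_preimage[OF Ck_on_imp_continuous_on[OF u] V(1)] open_ball)
  have V1: "V1 \<subseteq> V" "V1 \<subseteq> cimg c" "x0 \<in> V1" "\<And>x. x \<in> V1 \<Longrightarrow> ?U x \<in> ball y0 R" "\<And>x. x \<in> V1 \<Longrightarrow> 0 < grad_sq M c u x"
    using V x0 gpos R(1) by (auto simp: V1_def y0_def)
  have u1: "Ck_on 2 V1 ?U" by (rule Ck_on_subset[OF u V1(1)])
  have pdU: "Ck_on 1 V1 (pd i ?U)" for i using u1 by (simp add: pd_def[abs_def] numeral_2_eq_2)
  define X where "X i y = vol_density M c y *\<^sub>R (grad_norm M c u y powr (p - 2)) *\<^sub>R (\<Sum>j\<in>UNIV. ginv M c y i j *\<^sub>R pd j ?U y)" for i y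
  have X: "Ck_on 1 V1 (X i)" for i
    unfolding X_def
  proof (intro Ck_on_scaleR Ck_on_sum oV1 pdU Ck_on_powr_compose)
    show "Ck_on 1 V1 (vol_density M c)" by (rule Ck_on_subset[OF vol_density_smooth[OF M c] V1(2)])
    show "Ck_on 1 V1 (grad_norm M c u)" by (rule Ck_on_subset[OF grad_norm_Ck[OF M c V u]]) (auto simp: V1_def)
    show "Ck_on 1 V1 (\<lambda>y. ginv M c y i j)" for j by (rule Ck_on_subset[OF ginv_smooth[OF M c] V1(2)])
  qed (use V1(5) in \<open>simp add: grad_norm_eq[OF M c]\<close>)
  show ?thesis
  proof (rule tangential_divergence_zero[OF M c V u N uN x0 gpos], assumption, rule ccontr)
    fix s assume s: "s \<in> tangent_space N (?U x0)"
    let ?div = "divergence M c (\<lambda>i y. (grad_norm M c u y powr (p - 2)) *\<^sub>R (\<Sum>j\<in>UNIV. ginv M c y i j *\<^sub>R pd j ?U y))"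
    assume nz: "?div x0 \<bullet> s \<noteq> 0"
    obtain v where v: "v \<in> S" "s = dderiv \<Psi> v (\<Phi> y0)"
      using s tangent_space_slice[OF sc y0Y y0N] by (auto simp: y0_def)
    define \<zeta> where "\<zeta> x = dderiv \<Psi> v (\<Phi> (?U x))" for x
    have UY: "?U x \<in> Y" if "x \<in> V1" for x using V1(4)[OF that] R(2) by auto
    have PhiU: "Ck_on 2 V1 (\<lambda>x. \<Phi> (?U x))" by (rule Ck_on_compose[OF oV1 u1 slice_smooth(1)[OF sc] UY])
    have \<zeta>: "Ck_on 2 V1 \<zeta>" unfolding \<zeta>_def
      by (rule Ck_on_compose[OF oV1 PhiU Ck_on_dderiv[OF slice_smooth(2)[OF sc]] slice_Phi_in[OF sc UY]])
    define f0 where "f0 x = (\<Sum>i\<in>UNIV. pd i (X i) x) \<bullet> \<zeta> x" for x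
    have cf0: "continuous_on V1 f0" unfolding f0_def
    proof (intro continuous_intros Ck_on_imp_continuous_on[OF \<zeta>])
      show "continuous_on V1 (pd i (X i))" for i using X[of i] by (simp add: pd_def[abs_def])
    qed
    have vx0: "vol_density M c x0 > 0" using vol_density_pos[OF M c] x0 V(2) by auto
    have "?div x0 = (1 / vol_density M c x0) *\<^sub>R (\<Sum>i\<in>UNIV. pd i (X i) x0)"
      unfolding divergence_def X_def[abs_def] by simp
    then have "f0 x0 = vol_density M c x0 * (?div x0 \<bullet> s)"
      using vx0 by (simp add: f0_def \<zeta>_def v(2) y0_def)
    then have f0x0: "f0 x0 \<noteq> 0" using nz vx0 by simp
    \<comment> \<open>Multiplying by the sign treats positive and negative values of \<open>f0 x0\<close> together.\<close>
    define \<sigma> where "\<sigma> = sgn (f0 x0)"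
    define V2 where "V2 = V1 \<inter> (\<lambda>x. \<sigma> * f0 x) -` {0<..}"
    have "open V2" unfolding V2_def by (intro continuous_open_preimage continuous_intros cf0 oV1)
    moreover have "x0 \<in> V2" using V1(3) f0x0 by (simp add: V2_def \<sigma>_def sgn_mult_self_eq sgn_if)
    ultimately obtain a b where ab: "x0 \<in> box a b" "cbox a b \<subseteq> V2"
      using open_contains_cbox by metis
    have abV1: "cbox a b \<subseteq> V1" using ab(2) by (auto simp: V2_def)
    obtain r' where r': "r' > 0" "ball x0 r' \<subseteq> box a b" using ab(1) open_contains_ball[of "box a b"] by auto
    define r where "r = r' / 2"
    have r: "r > 0" "cball x0 r \<subseteq> cbox a b"
      using r' box_subset_cbox[of a b] by (auto simp: r_def subset_iff)
    have rc: "cball x0 r \<subseteq> cimg c" using r(2) abV1 V1(2) by blast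
    define F where "F = slice_variation c x0 r Y \<Phi> \<Psi> y0 R v"
    have varF: "variation M N F"
      unfolding F_def by (rule slice_variation_variation[OF M c sc R(1,2) \<delta>(2) R(3) v(1) r(1) rc])
    define \<kappa> where "\<kappa> x = bump x0 r x * bump y0 (R / 2) (?U x)" for x
    have \<kappa>: "Ck_on 2 V1 \<kappa>" unfolding \<kappa>_def
      by (intro Ck_on_mult oV1 Ck_on_bump Ck_on_compose[OF oV1 u1 Ck_on_bump[OF open_UNIV]]) auto
    have \<kappa>0: "\<kappa> x = 0" if "x \<notin> cball x0 r" for x
      using that r(1) by (simp add: \<kappa>_def bump_eq_0)
    have \<kappa>nn: "0 \<le> \<kappa> x" for x by (simp add: \<kappa>_def bump_nonneg)
    have \<kappa>pos: "0 < \<kappa> x0" using r(1) R(1) by (simp add: \<kappa>_def bump_pos_iff y0_def)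
    define \<epsilon> where "\<epsilon> = \<delta> / (norm v + 1)"
    have nv: "norm v + 1 > 0" by (simp add: add_nonneg_pos)
    have \<epsilon>: "\<epsilon> > 0" using \<delta>(1) nv by (simp add: \<epsilon>_def)
    have It: "\<bar>t\<bar> * norm v < \<delta>" if "\<bar>t\<bar> < \<epsilon>" for t
    proof -
      have "\<bar>t\<bar> * norm v \<le> \<epsilon> * norm v" using that by (intro mult_right_mono) auto
      also have "\<dots> < \<epsilon> * (norm v + 1)" using \<epsilon> by simp
      also have "\<dots> = \<delta>" using nv by (simp add: \<epsilon>_def)
      finally show ?thesis .
    qed
    define Z where "Z = {-\<epsilon><..<\<epsilon>} \<times> V1"
    have oZ: "open Z" unfolding Z_def by (intro open_Times oV1) auto
    \<comment> \<open>The deformed map in coordinates, as a function of time and of the point of the domain.\<close>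
    define U2 where "U2 z = \<Psi> (\<Phi> (?U (snd z)) + (fst z * \<kappa> (snd z)) *\<^sub>R v)" for z
    have inW: "\<Phi> (?U (snd z)) + (fst z * \<kappa> (snd z)) *\<^sub>R v \<in> W" if "z \<in> Z" for z
      using slice_variation_stays[OF sc R(1,2) \<delta>(2) R(3) It V1(4), of "fst z" "snd z" x0 r "snd z"] that
      by (auto simp: Z_def \<kappa>_def mult.assoc)
    have comp: "Ck_on k Z (\<lambda>z. g (snd z))" if "Ck_on k V1 g" for k and g :: "real^'n \<Rightarrow> 'z::real_normed_vector"
      by (rule Ck_on_compose_linear[OF bounded_linear_snd oZ that]) (auto simp: Z_def)
    have inner: "Ck_on 2 Z (\<lambda>z. \<Phi> (?U (snd z)) + (fst z * \<kappa> (snd z)) *\<^sub>R v)"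
      by (intro Ck_on_add Ck_on_scaleR Ck_on_mult oZ comp PhiU \<kappa> Ck_on_const Ck_on_linear[OF bounded_linear_fst])
    have U2: "Ck_on 2 Z U2" unfolding U2_def
      by (rule Ck_on_compose[OF oZ inner slice_smooth(2)[OF sc] inW])
    define ut where "ut t m = F t m (u m)" for t m
    have locut: "loc c (ut t) x = U2 (t, x)" if "x \<in> V1" for t x
      using that V1(2) UY[OF that] cinv_in[OF M c, of x] cmap_cinv[OF M c, of x]
      by (auto simp: loc_def ut_def F_def slice_variation_def U2_def \<kappa>_def mult.assoc)
    have U2t: "Ck_on 2 V1 (\<lambda>x. U2 (t, x))" if "\<bar>t\<bar> < \<epsilon>" for t
      by (rule Ck_on_compose[OF oV1 Ck_on_Pair[OF oV1 Ck_on_const Ck_on_id] U2]) (use that in \<open>auto simp: Z_def\<close>)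
    have Cut: "Ck_on 2 V1 (loc c (ut t))" if "\<bar>t\<bar> < \<epsilon>" for t
      by (rule Ck_on_cong[OF oV1 _ U2t[OF that]]) (simp add: locut)
    have slice_dd: "dderiv (\<lambda>x. g (t, x)) w x = dderiv g (0, w) (t, x)"
      if g: "g differentiable (at (t, x))" for g :: "real \<times> (real^'n) \<Rightarrow> 'l" and t x w
    proof -
      have "((\<lambda>x. (t, x)) has_derivative (\<lambda>w. (0, w))) (at x)"
        by (auto intro!: derivative_eq_intros)
      from diff_chain_at[OF this differentiable_has_dderiv[OF g]]
      show ?thesis by (intro dderiv_eqI) (simp add: o_def)
    qed
    have pdut: "pd i (loc c (ut t)) x = dderiv U2 (0, axis i 1) (t, x)" if "\<bar>t\<bar> < \<epsilon>" "x \<in> V1" for i t x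
    proof -
      have "dderiv (\<lambda>x. U2 (t, x)) (axis i 1) x = dderiv (loc c (ut t)) (axis i 1) x"
        by (rule dderiv_cong[OF oV1 that(2)])
          (use Ck_on_imp_differentiable[OF U2t[OF that(1)] _ that(2)] in \<open>simp_all add: locut\<close>)
      then show ?thesis
        using slice_dd[of U2 t x "axis i 1"] Ck_on_imp_differentiable[OF U2, of "(t, x)"] that by (simp add: pd_def Z_def abs_less_iff)
    qed
    define E where "E z = (\<Sum>i\<in>UNIV. \<Sum>j\<in>UNIV. ginv M c (snd z) i j * (dderiv U2 (0, axis i 1) z \<bullet> dderiv U2 (0, axis j 1) z))" for z
    have Egs: "grad_sq M c (ut t) x = E (t, x)" if "\<bar>t\<bar> < \<epsilon>" "x \<in> V1" for t x
      using that by (simp add: grad_sq_def[OF M c] E_def pdut)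
    have "ut 0 m = u m" if "m \<in> topspace (mtop M)" for m
    proof -
      have "u m \<in> N" using uW that by (auto simp: W1p_def)
      then show ?thesis using varF that unfolding variation_def ut_def by auto
    qed
    then have ut0: "loc c (ut 0) x = ?U x" if "x \<in> cimg c" for x
      using that cinv_in[OF M c that] cdom_subset[OF M c] by (auto simp: loc_def)
    have U20: "U2 (0, x) = ?U x" if "x \<in> V1" for x using ut0[of x] locut[OF that, of 0] that V1(2) by auto
    have pdU2: "dderiv U2 (0, axis i 1) (0, x) = pd i ?U x" if "x \<in> V1" for i x
    proof -
      have "dderiv (loc c (ut 0)) (axis i 1) x = dderiv ?U (axis i 1) x"
        by (rule dderiv_cong[OF oV1 that]) (use ut0 V1(2) Ck_on_imp_differentiable[OF Cut[of 0] _ that] \<epsilon> in auto)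
      then show ?thesis using pdut[of 0 x i] that \<epsilon> by (simp add: pd_def)
    qed
    have E0: "E (0, x) = grad_sq M c u x" if "x \<in> V1" for x
      using that by (simp add: E_def grad_sq_def[OF M c] pdU2)
    have aCk: "Ck_on 1 Z (dderiv U2 w)" for w
      using U2 Ck_on_dderiv[of 1 Z U2 w] by (simp only: Suc_1)
    have ginvV1: "Ck_on 1 V1 (\<lambda>y. ginv M c y i j)" for i j by (rule Ck_on_subset[OF ginv_smooth[OF M c] V1(2)])
    have volV1: "Ck_on 1 V1 (vol_density M c)" by (rule Ck_on_subset[OF vol_density_smooth[OF M c] V1(2)])
    have "Ck_on 1 Z E" unfolding E_def
      by (intro Ck_on_sum Ck_on_mult Ck_on_inner oZ aCk comp ginvV1)
    then have cE: "continuous_on Z E" by (rule Ck_on_imp_continuous_on)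
    \<comment> \<open>The energy density is differentiable where the gradient of the deformed map does not vanish.\<close>
    define Z' where "Z' = Z \<inter> E -` {0<..}"
    have oZ': "open Z'" unfolding Z'_def by (intro continuous_open_preimage cE oZ) auto
    have Z'Z: "Z' \<subseteq> Z" by (auto simp: Z'_def)
    have Z'V: "snd z \<in> V1" if "z \<in> Z'" for z using that by (auto simp: Z'_def Z_def)
    have E_eq: "E = (\<lambda>z. \<Sum>i\<in>UNIV. \<Sum>j\<in>UNIV. ginv M c (snd z) i j * (dderiv U2 (0, axis i 1) z \<bullet> dderiv U2 (0, axis j 1) z))"
      by (simp add: E_def fun_eq_iff)
    define f where "f z = E z powr (p / 2) * vol_density M c (snd z)" for z
    have gs: "ginv M c x i j = ginv M c x j i" if "x \<in> V1" for x i j using ginv_sym[OF M c, of x] that V1(2) by auto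
    have Epos: "E z > 0" if "z \<in> Z'" for z using that by (simp add: Z'_def)
    have fCk: "Ck_on 1 Z' f" unfolding f_def[abs_def]
      by (rule density_Ck[OF oZ' Ck_on_subset[OF U2 Z'Z] oV1 Z'V ginvV1 gs volV1 E_eq Epos]; assumption)
    have fder: "dderiv f (1, 0) z =
      p * (\<Sum>i\<in>UNIV. (vol_density M c (snd z) *\<^sub>R (sqrt (E z) powr (p - 2)) *\<^sub>R (\<Sum>j\<in>UNIV. ginv M c (snd z) i j *\<^sub>R dderiv U2 (0, axis j 1) z))
         \<bullet> dderiv (dderiv U2 (1, 0)) (0, axis i 1) z)" if z: "z \<in> Z'" for z
      unfolding f_def[abs_def]
      by (rule density_dderiv[OF oZ' Ck_on_subset[OF U2 Z'Z] oV1 Z'V ginvV1 gs volV1 E_eq Epos _]) (simp_all only: z)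
    have "{0} \<times> cbox a b \<subseteq> Z'"
      using abV1 V1(5) \<epsilon> by (auto simp: Z'_def Z_def E0 subset_iff)
    from parametric_integral_derivative[OF oZ' fCk this] obtain e where e: "e > 0"
      "\<And>t x. \<bar>t\<bar> < e \<Longrightarrow> x \<in> cbox a b \<Longrightarrow> (t, x) \<in> Z'"
      and der: "((\<lambda>t. integral (cbox a b) (\<lambda>x. f (t, x))) has_real_derivative
         integral (cbox a b) (\<lambda>x. dderiv f (1, 0) (0, x))) (at 0)" by blast
    have K: "compact (cbox a b)" "cbox a b \<subseteq> cimg c" using abV1 V1(2) by auto
    define C0 where "C0 = (\<integral>m. indicator (- cinv c ` cbox a b) m * \<bar>e0 m\<bar> powr p \<partial>\<mu>)"
    have en: "energy M \<mu> p (ut t) = C0 + integral (cbox a b) (\<lambda>x. f (t, x))" if t: "\<bar>t\<bar> < min e \<epsilon>" for t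
    proof -
      have t': "\<bar>t\<bar> < \<epsilon>" "\<bar>t\<bar> < e" using t by auto
      have "energy M \<mu> p (ut t) = C0 + integral (cbox a b) (\<lambda>x. grad_norm M c (ut t) x powr p * vol_density M c x)"
        unfolding C0_def
      proof (rule energy_modified[OF M \<mu> c K oV1 V1(2) abV1 _ _ _ e0(1) _ e0(2)])
        show "Ck_on 1 V1 (loc c u)" "Ck_on 1 V1 (loc c (ut t))"
          using Ck_on_mono[OF u1, of 1] Ck_on_mono[OF Cut[OF t'(1)], of 1] by (simp_all del: Ck_on.simps)
        fix m assume "m \<notin> cinv c ` cbox a b"
        then have "m \<in> cdom c \<Longrightarrow> cmap c m \<notin> cball x0 r"
          using cinv_image_eq[OF M c K(2)] r(2) by blast
        then have "m \<in> cdom c \<Longrightarrow> bump x0 r (cmap c m) = 0"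
          using r(1) by (intro bump_eq_0) auto
        then show "ut t m = u m"
          using slice_Psi_Phi[OF sc] by (auto simp: ut_def F_def slice_variation_def)
      qed (use p in auto)
      also have "integral (cbox a b) (\<lambda>x. grad_norm M c (ut t) x powr p * vol_density M c x) = integral (cbox a b) (\<lambda>x. f (t, x))"
      proof (rule integral_cong)
        fix x assume x: "x \<in> cbox a b"
        have "E (t, x) > 0" using Epos e(2)[OF t'(2) x] by blast
        then show "grad_norm M c (ut t) x powr p * vol_density M c x = f (t, x)"
          using Egs[OF t'(1), of x] x abV1 by (auto simp: f_def grad_norm_eq[OF M c] powr_half_sqrt[symmetric] powr_powr)
      qed
      finally show ?thesis .
    qed
    have A: "((\<lambda>t. C0 + integral (cbox a b) (\<lambda>x. f (t, x))) has_real_derivative 0) (at 0)"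
    proof (rule has_field_derivative_transform_within_open)
      show "((\<lambda>t. energy M \<mu> p (ut t)) has_real_derivative 0) (at 0)"
        using var[OF varF] by (simp add: ut_def[abs_def])
      show "open {- min e \<epsilon><..<min e \<epsilon>}" "0 \<in> {- min e \<epsilon><..<min e \<epsilon>}" using e(1) \<epsilon> by auto
      fix t assume "t \<in> {- min e \<epsilon><..<min e \<epsilon>}"
      then have "- min e \<epsilon> < t" "t < min e \<epsilon>" by (simp_all only: greaterThanLessThan_iff)
      then have "\<bar>t\<bar> < min e \<epsilon>" by linarith
      then show "energy M \<mu> p (ut t) = C0 + integral (cbox a b) (\<lambda>x. f (t, x))" by (rule en)
    qed
    have B: "((\<lambda>t. C0 + integral (cbox a b) (\<lambda>x. f (t, x))) has_real_derivative 0 + integral (cbox a b) (\<lambda>x. dderiv f (1, 0) (0, x))) (at 0)"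
      by (intro DERIV_add DERIV_const der)
    have i0: "integral (cbox a b) (\<lambda>x. dderiv f (1, 0) (0, x)) = 0"
      using DERIV_unique[OF A B] by simp
    define \<xi> where "\<xi> x = \<kappa> x *\<^sub>R \<zeta> x" for x
    have \<xi>: "Ck_on 2 V1 \<xi>" unfolding \<xi>_def by (intro Ck_on_scaleR oV1 \<kappa> \<zeta>)
    have dtU2: "dderiv U2 (1, 0) (0, x) = \<xi> x" if x: "x \<in> V1" for x
    proof -
      have z: "(0, x) \<in> Z" using x \<epsilon> by (simp add: Z_def)
      have w: "\<Phi> (?U x) \<in> W" by (rule slice_Phi_in[OF sc UY[OF x]])
      have "((\<lambda>s. U2 ((0, x) + s *\<^sub>R (1, 0))) has_vector_derivative dderiv U2 (1, 0) ((0, x) + 0 *\<^sub>R (1, 0))) (at 0)"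
        by (rule has_vector_derivative_along_line) (use Ck_on_imp_differentiable[OF U2 _ z] in simp)
      moreover have "((\<lambda>s. \<Psi> (\<Phi> (?U x) + s *\<^sub>R (\<kappa> x *\<^sub>R v))) has_vector_derivative dderiv \<Psi> (\<kappa> x *\<^sub>R v) (\<Phi> (?U x) + 0 *\<^sub>R (\<kappa> x *\<^sub>R v))) (at 0)"
        by (rule has_vector_derivative_along_line) (use slice_Psi_diff[OF sc w] in simp)
      ultimately have "dderiv U2 (1, 0) (0, x) = dderiv \<Psi> (\<kappa> x *\<^sub>R v) (\<Phi> (?U x))"
        by (intro vector_derivative_unique_at) (simp_all add: U2_def)
      then show ?thesis using linear_cmul[OF linear_dPsi[OF sc w]] by (simp add: \<xi>_def \<zeta>_def)
    qed
    have dtdU2: "dderiv (dderiv U2 (1, 0)) (0, axis i 1) (0, x) = pd i \<xi> x" if x: "x \<in> V1" for i x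
    proof -
      have z: "(0, x) \<in> Z" using x \<epsilon> by (simp add: Z_def)
      have d: "dderiv U2 (1, 0) differentiable (at (0, x))" using Ck_on_imp_differentiable[OF aCk _ z] by simp
      have "dderiv (\<lambda>x. dderiv U2 (1, 0) (0, x)) (axis i 1) x = dderiv (dderiv U2 (1, 0)) (0, axis i 1) (0, x)"
        by (rule slice_dd[OF d])
      moreover have "dderiv \<xi> (axis i 1) x = dderiv (\<lambda>x. dderiv U2 (1, 0) (0, x)) (axis i 1) x"
        by (rule dderiv_cong[OF oV1 x]) (use dtU2 Ck_on_imp_differentiable[OF \<xi> _ x] in auto)
      ultimately show ?thesis by (simp add: pd_def)
    qed
    have "dderiv f (1, 0) (0, x) = p * (\<Sum>i\<in>UNIV. X i x \<bullet> pd i \<xi> x)" if x: "x \<in> cbox a b" for x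
    proof -
      have xV: "x \<in> V1" using x abV1 by blast
      have z: "(0, x) \<in> Z'" using e(2)[of 0 x] e(1) x by simp
      show ?thesis
        using fder[OF z] by (simp add: X_def E0[OF xV] pdU2[OF xV] dtdU2[OF xV] grad_norm_eq[OF M c])
    qed
    then have "integral (cbox a b) (\<lambda>x. p * (\<Sum>i\<in>UNIV. X i x \<bullet> pd i \<xi> x)) = 0"
      using i0 integral_cong[of "cbox a b" "\<lambda>x. dderiv f (1, 0) (0, x)" "\<lambda>x. p * (\<Sum>i\<in>UNIV. X i x \<bullet> pd i \<xi> x)"] by simp
    then have "integral (cbox a b) (\<lambda>x. \<Sum>i\<in>UNIV. X i x \<bullet> pd i \<xi> x) = 0" using p by simp
    moreover have "Ck_on 1 V1 \<xi>" by (rule Ck_on_mono[OF \<xi>]) simp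
    then have "integral (cbox a b) (\<lambda>x. \<Sum>i\<in>UNIV. X i x \<bullet> pd i \<xi> x)
      = - integral (cbox a b) (\<lambda>x. \<Sum>i\<in>UNIV. pd i (X i) x \<bullet> \<xi> x)"
      by (rule integral_by_parts_box[OF oV1 abV1 compact_cball r(2) X]) (simp add: \<xi>_def \<kappa>0)
    ultimately have "integral (cbox a b) (\<lambda>x. \<Sum>i\<in>UNIV. pd i (X i) x \<bullet> \<xi> x) = 0" by linarith
    moreover have "(\<Sum>i\<in>UNIV. pd i (X i) x \<bullet> \<xi> x) = \<kappa> x * f0 x" for x
      by (simp add: f0_def \<xi>_def inner_sum_left sum_distrib_left)
    ultimately have "integral (cbox a b) (\<lambda>x. \<kappa> x * f0 x) = 0" by simp
    then have int0: "integral (cbox a b) (\<lambda>x. \<sigma> * (\<kappa> x * f0 x)) = 0" by simp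
    have "\<sigma> * (\<kappa> x0 * f0 x0) = 0"
    proof -
      have "continuous_on (cbox a b) (\<lambda>x. \<sigma> * (\<kappa> x * f0 x))"
        using Ck_on_imp_continuous_on[OF \<kappa>] cf0 abV1 by (intro continuous_intros) (auto intro: continuous_on_subset)
      moreover have "box a b \<noteq> {}" using ab(1) by auto
      moreover have "0 \<le> \<sigma> * (\<kappa> x * f0 x)" if "x \<in> cbox a b" for x
      proof -
        have "0 < \<sigma> * f0 x" using that ab(2) by (auto simp: V2_def)
        then have "0 \<le> \<kappa> x * (\<sigma> * f0 x)" by (rule mult_nonneg_nonneg[OF \<kappa>nn less_imp_le])
        then show ?thesis by (simp add: ac_simps)
      qed
      ultimately have "\<forall>x\<in>cbox a b. \<sigma> * (\<kappa> x * f0 x) = 0"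
        using int0 integral_cbox_eq_0_iff[of a b "\<lambda>x. \<sigma> * (\<kappa> x * f0 x)"] by blast
      then show ?thesis using ab(1) box_subset_cbox[of a b] by blast
    qed
    then show False using \<kappa>pos f0x0 by (simp add: \<sigma>_def sgn_0_0)
  qed
qed

section \<open>The refined Kato inequality\<close>

text \<open>The vector at \<open>k0\<close> is the normalized gradient, that is, \<open>w\<close> with its index raised: then orthogonality to it with
  respect to \<open>A\<close> is Euclidean orthogonality to \<open>w\<close>. For \<open>w = 0\<close> any frame will do.\<close>

lemma adapted_frame_exists:
  fixes A :: "real^'n::finite^'n"
  assumes A: "pos_def A"
  obtains P where "frame A P" "\<And>k. k \<noteq> k0 \<Longrightarrow> P k \<bullet> w = 0"
proof (cases "w = 0")
  case True
  then show ?thesis using pos_def_frame_exists[OF A] that by (metis inner_zero_right)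
next
  case False
  obtain P0 where P0: "frame A P0" using pos_def_frame_exists[OF A] .
  have "A ** matrix_inv A = mat 1" using matrix_inv_left[OF P0] by (simp add: matrix_left_right_inverse)
  then have Az: "A *v (matrix_inv A *v w) = w" by (simp add: matrix_vector_mul_assoc)
  define z where "z = matrix_inv A *v w"
  have "z \<noteq> 0" using Az False by (auto simp: z_def)
  define \<rho> where "\<rho> = z \<bullet> (A *v z)"
  have \<rho>: "\<rho> > 0" using A \<open>z \<noteq> 0\<close> by (simp add: pos_def_def \<rho>_def)
  define v where "v = (1 / sqrt \<rho>) *\<^sub>R z"
  have "v \<bullet> (A *v v) = 1" using \<rho> by (simp add: v_def matrix_vector_mult_scaleR \<rho>_def[symmetric])
  then obtain P where P: "frame A P" "P k0 = v" using frame_exists[OF A] by metis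
  have "w = sqrt \<rho> *\<^sub>R (A *v v)" using Az \<rho> by (simp add: v_def z_def matrix_vector_mult_scaleR)
  then have "P k \<bullet> w = 0" if "k \<noteq> k0" for k
    using P that by (simp add: frame_def) metis
  then show ?thesis using P(1) that by blast
qed

lemma refined_Kato:
  fixes M :: "('m, 'n::finite) manifold" and N :: "'l::euclidean_space set"
  assumes M: "riemannian_manifold M" and c: "c \<in> atlas M" and N: "embedded_submanifold d N"
    and n: "CARD('n) \<ge> 2" and p: "p > 1"
    and V: "open V" "V \<subseteq> cimg c" and u: "Ck_on 2 V (loc c u)" and uN: "\<And>x. x \<in> V \<Longrightarrow> loc c u x \<in> N"
    and x: "x \<in> V" and gpos: "0 < grad_sq M c u x" and t: "p_tension M c u N x p = 0"
  shows "kappa p CARD('n) * (grad_grad_norm M c u x)\<^sup>2 \<le> (hess_norm M c N u x)\<^sup>2"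
proof -
  have xc: "x \<in> cimg c" using x V by auto
  define k0 :: 'n where "k0 = undefined"
  obtain P where P: "frame (metric M c x) P"
    and P0: "\<And>k. k \<noteq> k0 \<Longrightarrow> P k \<bullet> (\<chi> i. pd i (grad_norm M c u) x) = 0"
    using adapted_frame_exists[OF pos_def_metric[OF M c xc], of k0] by blast
  note ctx = M c V u N uN x gpos
  have gp: "grad_norm M c u x > 0" using gpos by (simp add: grad_norm_eq[OF M c])
  have gg: "(grad_grad_norm M c u x)\<^sup>2 = (\<Sum>k\<in>UNIV. (frame_dnorm M c u x P k)\<^sup>2)"
    by (rule frame_grad_grad_norm[OF ctx P])
  have hh: "(hess_norm M c N u x)\<^sup>2 = (\<Sum>k\<in>UNIV. \<Sum>l\<in>UNIV. (norm (frame_hess M c u N x P k l))\<^sup>2)"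
    by (rule frame_hess_norm[OF ctx P])
  show ?thesis
    unfolding gg hh
  proof (rule refined_Kato_pointwise[OF n p gp])
    show "(\<Sum>k\<in>UNIV. (norm (frame_grad c u x P k))\<^sup>2) = (grad_norm M c u x)\<^sup>2"
      using frame_grad_norm[OF ctx P] by simp
    show "grad_norm M c u x * frame_dnorm M c u x P k = (\<Sum>l\<in>UNIV. frame_hess M c u N x P k l \<bullet> frame_grad c u x P l)" for k
      by (rule frame_dnorm_eq[OF ctx P])
    show "frame_dnorm M c u x P k = 0" if "k \<noteq> k0" for k
      using P0[OF that] by (simp add: frame_dnorm_def[OF ctx P] inner_vec_def)
    show "frame_hess M c u N x P k l = frame_hess M c u N x P l k" for k l
      by (rule frame_hess_sym[OF ctx P])
    show "(\<Sum>k\<in>UNIV. frame_hess M c u N x P k k) + ((p - 2) / grad_norm M c u x) *\<^sub>R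
        (\<Sum>k\<in>UNIV. frame_dnorm M c u x P k *\<^sub>R frame_grad c u x P k) = 0"
      using t frame_p_tension[OF ctx P] by simp
  qed
qed

section \<open>Maps with prescribed derivatives at a point\<close>

text \<open>The vectors \<open>A *v P k\<close> form the dual basis. With them, this lemma and the next one recover a family and a matrix
  from their coordinate expressions.\<close>

lemma dual_frame_sum:
  fixes e :: "'n::finite \<Rightarrow> 'l::real_vector"
  assumes P: "frame A P"
  shows "(\<Sum>i\<in>UNIV. P l $ i *\<^sub>R (\<Sum>k\<in>UNIV. (A *v P k) $ i *\<^sub>R e k)) = e l"
proof -
  have "(\<Sum>i\<in>UNIV. P l $ i *\<^sub>R (\<Sum>k\<in>UNIV. (A *v P k) $ i *\<^sub>R e k))
    = (\<Sum>k\<in>UNIV. \<Sum>i\<in>UNIV. (P l $ i * (A *v P k) $ i) *\<^sub>R e k)"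
    by (subst sum.swap) (simp add: scaleR_sum_right)
  also have "\<dots> = (\<Sum>k\<in>UNIV. (P l \<bullet> (A *v P k)) *\<^sub>R e k)"
    by (simp add: inner_vec_def scaleR_sum_left)
  also have "\<dots> = (\<Sum>k\<in>UNIV. (if l = k then e k else 0))"
    using P by (intro sum.cong) (auto simp: frame_def)
  finally show ?thesis by simp
qed

lemma dual_frame_sum2:
  fixes h :: "'n::finite \<Rightarrow> 'n \<Rightarrow> 'l::real_vector"
  assumes P: "frame A P"
  shows "(\<Sum>i\<in>UNIV. \<Sum>j\<in>UNIV. (P m $ i * P l $ j) *\<^sub>R
     (\<Sum>k\<in>UNIV. (A *v P k) $ i *\<^sub>R (\<Sum>k'\<in>UNIV. (A *v P k') $ j *\<^sub>R h k k'))) = h m l"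
proof -
  have "(\<Sum>j\<in>UNIV. (P m $ i * P l $ j) *\<^sub>R
     (\<Sum>k\<in>UNIV. (A *v P k) $ i *\<^sub>R (\<Sum>k'\<in>UNIV. (A *v P k') $ j *\<^sub>R h k k')))
     = P m $ i *\<^sub>R (\<Sum>k\<in>UNIV. (A *v P k) $ i *\<^sub>R h k l)" for i
  proof -
    have "(\<Sum>j\<in>UNIV. (P m $ i * P l $ j) *\<^sub>R
        (\<Sum>k\<in>UNIV. (A *v P k) $ i *\<^sub>R (\<Sum>k'\<in>UNIV. (A *v P k') $ j *\<^sub>R h k k')))
      = P m $ i *\<^sub>R (\<Sum>k\<in>UNIV. \<Sum>j\<in>UNIV. P l $ j *\<^sub>R ((A *v P k) $ i *\<^sub>R (\<Sum>k'\<in>UNIV. (A *v P k') $ j *\<^sub>R h k k')))"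
      by (subst sum.swap) (simp add: scaleR_sum_right mult.assoc)
    also have "\<dots> = P m $ i *\<^sub>R (\<Sum>k\<in>UNIV. (A *v P k) $ i *\<^sub>R (\<Sum>j\<in>UNIV. P l $ j *\<^sub>R (\<Sum>k'\<in>UNIV. (A *v P k') $ j *\<^sub>R h k k')))"
      by (simp add: scaleR_sum_right ac_simps)
    finally show ?thesis by (simp only: dual_frame_sum[OF P])
  qed
  then show ?thesis by (simp add: dual_frame_sum[OF P])
qed

lemma bump_le_center: "bump a r x \<le> bump a r a"
proof -
  define s where "s = r\<^sup>2 - (x - a) \<bullet> (x - a)"
  have "s \<le> r\<^sup>2" by (simp add: s_def)
  have "flat0 s \<le> flat0 (r\<^sup>2)"
  proof (cases "s > 0")
    case True
    then have "1 / r\<^sup>2 \<le> 1 / s" using \<open>s \<le> r\<^sup>2\<close> by (intro frac_le) auto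
    moreover have "r \<noteq> 0" using True \<open>s \<le> r\<^sup>2\<close> by auto
    ultimately show ?thesis using True by (simp add: flat_exp_def)
  next
    case False
    then show ?thesis using flat_exp_nonneg[of 0 "r\<^sup>2"] by (simp add: flat_exp_def[of _ s])
  qed
  then show ?thesis by (simp add: bump_def s_def)
qed

text \<open>The bump function is maximal at its centre.\<close>

lemma dderiv_bump_center: "dderiv (bump a r) v a = 0"
proof -
  have "bump a r differentiable (at a)"
    by (rule Ck_on_imp_differentiable[OF Ck_on_bump[OF open_UNIV, of 1]]) auto
  from has_derivative_local_max[OF differentiable_has_dderiv[OF this]]
  have "(\<lambda>v. dderiv (bump a r) v a) = (\<lambda>v. 0)"
    by (auto intro: bump_le_center always_eventually)
  then show ?thesis by (simp add: fun_eq_iff)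
qed

definition quad_poly :: "real^'n::finite \<Rightarrow> ('n \<Rightarrow> 'l::real_vector) \<Rightarrow> ('n \<Rightarrow> 'n \<Rightarrow> 'l) \<Rightarrow> real^'n \<Rightarrow> 'l" where
  "quad_poly z \<alpha> \<beta> x = (\<Sum>i\<in>UNIV. ((x - z) $ i) *\<^sub>R \<alpha> i)
     + (1/2) *\<^sub>R (\<Sum>i\<in>UNIV. \<Sum>j\<in>UNIV. ((x - z) $ i * (x - z) $ j) *\<^sub>R \<beta> i j)"

lemma coord_derivative: "((\<lambda>x :: real^'n::finite. (x - z) $ i) has_derivative (\<lambda>v. v $ i)) (at x)"
proof -
  have "((\<lambda>x :: real^'n. x $ i - z $ i) has_derivative (\<lambda>v. v $ i - 0)) (at x)"
    by (intro has_derivative_diff bounded_linear_imp_has_derivative bounded_linear_vec_nth has_derivative_const)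
  then show ?thesis by simp
qed

lemma Ck_on_coord: "Ck_on k UNIV (\<lambda>x :: real^'n::finite. (x - z) $ i)"
proof -
  have "Ck_on k UNIV (\<lambda>x :: real^'n. x $ i - z $ i)"
    by (intro Ck_on_diff open_UNIV Ck_on_const Ck_on_linear bounded_linear_vec_nth)
  then show ?thesis by simp
qed

lemma Ck_on_quad_poly:
  fixes \<alpha> :: "'n::finite \<Rightarrow> 'l::euclidean_space"
  shows "Ck_on k UNIV (quad_poly z \<alpha> \<beta>)"
  unfolding quad_poly_def[abs_def]
  by (intro Ck_on_add Ck_on_sum Ck_on_scaleR Ck_on_mult open_UNIV Ck_on_const Ck_on_coord)

lemma quad_poly_center: "quad_poly z \<alpha> \<beta> z = 0"
  by (simp add: quad_poly_def)

context
  fixes z :: "real^'n::finite" and \<alpha> :: "'n \<Rightarrow> 'l::euclidean_space" and \<beta> :: "'n \<Rightarrow> 'n \<Rightarrow> 'l"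
  assumes \<beta>: "\<And>i j. \<beta> i j = \<beta> j i"
begin

lemma pd_quad_poly: "pd j (quad_poly z \<alpha> \<beta>) x = \<alpha> j + (\<Sum>i\<in>UNIV. ((x - z) $ i) *\<^sub>R \<beta> i j)"
proof -
  have "(quad_poly z \<alpha> \<beta> has_derivative (\<lambda>v. (\<Sum>i\<in>UNIV. (v $ i) *\<^sub>R \<alpha> i)
     + (1/2) *\<^sub>R (\<Sum>i\<in>UNIV. \<Sum>j\<in>UNIV. ((x - z) $ i * v $ j + v $ i * (x - z) $ j) *\<^sub>R \<beta> i j))) (at x)"
    unfolding quad_poly_def[abs_def]
    by (intro has_derivative_add has_derivative_sum has_derivative_scaleR_left has_derivative_scaleR_right
        has_derivative_mult coord_derivative)
  then have "pd j (quad_poly z \<alpha> \<beta>) x = (\<Sum>i\<in>UNIV. (axis j 1 $ i) *\<^sub>R \<alpha> i)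
     + (1/2) *\<^sub>R (\<Sum>i\<in>UNIV. \<Sum>k\<in>UNIV. ((x - z) $ i * axis j 1 $ k + axis j 1 $ i * (x - z) $ k) *\<^sub>R \<beta> i k)"
    unfolding pd_def by (rule dderiv_eqI)
  also have "(\<Sum>i\<in>UNIV. (axis j 1 $ i) *\<^sub>R \<alpha> i) = (\<Sum>i\<in>UNIV. if i = j then \<alpha> i else 0)"
    by (intro sum.cong) (auto simp: axis_def)
  also have "(\<Sum>i\<in>UNIV. \<Sum>k\<in>UNIV. ((x - z) $ i * axis j 1 $ k + axis j 1 $ i * (x - z) $ k) *\<^sub>R \<beta> i k)
     = (\<Sum>i\<in>UNIV. \<Sum>k\<in>UNIV. if k = j then ((x - z) $ i) *\<^sub>R \<beta> i k else 0)
       + (\<Sum>k\<in>UNIV. \<Sum>i\<in>UNIV. if i = j then ((x - z) $ k) *\<^sub>R \<beta> i k else 0)"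
    (is "_ = ?A + ?B")
  proof -
    have "(\<Sum>i\<in>UNIV. \<Sum>k\<in>UNIV. ((x - z) $ i * axis j 1 $ k + axis j 1 $ i * (x - z) $ k) *\<^sub>R \<beta> i k)
      = (\<Sum>i\<in>UNIV. \<Sum>k\<in>UNIV. (if k = j then ((x - z) $ i) *\<^sub>R \<beta> i k else 0) + (if i = j then ((x - z) $ k) *\<^sub>R \<beta> i k else 0))"
      by (intro sum.cong refl) (auto simp: axis_def scaleR_add_left)
    also have "\<dots> = ?A + (\<Sum>i\<in>UNIV. \<Sum>k\<in>UNIV. if i = j then ((x - z) $ k) *\<^sub>R \<beta> i k else 0)"
      by (simp only: sum.distrib)
    also have "(\<Sum>i\<in>UNIV. \<Sum>k\<in>UNIV. if i = j then ((x - z) $ k) *\<^sub>R \<beta> i k else 0) = ?B" by (rule sum.swap)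
    finally show ?thesis .
  qed
  also have "?A = (\<Sum>i\<in>UNIV. ((x - z) $ i) *\<^sub>R \<beta> i j)" by simp
  also have "?B = (\<Sum>k\<in>UNIV. ((x - z) $ k) *\<^sub>R \<beta> j k)" by simp
  also have "\<dots> = (\<Sum>i\<in>UNIV. ((x - z) $ i) *\<^sub>R \<beta> i j)" by (rule sum.cong[OF refl]) (simp only: \<beta>[of j])
  finally show ?thesis by simp
qed

lemma pd2_quad_poly: "pd i (pd j (quad_poly z \<alpha> \<beta>)) x = \<beta> i j"
proof -
  have "(pd j (quad_poly z \<alpha> \<beta>) has_derivative (\<lambda>v. 0 + (\<Sum>i\<in>UNIV. (v $ i) *\<^sub>R \<beta> i j))) (at x)"
    unfolding pd_quad_poly[abs_def]
    by (intro has_derivative_add has_derivative_const has_derivative_sum has_derivative_scaleR_left coord_derivative)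
  then have "pd i (pd j (quad_poly z \<alpha> \<beta>)) x = 0 + (\<Sum>k\<in>UNIV. (axis i 1 $ k) *\<^sub>R \<beta> k j)"
    unfolding pd_def[of i] by (rule dderiv_eqI)
  also have "(\<Sum>k\<in>UNIV. (axis i 1 $ k) *\<^sub>R \<beta> k j) = (\<Sum>k\<in>UNIV. if k = i then \<beta> k j else 0)"
    by (intro sum.cong) (auto simp: axis_def)
  finally show ?thesis by simp
qed

text \<open>Multiplication by a normalized bump function preserves the first two derivatives at \<open>z\<close>: the polynomial vanishes
  there, and the bump function has a critical point.\<close>

lemma cutoff_quad_poly:
  fixes y :: 'l
  assumes r: "r > 0"
  defines "w \<equiv> \<lambda>x. y + (bump z r x / bump z r z) *\<^sub>R quad_poly z \<alpha> \<beta> x"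
  shows "Ck_on k UNIV w" and "pd j w z = \<alpha> j" and "pd i (pd j w) z = \<beta> i j"
proof -
  let ?b = "\<lambda>x. bump z r x / bump z r z" and ?q = "quad_poly z \<alpha> \<beta>"
  have b0: "bump z r z > 0" using r by (simp add: bump_pos_iff)
  have bC: "Ck_on k UNIV ?b" for k
    unfolding divide_inverse by (intro Ck_on_mult Ck_on_bump Ck_on_const open_UNIV)
  show w: "Ck_on k UNIV w" for k unfolding w_def
    by (intro Ck_on_add Ck_on_scaleR bC Ck_on_quad_poly Ck_on_const open_UNIV)
  have d: "?b differentiable (at x)" "?q differentiable (at x)" "pd j ?q differentiable (at x)" "pd j ?b differentiable (at x)" for x j
    using Ck_on_imp_differentiable[OF bC[of 1]] Ck_on_imp_differentiable[OF Ck_on_quad_poly[of 1]]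
      Ck_on_imp_differentiable[OF Ck_on_dderiv[OF bC[of "Suc 1"]]] Ck_on_imp_differentiable[OF Ck_on_dderiv[OF Ck_on_quad_poly[of "Suc 1"]]]
    by (simp_all add: pd_def[abs_def])
  have pb0: "pd j ?b z = 0" for j
  proof -
    have "bump z r differentiable (at z)"
      by (rule Ck_on_imp_differentiable[OF Ck_on_bump[OF open_UNIV, of 1]]) auto
    from has_derivative_mult_left[OF differentiable_has_dderiv[OF this], of "inverse (bump z r z)"]
    show ?thesis unfolding pd_def divide_inverse by (subst dderiv_eqI) (auto simp: dderiv_bump_center)
  qed
  have pw: "pd j w x = ?b x *\<^sub>R pd j ?q x + pd j ?b x *\<^sub>R ?q x" for j x
  proof -
    have "(w has_derivative (\<lambda>v. 0 + (?b x *\<^sub>R dderiv ?q v x + dderiv ?b v x *\<^sub>R ?q x))) (at x)"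
      unfolding w_def by (intro has_derivative_add has_derivative_const has_derivative_scaleR differentiable_has_dderiv d)
    then show ?thesis unfolding pd_def by (subst dderiv_eqI) auto
  qed
  show "pd j w z = \<alpha> j" using b0 by (simp add: pw pb0 pd_quad_poly)
  have "pd i (pd j w) z = (?b z *\<^sub>R pd i (pd j ?q) z + pd i ?b z *\<^sub>R pd j ?q z)
      + (pd j ?b z *\<^sub>R pd i ?q z + pd i (pd j ?b) z *\<^sub>R ?q z)"
    unfolding pw[abs_def] pd_def[of i]
    by (rule dderiv_eqI) (intro has_derivative_add has_derivative_scaleR differentiable_has_dderiv d)
  then show "pd i (pd j w) z = \<beta> i j" using b0 by (simp add: pb0 pd2_quad_poly quad_poly_center)
qed

end


text \<open>In the straightened picture of \<open>N\<close> the map is a polynomial with cut-off. Its linear coefficients are the images of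
  the first derivatives under \<open>D\<Phi>\<close>; the quadratic ones are corrected by the Christoffel symbols of \<open>M\<close> and by the
  tangential part of the second derivative of \<open>\<Psi>\<close>, which both enter the covariant Hessian. Because the polynomial
  vanishes at \<open>x0\<close>, a small support of the cut-off keeps the values in \<open>W\<close>.\<close>

lemma map_with_prescribed_jet:
  fixes M :: "('m, 'n::finite) manifold" and N :: "'l::euclidean_space set"
  assumes M: "riemannian_manifold M" and c: "c \<in> atlas M" and N: "embedded_submanifold d N"
    and x0: "x0 \<in> cimg c" and y0: "y0 \<in> N"
    and A: "\<And>i. A i \<in> tangent_space N y0" and h: "\<And>i j. h i j \<in> tangent_space N y0" "\<And>i j. h i j = h j i"
  obtains u where "smooth_map M N u" "loc c u x0 = y0" "\<And>i. pd i (loc c u) x0 = A i" "\<And>i j. hess M c N u x0 i j = h i j"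
proof -
  obtain Y W \<Phi> \<Psi> S where sc: "slice_chart d N Y W \<Phi> \<Psi> S" and y0Y: "y0 \<in> Y"
    using slice_chart_exists[OF N y0] by metis
  note sub = subspace_tangent_space[OF N y0]
  have Phi_in: "dderiv \<Phi> v y0 \<in> S" if "v \<in> tangent_space N y0" for v
    using that tangent_space_iff[OF sc y0Y y0] by simp
  let ?C = "christoffel M c x0"
  define \<alpha> where "\<alpha> i = dderiv \<Phi> (A i) y0" for i
  define D2 where "D2 i j = dderiv (dderiv \<Psi> (\<alpha> j)) (\<alpha> i) (\<Phi> y0)" for i j
  have w0: "\<Phi> y0 \<in> W" by (rule slice_Phi_in[OF sc y0Y])
  have D2s: "D2 i j = D2 j i" for i j
    unfolding D2_def by (rule dderiv_commute[OF slice_open(2)[OF sc] w0 slice_smooth(2)[OF sc]])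
  define B where "B i j = h i j + (\<Sum>k\<in>UNIV. ?C k i j *\<^sub>R A k) - tangential N y0 (D2 i j)" for i j
  have BT: "B i j \<in> tangent_space N y0" for i j unfolding B_def
    by (intro subspace_diff[OF sub] subspace_add[OF sub] subspace_sum[OF sub] subspace_scale[OF sub] h A tangential_in[OF sub])
  have Bs: "B i j = B j i" for i j
    unfolding B_def using h(2)[of i j] D2s[of i j] christoffel_sym[OF M c x0] by simp
  define \<beta> where "\<beta> i j = dderiv \<Phi> (B i j) y0" for i j
  have \<beta>s: "\<beta> i j = \<beta> j i" for i j unfolding \<beta>_def by (simp add: Bs[of i j])
  have qS: "quad_poly x0 \<alpha> \<beta> x \<in> S" for x
    unfolding quad_poly_def \<alpha>_def \<beta>_def
    by (intro subspace_add subspace_sum subspace_scale slice_subspace[OF sc] Phi_in A BT)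
  obtain \<delta> where \<delta>: "\<delta> > 0" "ball (\<Phi> y0) \<delta> \<subseteq> W"
    using slice_open(2)[OF sc] w0 open_contains_ball by blast
  have "isCont (quad_poly x0 \<alpha> \<beta>) x0"
    using Ck_on_imp_continuous_on[OF Ck_on_quad_poly[of 0 x0 \<alpha> \<beta>]] by (simp add: continuous_on_eq_continuous_at)
  then obtain r1 where r1: "r1 > 0" "\<And>x. dist x x0 < r1 \<Longrightarrow> norm (quad_poly x0 \<alpha> \<beta> x) < \<delta>"
    using \<delta>(1) quad_poly_center[of x0 \<alpha> \<beta>] unfolding continuous_at_eps_delta by (metis dist_0_norm dist_commute)
  obtain r2 where r2: "r2 > 0" "cball x0 r2 \<subseteq> cimg c" using open_cimg[OF M c] x0 open_contains_cball by blast
  define r where "r = min r1 r2"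
  have r: "r > 0" "cball x0 r \<subseteq> cimg c" using r1 r2 by (auto simp: r_def)
  define w where "w x = \<Phi> y0 + (bump x0 r x / bump x0 r x0) *\<^sub>R quad_poly x0 \<alpha> \<beta> x" for x
  have wdef: "w = (\<lambda>x. \<Phi> y0 + (bump x0 r x / bump x0 r x0) *\<^sub>R quad_poly x0 \<alpha> \<beta> x)" by (simp add: w_def fun_eq_iff)
  note jet = cutoff_quad_poly[where \<beta> = \<beta> and z = x0, OF \<beta>s r(1), where \<alpha> = \<alpha> and y = "\<Phi> y0", folded wdef]
  have wx0: "w x0 = \<Phi> y0" by (simp add: w_def quad_poly_center)
  have b0: "bump x0 r x0 > 0" using r(1) by (simp add: bump_pos_iff)
  have wout: "w x = \<Phi> y0" if "x \<notin> cball x0 r" for x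
  proof -
    have "bump x0 r x = 0" using that r(1) by (intro bump_eq_0) auto
    then show ?thesis by (simp add: w_def)
  qed
  have wW: "w x \<in> W" for x
  proof (cases "x \<in> ball x0 r")
    case True
    have "norm ((bump x0 r x / bump x0 r x0) *\<^sub>R quad_poly x0 \<alpha> \<beta> x) \<le> 1 * norm (quad_poly x0 \<alpha> \<beta> x)"
      unfolding norm_scaleR using b0 bump_le_center[of x0 r x] bump_nonneg[of x0 r x] by (intro mult_right_mono) auto
    also have "\<dots> < \<delta>" using r1(2)[of x] True by (simp add: r_def dist_commute)
    finally show ?thesis using \<delta>(2) by (auto simp: w_def dist_norm)
  next
    case False
    then have "bump x0 r x = 0" using r(1) by (intro bump_eq_0) auto
    then show ?thesis using w0 by (simp add: w_def)
  qed
  have wS: "w x \<in> S" for x unfolding w_def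
    by (intro subspace_add subspace_scale slice_subspace[OF sc] qS slice_Phi_S[OF sc y0Y y0])
  define u where "u m = (if m \<in> cdom c then \<Psi> (w (cmap c m)) else y0)" for m
  have uN: "u m \<in> N" for m using slice_Psi_N[OF sc wW wS] y0 by (simp add: u_def)
  have locu: "loc c u x = \<Psi> (w x)" if "x \<in> cimg c" for x
    using cinv_in[OF M c that] cmap_cinv[OF M c that] by (simp add: loc_def u_def)
  have PW: "Ck_on k UNIV (\<lambda>x. \<Psi> (w x))" for k
    by (rule Ck_on_compose[OF open_UNIV jet(1) slice_smooth(2)[OF sc] wW])
  have oc: "open (cimg c)" by (rule open_cimg[OF M c])
  have Ccu: "Ck_on k (cimg c) (loc c u)" for k
    by (rule Ck_on_cong[OF oc _ Ck_on_subset[OF PW]]) (auto simp: locu)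
  have smooth: "smooth_map M N u"
    unfolding smooth_map_def smooth_on_def
  proof (intro conjI ballI allI uN)
    fix c' k assume c': "c' \<in> atlas M"
    have "Ck_on k (cimg c') (\<lambda>x. u (cinv c' x) - y0)"
    proof (rule Ck_on_all_charts'[OF M c c' compact_cball r(2)])
      have "Ck_on k (cimg c) (\<lambda>x. loc c u x - y0)" by (intro Ck_on_diff oc Ccu Ck_on_const)
      then show "Ck_on k (cimg c) (\<lambda>x. u (cinv c x) - y0)" by (simp add: loc_def)
      fix m assume "m \<notin> cinv c ` cball x0 r"
      then have "m \<in> cdom c \<Longrightarrow> cmap c m \<notin> cball x0 r" using cinv_image_eq[OF M c r(2)] by blast
      then show "u m - y0 = 0" using wout slice_Psi_Phi[OF sc y0Y] by (auto simp: u_def)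
    qed
    then have "Ck_on k (cimg c') (\<lambda>x. (u (cinv c' x) - y0) + y0)"
      by (intro Ck_on_add open_cimg[OF M c'] Ck_on_const)
    then show "Ck_on k (cimg c') (loc c' u)" by (simp add: loc_def o_def)
  qed
  have wd: "w differentiable (at x)" for x by (rule Ck_on_imp_differentiable[OF jet(1)[of 1]]) auto
  have pdu: "pd j (loc c u) x = dderiv \<Psi> (pd j w x) (w x)" if "x \<in> cimg c" for j x
  proof -
    have "dderiv (loc c u) (axis j 1) x = dderiv (\<lambda>x. \<Psi> (w x)) (axis j 1) x"
      by (rule dderiv_cong[OF oc that locu Ck_on_imp_differentiable[OF Ccu[of 1] _ that]]) auto
    then show ?thesis using dderiv_compose[OF wd slice_Psi_diff[OF sc wW]] by (simp add: pd_def)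
  qed
  have pd1: "pd j (loc c u) x0 = A j" for j
    using pdu[OF x0, of j] wx0 jet(2) slice_inverse1[OF sc y0Y] by (simp add: \<alpha>_def)
  have pd2: "pd i (pd j (loc c u)) x0 = D2 i j + B i j" for i j
  proof -
    have e: "pd j (loc c u) x = pd j (\<lambda>x. \<Psi> (w x)) x" if "x \<in> cimg c" for x
      using pdu[OF that, of j] dderiv_compose[OF wd slice_Psi_diff[OF sc wW]] by (simp add: pd_def)
    have d: "pd j (loc c u) differentiable (at x0)"
      using Ck_on_imp_differentiable[OF Ck_on_dderiv[OF Ccu[of "Suc 1"]] _ x0] by (simp add: pd_def[abs_def])
    have "pd i (pd j (loc c u)) x0 = dderiv (dderiv (\<lambda>x. \<Psi> (w x)) (axis j 1)) (axis i 1) x0"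
      unfolding pd_def[of i] by (rule dderiv_cong[OF oc x0 _ d]) (use e in \<open>simp add: pd_def\<close>)
    also have "\<dots> = dderiv (dderiv \<Psi> (dderiv w (axis j 1) x0)) (dderiv w (axis i 1) x0) (w x0)
        + dderiv \<Psi> (dderiv (dderiv w (axis j 1)) (axis i 1) x0) (w x0)"
      by (rule dderiv2_compose[OF open_UNIV _ jet(1) slice_open(2)[OF sc] slice_smooth(2)[OF sc] wW]) auto
    also have "\<dots> = D2 i j + B i j"
      using wx0 jet(2)[of i] jet(2)[of j] jet(3)[of i j] slice_inverse1[OF sc y0Y, of "B i j"]
      by (simp add: D2_def pd_def[abs_def] \<beta>_def)
    finally show ?thesis .
  qed
  have lx0: "loc c u x0 = y0" using locu[OF x0] wx0 slice_Psi_Phi[OF sc y0Y] by simp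
  have "hess M c N u x0 i j = h i j" for i j
    unfolding hess_def lx0 pd2 pd1
    by (simp add: tangential_add[OF sub] tangential_id[OF sub BT]) (simp add: B_def)
  then show ?thesis using that smooth lx0 pd1 by blast
qed

text \<open>The jet has \<open>E\<close> and \<open>H\<close> concentrated in two frame directions \<open>k0\<close>, \<open>k1\<close> and two tangent directions \<open>e1\<close>, \<open>e2\<close> of
  \<open>N\<close>: the derivative at \<open>k0\<close> and the diagonal of the Hessian point along \<open>e1\<close>, the derivative at \<open>k1\<close> and the mixed
  second derivative along \<open>e2\<close>. This makes every Cauchy-Schwarz estimate in \<open>refined_Kato_pointwise\<close> an equality.\<close>

lemma extremal_map_exists:
  fixes M :: "('m, 'n::finite) manifold" and N :: "'l::euclidean_space set"
  assumes M: "riemannian_manifold M" and c: "c \<in> atlas M" and N: "embedded_submanifold d N" and d: "d \<ge> 2"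
    and n: "CARD('n) \<ge> 2" and p: "p > 1" and x0: "x0 \<in> cimg c"
  obtains u where "smooth_map M N u" "grad_norm M c u x0 \<noteq> 0" "solves_p_harmonic_eq_at M c N p u x0"
    "grad_grad_norm M c u x0 \<noteq> 0" "kappa p CARD('n) * (grad_grad_norm M c u x0)\<^sup>2 = (hess_norm M c N u x0)\<^sup>2"
proof -
  obtain y0 where y0: "y0 \<in> N" using N by (auto simp: embedded_submanifold_def)
  note sub = subspace_tangent_space[OF N y0]
  obtain e1 e2 where e: "e1 \<in> tangent_space N y0" "e2 \<in> tangent_space N y0" "e1 \<bullet> e1 = 1" "e2 \<bullet> e2 = 1" "e1 \<bullet> e2 = 0" "e2 \<bullet> e1 = 0"
  proof -
    obtain B where B: "B \<subseteq> tangent_space N y0" "pairwise orthogonal B" "\<And>x. x \<in> B \<Longrightarrow> norm x = 1"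
       "card B = dim (tangent_space N y0)"
      using orthonormal_basis_subspace[OF sub] by metis
    have "2 \<le> card B" using B(4) dim_tangent_space[OF N y0] d by simp
    then have "finite B" "\<not> card B \<le> Suc 0" by (auto intro: card_ge_0_finite)
    then obtain a b where "a \<in> B" "b \<in> B" "a \<noteq> b" by (auto simp: card_le_Suc0_iff_eq)
    then show ?thesis
      using that[of a b] B by (auto simp: pairwise_def orthogonal_def norm_eq_1 subset_iff)
  qed
  obtain P where P: "frame (metric M c x0) P" using pos_def_frame_exists[OF pos_def_metric[OF M c x0]] .
  obtain k0 k1 :: 'n where k: "k0 \<noteq> k1"
  proof -
    have "\<exists>k0 k1 :: 'n. k0 \<noteq> k1"
    proof (rule ccontr)
      assume "\<nexists>k0 k1 :: 'n. k0 \<noteq> k1"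
      then have "(UNIV :: 'n set) = {undefined}" by auto
      then have "CARD('n) = card {undefined :: 'n}" by (rule arg_cong)
      then show False using n by simp
    qed
    then show ?thesis using that by blast
  qed
  obtain s cc a b h where ex: "s\<^sup>2 + cc\<^sup>2 = 1" "a * s + cc * h = 1" "a + (real CARD('n) - 1) * b + (p - 2) * s = 0"
    "a\<^sup>2 + (real CARD('n) - 1) * b\<^sup>2 + 2 * h\<^sup>2 = kappa p CARD('n)"
    using kappa_extremal[OF n p] by metis
  define E where "E k = (if k = k0 then s *\<^sub>R e1 else if k = k1 then cc *\<^sub>R e2 else 0)" for k
  define H where "H k l = (if k = l then (if k = k0 then a *\<^sub>R e1 else b *\<^sub>R e1)
      else if k = k0 \<and> l = k1 \<or> k = k1 \<and> l = k0 then h *\<^sub>R e2 else 0)" for k l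
  have Hs: "H k l = H l k" for k l by (auto simp: H_def)
  let ?q = "\<lambda>k. metric M c x0 *v P k"
  define A where "A i = (\<Sum>k\<in>UNIV. ?q k $ i *\<^sub>R E k)" for i
  define hs where "hs i j = (\<Sum>k\<in>UNIV. ?q k $ i *\<^sub>R (\<Sum>l\<in>UNIV. ?q l $ j *\<^sub>R H k l))" for i j
  have AT: "A i \<in> tangent_space N y0" for i unfolding A_def E_def
    by (intro subspace_sum[OF sub] subspace_scale[OF sub]) (auto intro: subspace_scale[OF sub] subspace_0[OF sub] e)
  have hT: "hs i j \<in> tangent_space N y0" for i j unfolding hs_def H_def
    by (intro subspace_sum[OF sub] subspace_scale[OF sub]) (auto intro: subspace_scale[OF sub] subspace_0[OF sub] e)
  have hsym: "hs i j = hs j i" for i j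
  proof -
    have "hs i j = (\<Sum>l\<in>UNIV. \<Sum>k\<in>UNIV. (?q k $ i * ?q l $ j) *\<^sub>R H k l)"
      unfolding hs_def by (subst sum.swap) (simp add: scaleR_sum_right)
    then show ?thesis unfolding hs_def by (simp add: scaleR_sum_right Hs[of _ _] mult.commute)
  qed
  obtain u where u: "smooth_map M N u" "loc c u x0 = y0" "\<And>i. pd i (loc c u) x0 = A i" "\<And>i j. hess M c N u x0 i j = hs i j"
    using map_with_prescribed_jet[where A = A and h = hs, OF M c N x0 y0 AT hT hsym] by metis
  have split: "sum f UNIV = f k0 + (f k1 + sum f (UNIV - {k0, k1}))" for f :: "'n \<Rightarrow> 'z::comm_monoid_add"
  proof -
    have "sum f UNIV = f k0 + sum f (UNIV - {k0})" by (rule sum.remove) auto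
    also have "sum f (UNIV - {k0}) = f k1 + sum f (UNIV - {k0} - {k1})" using k by (intro sum.remove) auto
    finally show ?thesis by (simp add: Diff_insert2[symmetric] insert_commute)
  qed
  have crest: "real (card (UNIV - {k0, k1})) = real CARD('n) - 2"
    using k n by (simp add: card_Diff_subset of_nat_diff)
  have fg: "(\<Sum>i\<in>UNIV. P k $ i *\<^sub>R pd i (loc c u) x0) = E k" for k
    unfolding u(3) A_def by (rule dual_frame_sum[OF P])
  have gsq: "grad_sq M c u x0 = 1"
  proof -
    have "grad_sq M c u x0 = (\<Sum>k\<in>UNIV. E k \<bullet> E k)"
      unfolding grad_sq_def[OF M c] fg[symmetric]
      by (rule frame_sum_inner) (simp add: ginv_def matrix_inv_frame[OF P])
    also have "\<dots> = 1" unfolding split using k ex(1) by (simp add: E_def e power2_eq_square)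
    finally show ?thesis .
  qed
  then have gpos: "0 < grad_sq M c u x0" by simp
  have gn: "grad_norm M c u x0 = 1" using gsq by (simp add: grad_norm_eq[OF M c])
  have uC: "Ck_on 2 (cimg c) (loc c u)" using u(1) c by (simp add: smooth_map_def smooth_on_def)
  have uN: "\<And>x. x \<in> cimg c \<Longrightarrow> loc c u x \<in> N"
    using u(1) cinv_in[OF M c] cdom_subset[OF M c] by (auto simp: smooth_map_def loc_def)
  note ctx = M c open_cimg[OF M c] subset_refl uC N uN x0 gpos
  have fG: "frame_grad c u x0 P k = E k" for k
    using fg[of k] frame_grad_def[OF ctx P] by simp
  have fH: "frame_hess M c u N x0 P k l = H k l" for k l
    using frame_hess_def[OF ctx P] dual_frame_sum2[OF P, of k l H] unfolding u(4) hs_def by simp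
  have "(\<Sum>l\<in>UNIV. H k l \<bullet> E l) = (if k = k0 then 1 else 0)" for k
    unfolding split using k ex(2) by (auto simp: E_def H_def e mult.commute)
  then have fW: "frame_dnorm M c u x0 P k = (if k = k0 then 1 else 0)" for k
    using frame_dnorm_eq[OF ctx P, of k] by (simp add: gn fG fH)
  have trH: "(\<Sum>k\<in>UNIV. H k k) = (a + (real CARD('n) - 1) * b) *\<^sub>R e1"
  proof -
    have "(\<Sum>k\<in>UNIV - {k0, k1}. H k k) = (\<Sum>k\<in>UNIV - {k0, k1}. b *\<^sub>R e1)"
      by (rule sum.cong) (auto simp: H_def)
    also have "\<dots> = ((real CARD('n) - 2) * b) *\<^sub>R e1" by (simp add: scaleR_left.sum[symmetric] sum_constant crest scaleR_sum_left[symmetric] flip: crest)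
    finally have R: "(\<Sum>k\<in>UNIV - {k0, k1}. H k k) = ((real CARD('n) - 2) * b) *\<^sub>R e1" .
    have Hk: "H k0 k0 = a *\<^sub>R e1" "H k1 k1 = b *\<^sub>R e1" using k by (simp_all add: H_def)
    have "a + (b + (real CARD('n) - 2) * b) = a + (real CARD('n) - 1) * b" by (simp add: algebra_simps)
    then show ?thesis unfolding split R Hk scaleR_add_left[symmetric] by simp
  qed
  have "p_tension M c u N x0 p = 0"
  proof -
    have "(\<Sum>k\<in>UNIV. (if k = k0 then 1 else 0) *\<^sub>R E k) = s *\<^sub>R e1"
      unfolding split using k by (simp add: E_def)
    then have "p_tension M c u N x0 p = (a + (real CARD('n) - 1) * b + (p - 2) * s) *\<^sub>R e1"
      using frame_p_tension[OF ctx P, of p] by (simp add: gn fG fH fW trH scaleR_add_left)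
    then show ?thesis using ex(3) by simp
  qed
  then have solves: "solves_p_harmonic_eq_at M c N p u x0"
    using solves_p_harmonic_eq_iff[OF ctx] by simp
  have gg: "(grad_grad_norm M c u x0)\<^sup>2 = 1"
  proof -
    have "(grad_grad_norm M c u x0)\<^sup>2 = (\<Sum>k\<in>UNIV. (if k = k0 then 1 else 0)\<^sup>2)"
      using frame_grad_grad_norm[OF ctx P] by (simp add: fW)
    then show ?thesis unfolding split using k by simp
  qed
  have hh: "(hess_norm M c N u x0)\<^sup>2 = kappa p CARD('n)"
  proof -
    have "(hess_norm M c N u x0)\<^sup>2 = (\<Sum>k\<in>UNIV. \<Sum>l\<in>UNIV. (norm (H k l))\<^sup>2)"
      using frame_hess_norm[OF ctx P] by (simp add: fH)
    also have "\<dots> = (\<Sum>k\<in>UNIV. if k = k0 then a\<^sup>2 + h\<^sup>2 else if k = k1 then h\<^sup>2 + b\<^sup>2 else b\<^sup>2)"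
    proof (rule sum.cong[OF refl])
      fix k
      have n1: "norm e1 = 1" "norm e2 = 1" using e by (simp_all add: norm_eq_1)
      have "(norm (H k l))\<^sup>2 = (if l = k then (if k = k0 then a\<^sup>2 else b\<^sup>2) else 0)
         + ((if l = k1 then (if k = k0 then h\<^sup>2 else 0) else 0) + (if l = k0 then (if k = k1 then h\<^sup>2 else 0) else 0))" for l
        using k by (auto simp: H_def n1)
      then show "(\<Sum>l\<in>UNIV. (norm (H k l))\<^sup>2) = (if k = k0 then a\<^sup>2 + h\<^sup>2 else if k = k1 then h\<^sup>2 + b\<^sup>2 else b\<^sup>2)"
        using k by (simp add: sum.distrib)
    qed
    also have "\<dots> = a\<^sup>2 + h\<^sup>2 + (h\<^sup>2 + b\<^sup>2 + (\<Sum>k\<in>UNIV - {k0, k1}. b\<^sup>2))"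
      unfolding split using k by simp
    also have "(\<Sum>k\<in>UNIV - {k0, k1}. b\<^sup>2) = (real CARD('n) - 2) * b\<^sup>2" by (simp only: sum_constant crest)
    also have "a\<^sup>2 + h\<^sup>2 + (h\<^sup>2 + b\<^sup>2 + (real CARD('n) - 2) * b\<^sup>2) = kappa p CARD('n)"
      unfolding ex(4)[symmetric] by (simp add: algebra_simps)
    finally show ?thesis .
  qed
  show ?thesis
    by (rule that[OF u(1) _ solves]) (use gn gg hh in auto)
qed

section \<open>The sharp constant for p-harmonic maps\<close>

theorem theorem2p2:
  fixes M :: "('m, 'n::finite) manifold"
    and N :: "'l::euclidean_space set"
    and d :: nat and p :: real
  assumes "riemannian_manifold M" and "CARD('n) \<ge> 2"
    and "embedded_submanifold d N" and "d \<ge> 2"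
    and "p > 1"
  shows "(\<forall>u c q. p_harmonic_map M N p u \<and> c \<in> atlas M \<and> q \<in> cdom c \<and> C2_near c u q \<and>
            grad_norm M c u (cmap c q) \<noteq> 0 \<longrightarrow>
            kappa p CARD('n) * (grad_grad_norm M c u (cmap c q))\<^sup>2
              \<le> (hess_norm M c N u (cmap c q))\<^sup>2)
       \<and> (\<forall>c q. c \<in> atlas M \<and> q \<in> cdom c \<longrightarrow>
            (\<exists>u. smooth_map M N u \<and>
               grad_norm M c u (cmap c q) \<noteq> 0 \<and>
               solves_p_harmonic_eq_at M c N p u (cmap c q) \<and>
               grad_grad_norm M c u (cmap c q) \<noteq> 0 \<and>
               kappa p CARD('n) * (grad_grad_norm M c u (cmap c q))\<^sup>2
                 = (hess_norm M c N u (cmap c q))\<^sup>2))"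
proof (intro conjI allI impI)
  fix u c q
  assume a: "p_harmonic_map M N p u \<and> c \<in> atlas M \<and> q \<in> cdom c \<and> C2_near c u q \<and>
            grad_norm M c u (cmap c q) \<noteq> 0"
  then have c: "c \<in> atlas M" and ph: "p_harmonic_map M N p u" by auto
  obtain V where V: "open V" "V \<subseteq> cimg c" and q: "cmap c q \<in> V" and u: "Ck_on 2 V (loc c u)"
    using a by (auto simp: C2_near_def)
  have gpos: "0 < grad_sq M c u (cmap c q)"
    using a grad_norm_pos_iff[OF assms(1) c, of "cmap c q" u] V q by auto
  have uN: "loc c u x \<in> N" if "x \<in> V" for x
    using ph that V cinv_in[OF assms(1) c, of x] cdom_subset[OF assms(1) c]
    by (auto simp: p_harmonic_map_def W1p_def loc_def)
  have t: "p_tension M c u N (cmap c q) p = 0"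
    by (rule p_harmonic_imp_tension_zero[OF assms(1) c assms(3,5) ph V u q gpos])
  show "kappa p CARD('n) * (grad_grad_norm M c u (cmap c q))\<^sup>2 \<le> (hess_norm M c N u (cmap c q))\<^sup>2"
    by (rule refined_Kato[OF assms(1) c assms(3,2,5) V u uN q gpos t])
next
  fix c q assume "c \<in> atlas M \<and> q \<in> cdom c"
  then have "c \<in> atlas M" "cmap c q \<in> cimg c" by (auto simp: cimg_def)
  then show "\<exists>u. smooth_map M N u \<and>
               grad_norm M c u (cmap c q) \<noteq> 0 \<and>
               solves_p_harmonic_eq_at M c N p u (cmap c q) \<and>
               grad_grad_norm M c u (cmap c q) \<noteq> 0 \<and>
               kappa p CARD('n) * (grad_grad_norm M c u (cmap c q))\<^sup>2
                 = (hess_norm M c N u (cmap c q))\<^sup>2"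
    using extremal_map_exists[OF assms(1) _ assms(3,4,2,5)] by metis
qed

end
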